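(* Let $\Omega\subset\mathbb{R}^N$ ($N\ge 2$) be a smooth bounded domain, let $p>1$ and $0\le\gamma<\gamma_1$. Then $$\Lambda_\gamma:=\sup_{u\in W^{1,N}_0(\Omega),\ \|u\|_{N,F,\gamma,p}\le 1}\int_\Omega e^{\lambda_N|u|^{\frac{N}{N-1}}}\,dx<+\infty .$$
   Context: $F:\mathbb{R}^N\to[0,\infty)$ is a convex function of class $C^2(\mathbb{R}^N\setminus\{0\})$, even and positively homogeneous of degree 1 (i.e. $F(t\xi)=|t|F(\xi)$ for all $t\in\mathbb{R},\xi\in\mathbb{R}^N$), with $F(\xi)>0$ for $\xi\neq 0$ and $\mathrm{Hess}(F^2)$ positive definite on $\mathbb{R}^N\setminus\{0\}$. Its polar is $F^o(x)=\sup_{\xi\neq 0}\langle x,\xi\rangle/F(\xi)$. The Wulff ball of radius $r$ centered at $x_0$ is $\mathcal{W}_r(x_0)=\{x: F^o(x-x_0)\le r\}$, and $\kappa_N$ is the Lebesgue measure of $\mathcal{W}_1(0)$. Set $\lambda_N=N^{\frac{N}{N-1}}\kappa_N^{\frac{1}{N-1}}$. For $p>1$ let $\gamma_1=\inf_{u\in W^{1,N}_0(\Omega)\setminus\{0\}}\frac{\int_\Omega F^N(\nabla u)\,dx}{\|u\|_p^N}$ and $\|u\|_{N,F,\gamma,p}=\big(\int_\Omega F^N(\nabla u)\,dx-\gamma\|u\|_p^N\big)^{1/N}$, where $\|\cdot\|_p$ is the $L^p(\Omega)$ norm. *)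

theory Defs
  imports "HOL-Analysis.Analysis"
begin

definition pd :: "(real^'n \<Rightarrow> real) \<Rightarrow> 'n \<Rightarrow> real^'n \<Rightarrow> real" where
  "pd f i x = frechet_derivative f (at x) (axis i 1)"

definition grad :: "(real^'n \<Rightarrow> real) \<Rightarrow> real^'n \<Rightarrow> real^'n" where
  "grad f x = (\<chi> i. pd f i x)"

fun Ck_on :: "nat \<Rightarrow> (real^'n \<Rightarrow> real) \<Rightarrow> (real^'n) set \<Rightarrow> bool" where
  "Ck_on 0 f S = continuous_on S f"
| "Ck_on (Suc k) f S = (f differentiable_on S \<and> continuous_on S f \<and> (\<forall>i. Ck_on k (pd f i) S))"

definition smooth_on :: "(real^'n \<Rightarrow> real) \<Rightarrow> (real^'n) set \<Rightarrow> bool" where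
  "smooth_on f S = (\<forall>k. Ck_on k f S)"

definition admissible_F :: "(real^'n \<Rightarrow> real) \<Rightarrow> bool" where
  "admissible_F F \<longleftrightarrow>
     convex_on UNIV F \<and> (\<forall>x. F x \<ge> 0) \<and>
     Ck_on 2 F (UNIV - {0}) \<and>
     (\<forall>t \<xi>. F (t *\<^sub>R \<xi>) = \<bar>t\<bar> * F \<xi>) \<and>
     (\<forall>\<xi>. \<xi> \<noteq> 0 \<longrightarrow> F \<xi> > 0) \<and>
     (\<forall>\<xi> v. \<xi> \<noteq> 0 \<longrightarrow> v \<noteq> 0 \<longrightarrow>
        (\<Sum>i\<in>UNIV. \<Sum>j\<in>UNIV. pd (pd (\<lambda>x. (F x)\<^sup>2) i) j \<xi> * v$i * v$j) > 0)"

definition polar :: "(real^'n \<Rightarrow> real) \<Rightarrow> real^'n \<Rightarrow> real" where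
  "polar F x = (SUP \<xi>\<in>UNIV - {0}. (x \<bullet> \<xi>) / F \<xi>)"

definition kappa :: "(real^'n \<Rightarrow> real) \<Rightarrow> real" where
  "kappa F = measure lebesgue {x. polar F x \<le> 1}"

definition lambdaN :: "(real^'n \<Rightarrow> real) \<Rightarrow> real" where
  "lambdaN F = (let N = real CARD('n) in N powr (N / (N - 1)) * kappa F powr (1 / (N - 1)))"

definition smooth_bounded_domain :: "(real^'n) set \<Rightarrow> bool" where
  "smooth_bounded_domain \<Omega> \<longleftrightarrow> open \<Omega> \<and> connected \<Omega> \<and> \<Omega> \<noteq> {} \<and> bounded \<Omega> \<and>
     (\<forall>x\<in>frontier \<Omega>. \<exists>U \<psi>. open U \<and> x \<in> U \<and> smooth_on \<psi> U \<and>
        (\<forall>y\<in>U. grad \<psi> y \<noteq> 0) \<and> \<Omega> \<inter> U = {y\<in>U. \<psi> y < 0})"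

definition test_fun :: "(real^'n) set \<Rightarrow> (real^'n \<Rightarrow> real) \<Rightarrow> bool" where
  "test_fun \<Omega> \<phi> \<longleftrightarrow> smooth_on \<phi> UNIV \<and> (\<exists>K. compact K \<and> K \<subseteq> \<Omega> \<and> (\<forall>x. x \<notin> K \<longrightarrow> \<phi> x = 0))"

(* (u, g) with u \<in> W^{1,q}_0(\<Omega>) and g its weak gradient: limit of C_c^\<infinity>(\<Omega>)
   functions in the W^{1,q} norm on \<Omega> *)
definition W10 :: "real \<Rightarrow> (real^'n) set \<Rightarrow> (real^'n \<Rightarrow> real) \<Rightarrow> (real^'n \<Rightarrow> real^'n) \<Rightarrow> bool" where
  "W10 q \<Omega> u g \<longleftrightarrow> u \<in> borel_measurable lebesgue \<and> g \<in> borel_measurable lebesgue \<and>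
     (\<exists>\<phi>. (\<forall>k. test_fun \<Omega> (\<phi> k)) \<and>
        ((\<lambda>k. \<integral>\<^sup>+ x\<in>\<Omega>. ennreal (\<bar>\<phi> k x - u x\<bar> powr q) \<partial>lebesgue) \<longlonglongrightarrow> 0) \<and>
        ((\<lambda>k. \<integral>\<^sup>+ x\<in>\<Omega>. ennreal (norm (grad (\<phi> k) x - g x) powr q) \<partial>lebesgue) \<longlonglongrightarrow> 0))"

definition Lp_norm :: "real \<Rightarrow> (real^'n) set \<Rightarrow> (real^'n \<Rightarrow> real) \<Rightarrow> real" where
  "Lp_norm p \<Omega> u = (LINT x:\<Omega>|lebesgue. \<bar>u x\<bar> powr p) powr (1 / p)"

definition gamma1 :: "(real^'n \<Rightarrow> real) \<Rightarrow> real \<Rightarrow> (real^'n) set \<Rightarrow> real" where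
  "gamma1 F p \<Omega> = (let N = real CARD('n) in
     Inf {(LINT x:\<Omega>|lebesgue. F (g x) powr N) / Lp_norm p \<Omega> u powr N | u g.
            W10 N \<Omega> u g \<and> Lp_norm p \<Omega> u \<noteq> 0})"

definition aniso_norm :: "(real^'n \<Rightarrow> real) \<Rightarrow> real \<Rightarrow> real \<Rightarrow> (real^'n) set \<Rightarrow>
    (real^'n \<Rightarrow> real) \<Rightarrow> (real^'n \<Rightarrow> real^'n) \<Rightarrow> real" where
  "aniso_norm F \<gamma> p \<Omega> u g = (let N = real CARD('n) in
     ((LINT x:\<Omega>|lebesgue. F (g x) powr N) - \<gamma> * Lp_norm p \<Omega> u powr N) powr (1 / N))"

end

theory Submission
  imports Defs "HOL-Real_Asymp.Real_Asymp"
begin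

text \<open>
  No symmetrization, blow-up analysis or compactness is used. For a test function \<open>\<phi>\<close>, write
  \<open>v = |\<phi>|\<close> and \<open>\<nu>(t) = |{v \<ge> t}|\<close>. The Brunn-Minkowski inequality gives
  \<open>|{v > t} + \<epsilon> W| - |{v > t}| \<ge> \<epsilon> N \<kappa>\<^sup>1\<^sup>/\<^sup>N |{v > t}|\<^sup>1\<^sup>-\<^sup>1\<^sup>/\<^sup>N\<close> for the Wulff shape \<open>W\<close>, and
  \<open>{v > t} + \<epsilon> W\<close> lies in \<open>{v + \<epsilon> (F(\<nabla>\<phi>) + o(1)) > t}\<close>. Integrating over levels, applying Jensen
  and subdividing yields, with \<open>q = 1/(N-1)\<close> and \<open>e(a,b)\<close> the energy of \<open>\<phi>\<close> on \<open>{a < v < b}\<close>,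
  \<open>\<lambda>\<^sub>N (b - a)\<^sup>1\<^sup>+\<^sup>q \<le> e(a,b)\<^sup>q ln (|{v > a}| / \<nu>(b))\<close>.
  Garsia's argument turns it into Moser's inequality for \<open>(v - L)\<^sub>+\<close> at every level \<open>L\<close>.

  Choose \<open>L\<close> nearly maximizing \<open>t\<^sup>p \<nu>(t)\<^sup>1\<^sup>/\<^sup>2\<close>, and put \<open>s = ln (|\<Omega>| / \<nu>(L))\<close>. Then \<open>\<parallel>v\<parallel>\<^sub>p\<close> is controlled
  by \<open>L e\<^sup>-\<^sup>s\<^sup>/\<^sup>2\<^sup>p\<close>. If \<open>s\<close> is large, the \<open>L\<^sup>p\<close> term is exponentially smaller than the energy below
  \<open>L\<close>, so the energy above \<open>L\<close> is at most \<open>1 - (1 - 2\<eta>) e(0,L)\<close> with \<open>\<eta> s\<close> bounded. If \<open>s\<close> is bounded, then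
  the truncation of \<open>v\<close> at a fixed multiple of \<open>L\<close> carries almost all of \<open>\<parallel>v\<parallel>\<^sub>p\<close>, and the definition of
  \<open>\<gamma>\<^sub>1\<close>, applied to this truncation, shows that the energy above that level is at most
  \<open>1 - \<delta> L\<^sup>N\<close>. In both cases Moser's inequality above the level has exactly the slack
  needed to absorb the shift from \<open>v - L\<close> to \<open>v\<close>.
\<close>

subsection \<open>The Brunn-Minkowski inequality\<close>

text \<open>At the critical exponent no factor may be lost, so the energy allowance is divided
  between the parts below and above a level by convexity: if the part above has energy at most
  \<open>1 - \<sigma>\<close>, replacing \<open>v - L\<close> by \<open>v\<close> adds at most
  \<lambda>_N L^(1+q) / \<sigma>^q to the exponent. With \<sigma> close to e(0,L) the level
  inequality bounds this by s + O(1), and e^s is what the factor |{v > L}| \<le> |\<Omega>| e^(-s)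
  in Moser's inequality cancels. With \<sigma> comparable to L^N the powers of \<open>L\<close>
  cancel, since N q = 1 + q.

  The square root in the choice of \<open>L\<close> is a compromise: an exponent below 1 turns
  near-maximality into the integrable bound v^p \<le> C \<nu>(v)^(-1/2), and a positive one leaves
  the decay e^(-s/2).

  Comparing measures of enlarged level sets replaces the coarea formula, so critical points and
  plateaus of \<phi> need no separate treatment. The gap between \<gamma> and \<gamma>_1 is used
  twice, to bound the total energy and to make truncations coercive.\<close>

definition minkowski_sum :: "'a::euclidean_space set \<Rightarrow> 'a set \<Rightarrow> 'a set" where
  "minkowski_sum A B = {x + y |x y. x \<in> A \<and> y \<in> B}"

lemma minkowski_sum_commute: "minkowski_sum A B = minkowski_sum B A"
  unfolding minkowski_sum_def by (metis (no_types, opaque_lifting) add.commute)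

lemma minkowski_sum_mono: "A \<subseteq> A' \<Longrightarrow> B \<subseteq> B' \<Longrightarrow> minkowski_sum A B \<subseteq> minkowski_sum A' B'"
  unfolding minkowski_sum_def by blast

lemma open_minkowski_sum: "open A \<Longrightarrow> open (minkowski_sum A B)"
proof -
  assume "open A"
  have "minkowski_sum A B = (\<Union>y\<in>B. (\<lambda>x. y + x) ` A)"
    unfolding minkowski_sum_def by (auto simp: image_iff) (metis add.commute)+
  then show ?thesis using \<open>open A\<close> by (auto intro: open_translation)
qed

lemma bounded_minkowski_sum: "bounded A \<Longrightarrow> bounded B \<Longrightarrow> bounded (minkowski_sum A B)"
proof -
  assume "bounded A" "bounded B"
  moreover have "minkowski_sum A B = (\<lambda>(x, y). x + y) ` (A \<times> B)"
    unfolding minkowski_sum_def by auto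
  ultimately show ?thesis using bounded_plus by simp
qed

text \<open>Divide by the right side: the arithmetic-geometric mean inequality, applied to the
  ratios \<open>x i / (x i + y i)\<close> and to \<open>y i / (x i + y i)\<close>, bounds the two
  quotients by averages whose sum is 1.\<close>

lemma prod_powr_superadditive:
  fixes x y :: "'b \<Rightarrow> real"
  assumes "finite S" "S \<noteq> {}" and x: "\<And>i. i \<in> S \<Longrightarrow> x i > 0" and y: "\<And>i. i \<in> S \<Longrightarrow> y i > 0"
  shows "(\<Prod>i\<in>S. x i) powr (1 / card S) + (\<Prod>i\<in>S. y i) powr (1 / card S)
           \<le> (\<Prod>i\<in>S. x i + y i) powr (1 / card S)"
proof -
  let ?p = "1 / real (card S)"
  have c: "real (card S) > 0" using assms by (simp add: card_gt_0_iff)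
  have P: "(\<Prod>i\<in>S. x i + y i) > 0" using x y by (intro prod_pos) (simp add: add_pos_pos)
  have am: "(\<Prod>i\<in>S. z i) powr ?p / (\<Prod>i\<in>S. x i + y i) powr ?p \<le> (\<Sum>i\<in>S. z i / (x i + y i) / card S)"
    if "\<And>i. i \<in> S \<Longrightarrow> z i > 0" for z :: "'b \<Rightarrow> real"
  proof -
    have "(\<Prod>i\<in>S. z i / (x i + y i)) powr ?p \<le> (\<Sum>i\<in>S. z i / (x i + y i) / card S)"
    proof (rule arith_geom_mean)
      show "z i / (x i + y i) \<ge> 0" if "i \<in> S" for i
        using that x[of i] y[of i] \<open>\<And>i. i \<in> S \<Longrightarrow> z i > 0\<close>[of i] by simp
    qed (use assms in auto)
    moreover have "(\<Prod>i\<in>S. z i / (x i + y i)) powr ?p = (\<Prod>i\<in>S. z i) powr ?p / (\<Prod>i\<in>S. x i + y i) powr ?p"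
    proof -
      have "(\<Prod>i\<in>S. z i) \<ge> 0" by (rule prod_nonneg) (use that in \<open>auto intro: less_imp_le\<close>)
      then show ?thesis using P by (subst prod_dividef) (simp add: powr_divide)
    qed
    ultimately show ?thesis by simp
  qed
  have "(\<Sum>i\<in>S. x i / (x i + y i) / card S) + (\<Sum>i\<in>S. y i / (x i + y i) / card S) = (\<Sum>i\<in>S. 1 / card S)"
    unfolding sum.distrib[symmetric]
  proof (intro sum.cong refl)
    fix i assume "i \<in> S"
    then have "x i + y i \<noteq> 0" using x[of i] y[of i] by simp
    then show "x i / (x i + y i) / real (card S) + y i / (x i + y i) / real (card S) = 1 / real (card S)"
      by (simp add: add_divide_distrib[symmetric])
  qed
  also have "\<dots> = 1" using c by simp
  finally have "(\<Prod>i\<in>S. x i) powr ?p / (\<Prod>i\<in>S. x i + y i) powr ?p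
      + (\<Prod>i\<in>S. y i) powr ?p / (\<Prod>i\<in>S. x i + y i) powr ?p \<le> 1"
    using am[of x] am[of y] x y by force
  moreover have "(\<Prod>i\<in>S. x i + y i) powr ?p > 0" using P by simp
  ultimately show ?thesis by (simp add: field_simps)
qed

lemma minkowski_sum_box:
  fixes a b c d :: "'a::euclidean_space"
  assumes "box a b \<noteq> {}" "box c d \<noteq> {}"
  shows "box (a + c) (b + d) \<subseteq> minkowski_sum (box a b) (box c d)"
proof
  fix z assume z: "z \<in> box (a + c) (b + d)"
  \<comment> \<open>Each coordinate of \<open>z\<close>, measured from the lower corner as
    \<open>w\<close>, is shared in proportion to the two side lengths, so that \<open>x\<close> and
    \<open>z - x\<close> stay inside their boxes together.\<close>
  define r where "r i = (b \<bullet> i - a \<bullet> i) / ((b \<bullet> i - a \<bullet> i) + (d \<bullet> i - c \<bullet> i))" for i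
  define w where "w i = z \<bullet> i - a \<bullet> i - c \<bullet> i" for i
  define x where "x = (\<Sum>i\<in>Basis. (a \<bullet> i + r i * w i) *\<^sub>R i)"
  have ab: "a \<bullet> i < b \<bullet> i" "c \<bullet> i < d \<bullet> i" if "i \<in> Basis" for i
    using assms that by (auto simp: box_ne_empty)
  have xi: "x \<bullet> i = a \<bullet> i + r i * w i" if "i \<in> Basis" for i
    using that unfolding x_def by simp
  have w: "0 < w i" "w i < (b \<bullet> i - a \<bullet> i) + (d \<bullet> i - c \<bullet> i)" if "i \<in> Basis" for i
    using z that by (auto simp: mem_box inner_add_left w_def algebra_simps)
  have r: "0 < r i" "r i < 1" "r i * ((b \<bullet> i - a \<bullet> i) + (d \<bullet> i - c \<bullet> i)) = b \<bullet> i - a \<bullet> i"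
    if "i \<in> Basis" for i
    using ab[OF that] unfolding r_def by (auto simp: field_simps)
  have "x \<in> box a b"
    unfolding mem_box
  proof
    fix i :: 'a assume i: "i \<in> Basis"
    have "r i * w i < r i * ((b \<bullet> i - a \<bullet> i) + (d \<bullet> i - c \<bullet> i))"
      by (rule mult_strict_left_mono[OF w(2)[OF i] r(1)[OF i]])
    moreover have "0 < r i * w i" using r[OF i] w[OF i] by simp
    ultimately show "a \<bullet> i < x \<bullet> i \<and> x \<bullet> i < b \<bullet> i" using r(3)[OF i] xi[OF i] by linarith
  qed
  moreover have "z - x \<in> box c d"
    unfolding mem_box
  proof
    fix i :: 'a assume i: "i \<in> Basis"
    have e: "(z - x) \<bullet> i = c \<bullet> i + (1 - r i) * w i"
      by (simp add: inner_diff_left xi[OF i] w_def algebra_simps)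
    have "(1 - r i) * w i < (1 - r i) * ((b \<bullet> i - a \<bullet> i) + (d \<bullet> i - c \<bullet> i))"
      by (rule mult_strict_left_mono[OF w(2)[OF i]]) (use r(2)[OF i] in simp)
    also have "\<dots> = d \<bullet> i - c \<bullet> i" using r(3)[OF i] by (simp add: algebra_simps)
    finally have "(1 - r i) * w i < d \<bullet> i - c \<bullet> i" .
    moreover have "0 < (1 - r i) * w i" using r[OF i] w[OF i] by simp
    ultimately show "c \<bullet> i < (z - x) \<bullet> i \<and> (z - x) \<bullet> i < d \<bullet> i" using e by linarith
  qed
  ultimately have "\<exists>x y. z = x + y \<and> x \<in> box a b \<and> y \<in> box c d"
    by (intro exI[of _ x] exI[of _ "z - x"]) auto
  then show "z \<in> minkowski_sum (box a b) (box c d)" unfolding minkowski_sum_def by blast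
qed

lemma measure_box_prod:
  fixes a b :: "'a::euclidean_space"
  assumes "box a b \<noteq> {}"
  shows "measure lebesgue (box a b) = (\<Prod>i\<in>Basis. b \<bullet> i - a \<bullet> i)"
  using assms by (subst measure_completion) (auto simp: measure_lborel_box_eq box_ne_empty less_imp_le inner_diff_left intro!: prod.cong)

lemma brunn_minkowski_box:
  fixes a b c d :: "'a::euclidean_space"
  assumes "box a b \<noteq> {}" "box c d \<noteq> {}"
  shows "measure lebesgue (box a b) powr (1 / DIM('a)) + measure lebesgue (box c d) powr (1 / DIM('a))
     \<le> measure lebesgue (minkowski_sum (box a b) (box c d)) powr (1 / DIM('a))"
proof -
  have ab: "a \<bullet> i < b \<bullet> i" "c \<bullet> i < d \<bullet> i" if "i \<in> Basis" for i
    using assms that by (auto simp: box_ne_empty)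
  then have ne: "box (a + c) (b + d) \<noteq> {}" by (auto simp: box_ne_empty inner_add_left intro!: add_strict_mono)
  have "measure lebesgue (box a b) powr (1 / DIM('a)) + measure lebesgue (box c d) powr (1 / DIM('a))
     \<le> measure lebesgue (box (a + c) (b + d)) powr (1 / DIM('a))"
    using prod_powr_superadditive[of "Basis :: 'a set" "\<lambda>i. b \<bullet> i - a \<bullet> i" "\<lambda>i. d \<bullet> i - c \<bullet> i"] ab
    unfolding measure_box_prod[OF assms(1)] measure_box_prod[OF assms(2)] measure_box_prod[OF ne]
    by (simp add: inner_add_left algebra_simps)
  also have "\<dots> \<le> measure lebesgue (minkowski_sum (box a b) (box c d)) powr (1 / DIM('a))"
  proof (intro powr_mono2 measure_mono_fmeasurable)
    show "minkowski_sum (box a b) (box c d) \<in> lmeasurable"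
      by (intro lmeasurable_open bounded_minkowski_sum open_minkowski_sum bounded_box open_box)
  qed (use minkowski_sum_box[OF assms] in auto)
  finally show ?thesis .
qed

section \<open>Finite families of disjoint boxes, their cuts by hyperplanes, and the Hadwiger-Ohmann
  induction\<close>

definition box_family :: "'a::euclidean_space set set \<Rightarrow> bool" where
  "box_family \<A> \<longleftrightarrow> finite \<A> \<and> disjoint \<A> \<and> (\<forall>P\<in>\<A>. P \<noteq> {} \<and> (\<exists>l u. P = box l u))"

lemma box_family_open: "box_family \<A> \<Longrightarrow> open (\<Union>\<A>)"
  unfolding box_family_def by (auto intro!: open_Union)

lemma box_family_bounded: "box_family \<A> \<Longrightarrow> bounded (\<Union>\<A>)"
  unfolding box_family_def by (auto intro!: bounded_Union)

lemma box_family_pos: assumes "box_family \<A>" "\<A> \<noteq> {}" shows "measure lebesgue (\<Union>\<A>) > 0"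
proof -
  have "\<Union>\<A> \<noteq> {}" using assms unfolding box_family_def by auto
  moreover have "open (\<Union>\<A>)" using box_family_open assms by auto
  moreover have "\<Union>\<A> \<in> lmeasurable" using assms by (intro lmeasurable_open box_family_bounded box_family_open)
  ultimately show ?thesis
    by (metis open_not_negligible measure_nonneg order_le_less negligible_iff_measure0)
qed

definition halfspace_lt :: "'a::euclidean_space \<Rightarrow> real \<Rightarrow> 'a set" where
  "halfspace_lt i t = {x. x \<bullet> i < t}"

definition halfspace_gt :: "'a::euclidean_space \<Rightarrow> real \<Rightarrow> 'a set" where
  "halfspace_gt i t = {x. x \<bullet> i > t}"

lemma box_Int_halfspace_gt:
  assumes "i \<in> Basis"
  shows "box l u \<inter> halfspace_gt i t = box (l + (max (l \<bullet> i) t - l \<bullet> i) *\<^sub>R i) u"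
  using assms unfolding halfspace_gt_def
  by (auto simp: mem_box inner_add_left inner_Basis split: if_splits; force)

lemma box_Int_halfspace_lt:
  assumes "i \<in> Basis"
  shows "box l u \<inter> halfspace_lt i t = box l (u + (min (u \<bullet> i) t - u \<bullet> i) *\<^sub>R i)"
  using assms unfolding halfspace_lt_def
  by (auto simp: mem_box inner_add_left inner_Basis split: if_splits; force)

text \<open>Empty pieces are discarded so that the number of boxes drops strictly when one of them
  misses \<open>H\<close>; the induction in the Brunn-Minkowski inequality runs on this
  number.\<close>

definition cut_family :: "'a::euclidean_space set set \<Rightarrow> 'a set \<Rightarrow> 'a set set" where
  "cut_family \<A> H = (\<lambda>P. P \<inter> H) ` \<A> - {{}}"

lemma cut_family_Union: "\<Union>(cut_family \<A> H) = \<Union>\<A> \<inter> H"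
  unfolding cut_family_def by auto

lemma box_family_cut:
  assumes "box_family \<A>" "i \<in> Basis" "H = halfspace_gt i t \<or> H = halfspace_lt i t"
  shows "box_family (cut_family \<A> H)"
proof -
  have "\<exists>l u. P \<inter> H = box l u" if "P \<in> \<A>" for P
    using assms that box_Int_halfspace_gt[OF assms(2)] box_Int_halfspace_lt[OF assms(2)]
    unfolding box_family_def by metis
  moreover have "disjoint (cut_family \<A> H)"
    using assms(1) unfolding box_family_def cut_family_def disjoint_def by blast
  ultimately show ?thesis using assms(1) unfolding box_family_def cut_family_def by auto
qed

lemma card_cut_family: "finite \<A> \<Longrightarrow> card (cut_family \<A> H) \<le> card \<A>"
  unfolding cut_family_def
  by (metis card_Diff1_le card_image_le finite_imageI le_trans)

lemma card_cut_family_less: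
  assumes "finite \<A>" "P \<in> \<A>" "P \<inter> H = {}"
  shows "card (cut_family \<A> H) < card \<A>"
proof -
  have "cut_family \<A> H \<subseteq> (\<lambda>P. P \<inter> H) ` (\<A> - {P})" using assms unfolding cut_family_def by auto
  then have "card (cut_family \<A> H) \<le> card (\<A> - {P})"
    using assms by (meson card_image_le card_mono finite_Diff finite_imageI le_trans)
  also have "\<dots> < card \<A>" using assms by (meson card_Diff1_less)
  finally show ?thesis .
qed

lemma measure_Un_disjoint:
  "A \<in> fmeasurable M \<Longrightarrow> B \<in> fmeasurable M \<Longrightarrow> A \<inter> B = {} \<Longrightarrow>
    measure M (A \<union> B) = measure M A + measure M B"
  by (simp add: measure_Un3)

lemma measure_halfspace_split:
  fixes A :: "'a::euclidean_space set"
  assumes "A \<in> lmeasurable" "i \<in> Basis"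
  shows "measure lebesgue A = measure lebesgue (A \<inter> halfspace_lt i t) + measure lebesgue (A \<inter> halfspace_gt i t)"
proof -
  have lt: "halfspace_lt i t \<in> sets lebesgue" and gt: "halfspace_gt i t \<in> sets lebesgue"
    unfolding halfspace_lt_def halfspace_gt_def
    by (auto intro!: borel_open open_Collect_less continuous_intros lborelD)
  have n: "negligible {x. x \<bullet> i = t}" using negligible_standard_hyperplane[OF assms(2)] .
  have "measure lebesgue A = measure lebesgue ((A \<inter> halfspace_lt i t) \<union> (A \<inter> halfspace_gt i t))"
    by (rule measure_negligible_symdiff[symmetric, OF _ ])
      (use assms in \<open>auto intro!: negligible_subset[OF n] simp: halfspace_lt_def halfspace_gt_def\<close>)
  also have "\<dots> = measure lebesgue (A \<inter> halfspace_lt i t) + measure lebesgue (A \<inter> halfspace_gt i t)"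
    by (rule measure_Un_disjoint) (use assms lt gt in \<open>auto intro!: fmeasurable_Int_fmeasurable simp: halfspace_lt_def halfspace_gt_def\<close>)
  finally show ?thesis .
qed

lemma measure_box_halfspace_continuous:
  fixes l u i :: "'a::euclidean_space"
  assumes "i \<in> Basis" "box l u \<noteq> {}"
  shows "continuous_on UNIV (\<lambda>t. measure lebesgue (box l u \<inter> halfspace_lt i t))"
proof -
  have lu: "l \<bullet> j < u \<bullet> j" if "j \<in> Basis" for j using assms that by (auto simp: box_ne_empty)
  have "measure lebesgue (box l u \<inter> halfspace_lt i t) =
      max 0 (min (u \<bullet> i) t - l \<bullet> i) * (\<Prod>j\<in>Basis - {i}. u \<bullet> j - l \<bullet> j)" for t
  proof -
    let ?u = "u + (min (u \<bullet> i) t - u \<bullet> i) *\<^sub>R i"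
    have uj: "?u \<bullet> j = (if j = i then min (u \<bullet> i) t else u \<bullet> j)" if "j \<in> Basis" for j
      using that assms by (auto simp: inner_add_left inner_Basis)
    show ?thesis
    proof (cases "box l ?u = {}")
      case True
      then obtain j where "j \<in> Basis" "?u \<bullet> j \<le> l \<bullet> j" by (auto simp: box_eq_empty)
      then have "min (u \<bullet> i) t \<le> l \<bullet> i" using uj lu by (metis not_less)
      then show ?thesis using True by (simp add: box_Int_halfspace_lt[OF assms(1)])
    next
      case False
      then have "l \<bullet> i < min (u \<bullet> i) t" using assms uj by (metis box_ne_empty(2))
      have "measure lebesgue (box l ?u) = (\<Prod>j\<in>Basis. ?u \<bullet> j - l \<bullet> j)" by (rule measure_box_prod[OF False])
      also have "\<dots> = (?u \<bullet> i - l \<bullet> i) * (\<Prod>j\<in>Basis - {i}. ?u \<bullet> j - l \<bullet> j)"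
        using assms by (simp add: prod.remove)
      also have "(\<Prod>j\<in>Basis - {i}. ?u \<bullet> j - l \<bullet> j) = (\<Prod>j\<in>Basis - {i}. u \<bullet> j - l \<bullet> j)"
        by (rule prod.cong) (use uj in auto)
      finally show ?thesis using \<open>l \<bullet> i < min (u \<bullet> i) t\<close> uj[OF assms(1)] by (simp add: box_Int_halfspace_lt[OF assms(1)])
    qed
  qed
  then show ?thesis by (simp add: continuous_intros)
qed

lemma box_family_measure_cut:
  assumes "box_family \<B>" "H \<in> sets lebesgue"
  shows "measure lebesgue (\<Union>\<B> \<inter> H) = (\<Sum>P\<in>\<B>. measure lebesgue (P \<inter> H))"
proof -
  have "measure lebesgue (\<Union>P\<in>\<B>. P \<inter> H) = (\<Sum>P\<in>\<B>. measure lebesgue (P \<inter> H))"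
  proof (rule measure_UNION')
    show "finite \<B>" using assms unfolding box_family_def by auto
    show "P \<inter> H \<in> lmeasurable" if "P \<in> \<B>" for P
      using assms that unfolding box_family_def by (auto intro!: fmeasurable_Int_fmeasurable)
    show "pairwise (\<lambda>P Q. disjnt (P \<inter> H) (Q \<inter> H)) \<B>"
      using assms(1) unfolding box_family_def disjoint_def pairwise_def disjnt_def by blast
  qed
  moreover have "(\<Union>P\<in>\<B>. P \<inter> H) = \<Union>\<B> \<inter> H" by auto
  ultimately show ?thesis by simp
qed

lemma halfspace_lebesgue [simp]: "halfspace_lt i t \<in> sets lebesgue" "halfspace_gt i t \<in> sets lebesgue"
  unfolding halfspace_lt_def halfspace_gt_def
  by (auto intro!: borel_open open_Collect_less continuous_intros lborelD)

text \<open>The measure on the lower side is continuous in the position of the hyperplane and is 0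
  or full far out, so the intermediate value theorem applies.\<close>

lemma box_family_halfspace_fraction:
  fixes \<B> :: "'a::euclidean_space set set"
  assumes "box_family \<B>" "i \<in> Basis" "0 \<le> m" "m \<le> measure lebesgue (\<Union>\<B>)"
  obtains t where "measure lebesgue (\<Union>\<B> \<inter> halfspace_lt i t) = m"
proof -
  obtain R where R: "\<And>x. x \<in> \<Union>\<B> \<Longrightarrow> norm x \<le> R"
    using box_family_bounded[OF assms(1)] unfolding bounded_iff by blast
  have R': "\<bar>x \<bullet> i\<bar> \<le> R" if "x \<in> \<Union>\<B>" for x
    using R[OF that] Basis_le_norm[OF assms(2), of x] by linarith
  have c: "continuous_on UNIV (\<lambda>t. measure lebesgue (\<Union>\<B> \<inter> halfspace_lt i t))"
    unfolding box_family_measure_cut[OF assms(1) halfspace_lebesgue(1)]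
    using assms unfolding box_family_def
    by (intro continuous_on_sum) (auto intro!: measure_box_halfspace_continuous)
  have lo: "\<Union>\<B> \<inter> halfspace_lt i (- \<bar>R\<bar> - 1) = {}" 
    using R' unfolding halfspace_lt_def by fastforce
  have hi: "\<Union>\<B> \<inter> halfspace_lt i (\<bar>R\<bar> + 1) = \<Union>\<B>"
    using R' unfolding halfspace_lt_def by fastforce
  have "\<exists>t\<ge>- \<bar>R\<bar> - 1. t \<le> \<bar>R\<bar> + 1 \<and> measure lebesgue (\<Union>\<B> \<inter> halfspace_lt i t) = m"
    by (rule IVT') (use assms lo hi c in \<open>auto intro: continuous_on_subset\<close>)
  then show ?thesis using that by blast
qed

text \<open>Induction on the total number of boxes. A hyperplane separating two boxes of one family
  leaves the fraction \<open>\<alpha>\<close> of its measure on one side; a parallel hyperplane cuts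
  the other family in the same ratio. The sums of corresponding parts satisfy the claim with the
  bound scaled by \<open>\<alpha>\<close> and by \<open>1 - \<alpha>\<close>, and they lie on
  opposite sides of a hyperplane, so their measures add.\<close>

lemma brunn_minkowski_box_family:
  fixes \<A> \<B> :: "'a::euclidean_space set set"
  assumes "box_family \<A>" "box_family \<B>" "\<A> \<noteq> {}" "\<B> \<noteq> {}"
  shows "(measure lebesgue (\<Union>\<A>) powr (1 / DIM('a)) + measure lebesgue (\<Union>\<B>) powr (1 / DIM('a))) powr DIM('a)
     \<le> measure lebesgue (minkowski_sum (\<Union>\<A>) (\<Union>\<B>))"
  using assms
proof (induction "card \<A> + card \<B>" arbitrary: \<A> \<B> rule: less_induct)
  case less
  let ?d = "real DIM('a)"
  let ?m = "measure lebesgue :: 'a set \<Rightarrow> real"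
  let ?claim = "\<lambda>\<A> \<B>. (?m (\<Union>\<A>) powr (1 / ?d) + ?m (\<Union>\<B>) powr (1 / ?d)) powr ?d
     \<le> ?m (minkowski_sum (\<Union>\<A>) (\<Union>\<B>))"
  have sum_meas: "minkowski_sum (\<Union>\<A>) (\<Union>\<B>) \<in> lmeasurable" if "box_family \<A>" "box_family \<B>" for \<A> \<B> :: "'a set set"
    using that by (intro lmeasurable_open bounded_minkowski_sum open_minkowski_sum box_family_bounded box_family_open)
  \<comment> \<open>Only the family that is to be separated must have two boxes. Since the sum is
    commutative, this one-sided form can be applied to the pair in either order.\<close>
  have step: "?claim \<C> \<D>"
    if C: "box_family \<C>" "\<C> \<noteq> {}" and D: "box_family \<D>" "\<D> \<noteq> {}" and c: "card \<C> \<ge> 2"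
      and IH: "\<And>\<C>' \<D>'. card \<C>' < card \<C> \<Longrightarrow> card \<D>' \<le> card \<D> \<Longrightarrow> box_family \<C>' \<Longrightarrow> box_family \<D>' \<Longrightarrow>
         \<C>' \<noteq> {} \<Longrightarrow> \<D>' \<noteq> {} \<Longrightarrow> ?claim \<C>' \<D>'" for \<C> \<D>
  proof -
    obtain P Q where PQ: "P \<in> \<C>" "Q \<in> \<C>" "P \<noteq> Q"
      using c by (metis card_2_iff' ex_card obtain_subset_with_card_n subset_iff)
    obtain i t P Q where i: "i \<in> Basis" and PQ: "P \<in> \<C>" "Q \<in> \<C>" "P \<subseteq> halfspace_lt i t" "Q \<subseteq> halfspace_gt i t"
    proof -
      obtain a b where P: "P = box a b" "P \<noteq> {}" using C PQ unfolding box_family_def by metis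
      obtain c d where Q: "Q = box c d" "Q \<noteq> {}" using C PQ unfolding box_family_def by metis
      have "box a b \<inter> box c d = {}" using C PQ P Q unfolding box_family_def disjoint_def by metis
      then obtain i where i: "i \<in> Basis" "b \<bullet> i \<le> c \<bullet> i \<or> d \<bullet> i \<le> a \<bullet> i"
        using P(2) Q(2) unfolding disjoint_interval P(1) Q(1) box_ne_empty by (force simp: not_less[symmetric])
      from i(2) show ?thesis
      proof
        assume "b \<bullet> i \<le> c \<bullet> i"
        then show ?thesis using i(1) PQ P Q
          by (intro that[of i P Q "b \<bullet> i"]) (auto simp: halfspace_lt_def halfspace_gt_def mem_box intro: le_less_trans)
      next
        assume "d \<bullet> i \<le> a \<bullet> i"
        then show ?thesis using i(1) PQ P Q
          by (intro that[of i Q P "d \<bullet> i"]) (auto simp: halfspace_lt_def halfspace_gt_def mem_box intro: le_less_trans)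
      qed
    qed
    let ?C1 = "cut_family \<C> (halfspace_lt i t)" and ?C2 = "cut_family \<C> (halfspace_gt i t)"
    have fin: "finite \<C>" "finite \<D>" using C D unfolding box_family_def by auto
    have ne: "P \<noteq> {}" "Q \<noteq> {}" using C PQ unfolding box_family_def by auto
    have disj: "halfspace_lt i s \<inter> halfspace_gt i s = {}" for s unfolding halfspace_lt_def halfspace_gt_def by auto
    have C1: "box_family ?C1" and C2: "box_family ?C2" using box_family_cut[OF C(1) i] by auto
    have neC: "?C1 \<noteq> {}" "?C2 \<noteq> {}" using PQ ne unfolding cut_family_def by blast+
    have cC: "card ?C1 < card \<C>" "card ?C2 < card \<C>"
      by (rule card_cut_family_less[OF fin(1) PQ(2)], use PQ disj in blast)
         (rule card_cut_family_less[OF fin(1) PQ(1)], use PQ disj in blast)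
    define \<alpha> where "\<alpha> = ?m (\<Union>?C1) / ?m (\<Union>\<C>)"
    have mC: "?m (\<Union>\<C>) > 0" "?m (\<Union>?C1) > 0" "?m (\<Union>?C2) > 0" "?m (\<Union>\<D>) > 0"
      using box_family_pos C D C1 C2 neC by auto
    have lm: "\<Union>\<C> \<in> lmeasurable" "\<Union>\<D> \<in> lmeasurable"
      using C D by (auto intro!: lmeasurable_open box_family_bounded box_family_open)
    have split: "?m (\<Union>\<C>) = ?m (\<Union>?C1) + ?m (\<Union>?C2)"
      using measure_halfspace_split[OF lm(1) i] by (simp add: cut_family_Union)
    have \<alpha>: "0 < \<alpha>" "\<alpha> < 1" "?m (\<Union>?C1) = \<alpha> * ?m (\<Union>\<C>)" "?m (\<Union>?C2) = (1 - \<alpha>) * ?m (\<Union>\<C>)"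
      using mC split by (auto simp: \<alpha>_def field_simps)
    obtain s where s: "?m (\<Union>\<D> \<inter> halfspace_lt i s) = \<alpha> * ?m (\<Union>\<D>)"
      by (rule box_family_halfspace_fraction[OF D(1) i, of "\<alpha> * ?m (\<Union>\<D>)"])
         (use \<alpha> mC in \<open>auto simp: mult_le_cancel_right1\<close>)
    let ?D1 = "cut_family \<D> (halfspace_lt i s)" and ?D2 = "cut_family \<D> (halfspace_gt i s)"
    have mD: "?m (\<Union>?D1) = \<alpha> * ?m (\<Union>\<D>)" "?m (\<Union>?D2) = (1 - \<alpha>) * ?m (\<Union>\<D>)"
      using measure_halfspace_split[OF lm(2) i, of s] s by (auto simp: cut_family_Union algebra_simps)
    have D1: "box_family ?D1" and D2: "box_family ?D2" using box_family_cut[OF D(1) i] by auto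
    have neD: "?D1 \<noteq> {}" "?D2 \<noteq> {}" using mD \<alpha> mC by (metis Sup_empty measure_empty mult_pos_pos less_irrefl diff_gt_0_iff_gt)+
    let ?S = "(?m (\<Union>\<C>) powr (1 / ?d) + ?m (\<Union>\<D>) powr (1 / ?d)) powr ?d"
    \<comment> \<open>The bound is homogeneous of degree 1 in the two measures jointly; this is why
      both families are cut in equal ratios.\<close>
    have scale: "((\<beta> * ?m (\<Union>\<C>)) powr (1 / ?d) + (\<beta> * ?m (\<Union>\<D>)) powr (1 / ?d)) powr ?d = \<beta> * ?S"
      if "\<beta> > 0" for \<beta>
    proof -
      have "(\<beta> * ?m (\<Union>\<C>)) powr (1 / ?d) + (\<beta> * ?m (\<Union>\<D>)) powr (1 / ?d)
        = \<beta> powr (1 / ?d) * (?m (\<Union>\<C>) powr (1 / ?d) + ?m (\<Union>\<D>) powr (1 / ?d))"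
        using that by (simp add: powr_mult algebra_simps)
      then show ?thesis using that by (simp add: powr_mult powr_powr)
    qed
    have I1: "\<alpha> * ?S \<le> ?m (minkowski_sum (\<Union>?C1) (\<Union>?D1))"
      using IH[OF cC(1) card_cut_family[OF fin(2)] C1 D1 neC(1) neD(1)] scale[OF \<alpha>(1)] by (simp add: \<alpha>(3) mD)
    have I2: "(1 - \<alpha>) * ?S \<le> ?m (minkowski_sum (\<Union>?C2) (\<Union>?D2))"
      using IH[OF cC(2) card_cut_family[OF fin(2)] C2 D2 neC(2) neD(2)] scale[of "1 - \<alpha>"] \<alpha>(2) by (simp add: \<alpha>(4) mD)
    have "?S = \<alpha> * ?S + (1 - \<alpha>) * ?S" by (simp add: algebra_simps)
    also have "\<dots> \<le> ?m (minkowski_sum (\<Union>?C1) (\<Union>?D1)) + ?m (minkowski_sum (\<Union>?C2) (\<Union>?D2))"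
      using I1 I2 by linarith
    also have "\<dots> = ?m (minkowski_sum (\<Union>?C1) (\<Union>?D1) \<union> minkowski_sum (\<Union>?C2) (\<Union>?D2))"
    proof (rule measure_Un_disjoint[symmetric])
      show "minkowski_sum (\<Union>?C1) (\<Union>?D1) \<inter> minkowski_sum (\<Union>?C2) (\<Union>?D2) = {}"
      proof (rule ccontr)
        assume "\<not> ?thesis"
        then obtain x x' y y' where e: "x + y = x' + y'" and l: "x \<bullet> i < t" "y \<bullet> i < s"
          and g: "t < x' \<bullet> i" "s < y' \<bullet> i"
          unfolding cut_family_Union minkowski_sum_def halfspace_lt_def halfspace_gt_def by blast
        have "x \<bullet> i + y \<bullet> i = x' \<bullet> i + y' \<bullet> i" using arg_cong[OF e, of "\<lambda>z. z \<bullet> i"] by (simp add: inner_add_left)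
        then show False using l g by linarith
      qed
    qed (use sum_meas C1 C2 D1 D2 in auto)
    also have "\<dots> \<le> ?m (minkowski_sum (\<Union>\<C>) (\<Union>\<D>))"
    proof (rule measure_mono_fmeasurable)
      show "minkowski_sum (\<Union>?C1) (\<Union>?D1) \<union> minkowski_sum (\<Union>?C2) (\<Union>?D2) \<subseteq> minkowski_sum (\<Union>\<C>) (\<Union>\<D>)"
        by (intro Un_least minkowski_sum_mono) (auto simp: cut_family_Union)
    qed (use sum_meas C1 C2 D1 D2 C D in auto)
    finally show ?thesis .
  qed
  have fin: "finite \<A>" "finite \<B>" using less.prems unfolding box_family_def by auto
  consider "card \<A> \<ge> 2" | "card \<B> \<ge> 2" | "card \<A> = 1" "card \<B> = 1"
    using less.prems fin by (metis One_nat_def Suc_1 card_0_eq less_one linorder_not_less not_less_eq_eq le_antisym)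
  then show ?case
  proof cases
    case 1
    show ?thesis by (rule step) (use less 1 in auto)
  next
    case 2
    have "?claim \<B> \<A>"
    proof (rule step)
      fix \<C>' \<D>' :: "'a set set" assume "card \<C>' < card \<B>" "card \<D>' \<le> card \<A>" "box_family \<C>'" "box_family \<D>'" "\<C>' \<noteq> {}" "\<D>' \<noteq> {}"
      then show "?claim \<C>' \<D>'" by (intro less.hyps) auto
    qed (use less 2 in auto)
    then show ?thesis by (simp add: minkowski_sum_commute add.commute)
  next
    case 3
    then obtain P Q where PQ: "\<A> = {P}" "\<B> = {Q}" by (metis card_1_singletonE)
    then obtain a b c d where "P = box a b" "Q = box c d" "P \<noteq> {}" "Q \<noteq> {}"
      using less.prems unfolding box_family_def by auto
    then have "?m P powr (1 / ?d) + ?m Q powr (1 / ?d) \<le> ?m (minkowski_sum P Q) powr (1 / ?d)"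
      using brunn_minkowski_box by blast
    then have "(?m P powr (1 / ?d) + ?m Q powr (1 / ?d)) powr ?d \<le> (?m (minkowski_sum P Q) powr (1 / ?d)) powr ?d"
      by (intro powr_mono2) auto
    then show ?thesis using PQ by (simp add: powr_powr)
  qed
qed

text \<open>An open set is a countable union of closed boxes. A finite partial union already has
  almost full measure, it can be divided into boxes with disjoint interiors, and passing to these
  interiors loses only a null set.\<close>

lemma open_approx_box_family:
  fixes A :: "'a::euclidean_space set"
  assumes "open A" "bounded A" "A \<noteq> {}" "\<delta> > 0"
  obtains \<A> where "box_family \<A>" "\<A> \<noteq> {}" "\<Union>\<A> \<subseteq> A" "measure lebesgue (\<Union>\<A>) > measure lebesgue A - \<delta>"
proof -
  let ?m = "measure lebesgue :: 'a set \<Rightarrow> real"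
  have Am: "A \<in> lmeasurable" using assms by (intro lmeasurable_open)
  have Apos: "?m A > 0"
    using assms Am open_not_negligible negligible_iff_measure0 measure_nonneg[of lebesgue A]
    by (metis order_le_less)
  obtain \<D> where D: "countable \<D>" "\<D> \<subseteq> Pow A" "\<And>X. X \<in> \<D> \<Longrightarrow> \<exists>a b. X = cbox a b" "\<Union>\<D> = A"
    using open_countable_Union_open_cbox[OF assms(1)] by metis
  have "\<D> \<noteq> {}" using D assms by auto
  define f where "f = from_nat_into \<D>"
  have rf: "range f = \<D>" unfolding f_def using D \<open>\<D> \<noteq> {}\<close> by simp
  define U where "U n = (\<Union>k\<le>n. f k)" for n
  have fm: "f k \<in> lmeasurable" for k
    using rf D by (metis lmeasurable_cbox rangeI)
  have "(\<lambda>n. ?m (U n)) \<longlonglongrightarrow> ?m (\<Union>n. U n)"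
  proof (rule Lim_measure_incseq)
    show "range U \<subseteq> sets lebesgue" unfolding U_def using fm by (auto intro!: sets.finite_UN)
    show "incseq U" unfolding U_def incseq_def by (intro allI impI UN_mono) auto
    have "(\<Union>n. U n) = A" unfolding U_def using rf D(4) by (auto; blast)
    then show "emeasure lebesgue (\<Union>n. U n) \<noteq> \<infinity>" using Am fmeasurableD2[of A lebesgue] by (metis infinity_ennreal_def)
  qed
  moreover have "(\<Union>n. U n) = A" unfolding U_def using rf D(4) by (auto; blast)
  ultimately have "(\<lambda>n. ?m (U n)) \<longlonglongrightarrow> ?m A" by simp
  \<comment> \<open>The \<open>max\<close> with 0 forces the partial union to have positive measure,
    hence the final family to be nonempty.\<close>
  moreover have "?m A > max 0 (?m A - \<delta>)" using Apos assms by auto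
  ultimately have "\<forall>\<^sub>F n in sequentially. ?m (U n) > max 0 (?m A - \<delta>)" by (rule order_tendstoD(1))
  then obtain n where n: "?m (U n) > max 0 (?m A - \<delta>)" by (meson eventually_happens trivial_limit_sequentially)
  have "\<exists>p. p division_of (\<Union>(f ` {..n}))"
  proof (rule elementary_unions_intervals)
    show "\<exists>a b. s = cbox a b" if "s \<in> f ` {..n}" for s using that rf D(3) by auto
  qed auto
  then obtain p where p: "p division_of U n" unfolding U_def by auto
  define \<A> where "\<A> = interior ` p - {{}}"
  have pd: "finite p" "\<Union>p = U n" "\<And>K. K \<in> p \<Longrightarrow> \<exists>a b. K = cbox a b"
    "\<And>K L. K \<in> p \<Longrightarrow> L \<in> p \<Longrightarrow> K \<noteq> L \<Longrightarrow> interior K \<inter> interior L = {}"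
    using division_ofD[OF p] by auto
  have fam: "box_family \<A>"
    unfolding box_family_def
  proof (intro conjI)
    show "finite \<A>" unfolding \<A>_def using pd by auto
    show "disjoint \<A>" unfolding \<A>_def disjoint_def using pd(4) by blast
    show "\<forall>P\<in>\<A>. P \<noteq> {} \<and> (\<exists>l u. P = box l u)"
      unfolding \<A>_def using pd(3) interior_cbox by fastforce
  qed
  have sub: "\<Union>\<A> \<subseteq> U n" unfolding \<A>_def using pd(2) interior_subset by fastforce
  have "U n - \<Union>\<A> \<subseteq> (\<Union>K\<in>p. K - interior K)" unfolding \<A>_def pd(2)[symmetric] by auto
  moreover have "negligible (\<Union>K\<in>p. K - interior K)"
  proof (rule negligible_Union)
    fix T assume "T \<in> (\<lambda>K. K - interior K) ` p"
    then obtain K where K: "K \<in> p" "T = K - interior K" by auto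
    then obtain a b where "T = cbox a b - interior (cbox a b)" using pd(3) by metis
    then show "negligible T" by (simp add: negligible_frontier_interval interior_cbox)
  qed (use pd(1) in auto)
  ultimately have "negligible (U n - \<Union>\<A>)" by (rule negligible_subset[rotated])
  then have eq: "?m (\<Union>\<A>) = ?m (U n)"
    by (intro measure_negligible_symdiff) (use sub fm fam in \<open>auto simp: U_def Diff_eq_empty_iff[THEN iffD2]\<close>)
  have "\<Union>\<A> \<subseteq> A" using sub rf D(4) unfolding U_def by blast
  moreover have "\<A> \<noteq> {}" using eq n by auto
  ultimately show ?thesis using fam eq n by (intro that[of \<A>]) auto
qed

theorem brunn_minkowski_open:
  fixes A B :: "'a::euclidean_space set"
  assumes A: "open A" "bounded A" "A \<noteq> {}" and B: "open B" "bounded B" "B \<noteq> {}"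
  shows "(measure lebesgue A powr (1 / DIM('a)) + measure lebesgue B powr (1 / DIM('a))) powr DIM('a)
     \<le> measure lebesgue (minkowski_sum A B)"
proof -
  let ?d = "real DIM('a)"
  let ?m = "measure lebesgue :: 'a set \<Rightarrow> real"
  let ?r = "\<lambda>n::nat. 1 / (real n + 1)"
  have m: "A \<in> lmeasurable" "B \<in> lmeasurable" "minkowski_sum A B \<in> lmeasurable"
    using A B by (auto intro!: lmeasurable_open bounded_minkowski_sum open_minkowski_sum)
  \<comment> \<open>Cutting off at 0 keeps the bases of \<open>powr\<close> nonnegative, where it is
    monotone, and makes no difference in the limit.\<close>
  have ev: "(max 0 (?m A - ?r n) powr (1 / ?d) + max 0 (?m B - ?r n) powr (1 / ?d)) powr ?d \<le> ?m (minkowski_sum A B)" for n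
  proof -
    have r: "?r n > 0" by simp
    obtain \<A> where \<A>: "box_family \<A>" "\<A> \<noteq> {}" "\<Union>\<A> \<subseteq> A" "?m (\<Union>\<A>) > ?m A - ?r n"
      using open_approx_box_family[OF A r] by blast
    obtain \<B> where \<B>: "box_family \<B>" "\<B> \<noteq> {}" "\<Union>\<B> \<subseteq> B" "?m (\<Union>\<B>) > ?m B - ?r n"
      using open_approx_box_family[OF B r] by blast
    have "(max 0 (?m A - ?r n) powr (1 / ?d) + max 0 (?m B - ?r n) powr (1 / ?d)) powr ?d
       \<le> (?m (\<Union>\<A>) powr (1 / ?d) + ?m (\<Union>\<B>) powr (1 / ?d)) powr ?d"
      using \<A> \<B> by (intro powr_mono2 add_mono) auto
    also have "\<dots> \<le> ?m (minkowski_sum (\<Union>\<A>) (\<Union>\<B>))" using \<A> \<B> brunn_minkowski_box_family by blast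
    also have "\<dots> \<le> ?m (minkowski_sum A B)"
    proof (rule measure_mono_fmeasurable)
      show "minkowski_sum (\<Union>\<A>) (\<Union>\<B>) \<subseteq> minkowski_sum A B" using \<A> \<B> by (intro minkowski_sum_mono) auto
      show "minkowski_sum (\<Union>\<A>) (\<Union>\<B>) \<in> sets lebesgue"
        using \<A> \<B> by (intro fmeasurableD[OF lmeasurable_open] bounded_minkowski_sum open_minkowski_sum
            box_family_bounded box_family_open)
    qed (use m in auto)
    finally show ?thesis .
  qed
  have "(\<lambda>n. ?r n) \<longlonglongrightarrow> 0" using LIMSEQ_inverse_real_of_nat by (simp add: inverse_eq_divide add.commute)
  then have "(\<lambda>n. (max 0 (?m A - ?r n) powr (1 / ?d) + max 0 (?m B - ?r n) powr (1 / ?d)) powr ?d)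
     \<longlonglongrightarrow> (max 0 (?m A - 0) powr (1 / ?d) + max 0 (?m B - 0) powr (1 / ?d)) powr ?d"
    by (intro tendsto_powr' tendsto_add tendsto_max tendsto_diff tendsto_const) auto
  then have "(max 0 (?m A - 0) powr (1 / ?d) + max 0 (?m B - 0) powr (1 / ?d)) powr ?d \<le> ?m (minkowski_sum A B)"
    by (rule LIMSEQ_le_const2) (use ev in auto)
  then show ?thesis by simp
qed

subsection \<open>Level sets and the one-dimensional Moser inequality\<close>

text \<open>Convexity of \<open>t powr (1 + q)\<close> at the points \<open>x / (1 - s)\<close> and
  \<open>y / s\<close> with weights \<open>1 - s\<close> and \<open>s\<close>. When \<open>s\<close>
  is the share of the energy spent on \<open>y\<close>, the two terms have exactly the form of the
  level inequality; the changes of level below are paid for through this estimate.\<close>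

lemma powr_add_split:
  fixes x y s q :: real
  assumes "0 \<le> x" "0 \<le> y" "0 < s" "s < 1" "0 < q"
  shows "(x + y) powr (1 + q) \<le> x powr (1 + q) / (1 - s) powr q + y powr (1 + q) / s powr q"
proof -
  have le1: "r powr (1 + q) \<le> r powr (1 + q) / t powr q" if "0 \<le> r" "0 < t" "t < 1" for r t :: real
  proof -
    have "t powr q \<le> 1" using that assms by (simp add: powr_le1)
    then show ?thesis using that by (simp add: le_divide_eq mult_left_le)
  qed
  have scale: "t * (r / t) powr (1 + q) = r powr (1 + q) / t powr q" if "0 < r" "0 < t" for r t :: real
    using that by (simp add: powr_divide powr_add)
  consider "x = 0" | "y = 0" | "x > 0" "y > 0" using assms by linarith
  then show ?thesis
  proof cases
    case 1 then show ?thesis using le1[of y s] assms by simp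
  next
    case 2 then show ?thesis using le1[of x "1 - s"] assms by simp
  next
    case 3
    have "convex_on {0<..} (\<lambda>x::real. x powr (1 + q))" using assms by (intro powr_convex) simp
    from convex_onD[OF this, of s "x / (1 - s)" "y / s"]
    have "((1 - s) * (x / (1 - s)) + s * (y / s)) powr (1 + q)
      \<le> (1 - s) * (x / (1 - s)) powr (1 + q) + s * (y / s) powr (1 + q)"
      using 3 assms by simp
    then show ?thesis using scale[of x "1 - s"] scale[of y s] 3 assms by simp
  qed
qed

section \<open>Distribution functions of a function with an energy density\<close>

locale level_energy = finite_measure M for M :: "'a measure" +
  fixes v f :: "'a \<Rightarrow> real" and lam q :: real
  assumes v_meas [measurable]: "v \<in> borel_measurable M"
    and v_nonneg: "\<And>x. 0 \<le> v x"
    and f_int: "integrable M f"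
    and f_nonneg: "\<And>x. 0 \<le> f x"
    and lam_pos: "0 < lam" and q_pos: "0 < q" and q_le: "q \<le> 1"
begin

text \<open>In the application \<open>v\<close> is |\<phi>|, \<open>f\<close> is
  F(\<nabla>\<phi>)^N, \<open>lam\<close> is \<lambda>_N and \<open>q\<close> is 1/(N-1). Closed and
  open superlevel sets are kept apart because \<open>v\<close> may be constant on a set of positive
  measure, and at such a level \<open>nu\<close> exceeds \<open>mu\<close>.\<close>

definition nu :: "real \<Rightarrow> real" where "nu t = measure M {x \<in> space M. t \<le> v x}"
definition mu :: "real \<Rightarrow> real" where "mu t = measure M {x \<in> space M. t < v x}"
definition en :: "real \<Rightarrow> real \<Rightarrow> real" where
  "en a b = (\<integral>x. f x * indicator {x. a < v x \<and> v x < b} x \<partial>M)"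
definition tail :: "real \<Rightarrow> real" where "tail a = (\<integral>x. f x * indicator {x. a < v x} x \<partial>M)"

lemma nu_nonneg: "0 \<le> nu t" and mu_nonneg: "0 \<le> mu t"
  unfolding nu_def mu_def by auto

lemma nu_antimono: "s \<le> t \<Longrightarrow> nu t \<le> nu s"
  unfolding nu_def by (intro finite_measure_mono) auto

lemma mu_le_nu: "mu t \<le> nu t"
  unfolding nu_def mu_def by (intro finite_measure_mono) auto

lemma nu_le_mu: "s < t \<Longrightarrow> nu t \<le> mu s"
  unfolding nu_def mu_def by (intro finite_measure_mono) auto

lemma mu_le_space: "mu t \<le> measure M (space M)" and nu_le_space: "nu t \<le> measure M (space M)"
  unfolding mu_def nu_def by (intro finite_measure_mono; auto)+

lemma nu_measurable [measurable]: "nu \<in> borel_measurable borel"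
proof -
  have "mono (\<lambda>t. - nu t)" by (intro monoI) (simp add: nu_antimono)
  then have "(\<lambda>t. - nu t) \<in> borel_measurable borel" by (rule borel_measurable_mono)
  then have "(\<lambda>t. - (- nu t)) \<in> borel_measurable borel" by measurable
  then show ?thesis by simp
qed

lemma f_measurable [measurable]: "f \<in> borel_measurable M"
  using f_int by auto

lemma integrable_f_indicator: "Measurable.pred M (\<lambda>x. P x) \<Longrightarrow> integrable M (\<lambda>x. f x * indicator {x. P x} x)"
  by (rule Bochner_Integration.integrable_bound[OF f_int]) (auto split: split_indicator)

lemma en_nonneg: "0 \<le> en a b"
  unfolding en_def by (intro Bochner_Integration.integral_nonneg) (auto simp: f_nonneg split: split_indicator)

lemma en_add_le: "a \<le> b \<Longrightarrow> en a b + en b c \<le> en a c" if "b \<le> c" for a b c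
proof -
  assume "a \<le> b"
  have "en a b + en b c = (\<integral>x. f x * indicator {x. a < v x \<and> v x < b} x + f x * indicator {x. b < v x \<and> v x < c} x \<partial>M)"
    unfolding en_def by (intro Bochner_Integration.integral_add[symmetric] integrable_f_indicator) measurable
  also have "\<dots> \<le> en a c"
    unfolding en_def
    by (intro integral_mono Bochner_Integration.integrable_add integrable_f_indicator; (measurable)?)
       (use \<open>a \<le> b\<close> that f_nonneg in \<open>auto split: split_indicator\<close>)
  finally show ?thesis .
qed

lemma en_le_tail: "en a b \<le> tail a"
  unfolding en_def tail_def
  by (intro integral_mono integrable_f_indicator; (measurable)?)
     (use f_nonneg in \<open>auto split: split_indicator\<close>)

text \<open>Let \<open>t0\<close> be the infimum of the levels involved. If it is attained, the set
  is contained in the closed superlevel set at \<open>t0\<close>, which has measure at most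
  \<open>\<beta>\<close>. Otherwise it is contained in the open one, an increasing union of closed
  ones of measure at most \<open>\<beta>\<close>. Thus \<open>nu (v x)\<close> is never concentrated
  near 0 more than a uniform variable.\<close>

lemma measure_nu_le:
  assumes "0 \<le> \<beta>"
  shows "measure M {x \<in> space M. nu (v x) \<le> \<beta>} \<le> \<beta>"
proof (cases "{x \<in> space M. nu (v x) \<le> \<beta>} = {}")
  case True
  show ?thesis unfolding True using assms by simp
next
  case False
  define T where "T = v ` {x \<in> space M. nu (v x) \<le> \<beta>}"
  have T: "T \<noteq> {}" "bdd_below T" using False v_nonneg unfolding T_def by (auto intro!: bdd_belowI2[of _ 0])
  have T_nu: "nu t \<le> \<beta>" if "t \<in> T" for t using that unfolding T_def by auto
  define t0 where "t0 = Inf T"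
  have lb: "t0 \<le> t" if "t \<in> T" for t using that T unfolding t0_def by (intro cInf_lower)
  show ?thesis
  proof (cases "t0 \<in> T")
    case True
    have "measure M {x \<in> space M. nu (v x) \<le> \<beta>} \<le> nu t0"
      unfolding nu_def[of t0] by (intro finite_measure_mono) (use lb in \<open>auto simp: T_def\<close>)
    then show ?thesis using T_nu[OF True] by linarith
  next
    case F: False
    let ?A = "\<lambda>n::nat. {x \<in> space M. t0 + 1 / (real n + 1) \<le> v x}"
    have "measure M {x \<in> space M. nu (v x) \<le> \<beta>} \<le> measure M {x \<in> space M. t0 < v x}"
      by (intro finite_measure_mono) (use lb F in \<open>auto simp: T_def less_le\<close>)
    also have "\<dots> \<le> \<beta>"
    proof -
      have "(\<lambda>n. measure M (?A n)) \<longlonglongrightarrow> measure M (\<Union>n. ?A n)"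
      proof (rule finite_Lim_measure_incseq)
        show "incseq ?A"
        proof (rule incseq_SucI, safe)
          fix n x assume "t0 + 1 / (real n + 1) \<le> v x"
          moreover have "1 / (real (Suc n) + 1) \<le> 1 / (real n + 1)" by (intro divide_left_mono) auto
          ultimately show "t0 + 1 / (real (Suc n) + 1) \<le> v x" by linarith
        qed
      qed auto
      moreover have "(\<Union>n. ?A n) = {x \<in> space M. t0 < v x}"
      proof safe
        fix x n assume "t0 + 1 / (real n + 1) \<le> v x"
        moreover have "1 / (real n + 1) > 0" by simp
        ultimately show "t0 < v x" by linarith
      next
        fix x assume x: "x \<in> space M" "t0 < v x"
        then obtain n where "inverse (real (Suc n)) < v x - t0" using reals_Archimedean[of "v x - t0"] by auto
        then have "t0 + 1 / (real n + 1) \<le> v x" by (simp add: inverse_eq_divide add.commute)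
        then show "x \<in> (\<Union>n. ?A n)" using x by blast
      qed
      moreover have "measure M (?A n) \<le> \<beta>" for n
      proof -
        have "t0 < t0 + 1 / (real n + 1)" by simp
        then obtain t where t: "t \<in> T" "t < t0 + 1 / (real n + 1)"
          unfolding t0_def using T cInf_lessD by metis
        then have "measure M (?A n) \<le> nu t" unfolding nu_def by (intro finite_measure_mono) auto
        then show ?thesis using T_nu[OF t(1)] by linarith
      qed
      ultimately show ?thesis by (intro LIMSEQ_le_const2[of "\<lambda>n. measure M (?A n)"]) auto
    qed
    finally show ?thesis .
  qed
qed

lemma AE_nu_pos: "AE x in M. 0 < nu (v x)"
proof (rule AE_I)
  show "{x \<in> space M. \<not> 0 < nu (v x)} \<subseteq> {x \<in> space M. nu (v x) \<le> 0}" by auto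
  show "emeasure M {x \<in> space M. nu (v x) \<le> 0} = 0"
    using measure_nu_le[of 0] measure_nonneg[of M] by (simp add: emeasure_eq_measure order_antisym)
qed measurable

text \<open>Moser's logarithmic variable, counted from the level \<open>L\<close>: between
  \<open>L\<close> and \<open>t\<close> the superlevel set shrinks by the factor
  \<open>exp (- logdec L t)\<close>.\<close>

definition logdec :: "real \<Rightarrow> real \<Rightarrow> real" where "logdec L t = ln (mu L / nu t)"

lemma logdec_measurable [measurable]: "logdec L \<in> borel_measurable borel"
  unfolding logdec_def by measurable

lemma logdec_nonneg: "L < t \<Longrightarrow> 0 < nu t \<Longrightarrow> 0 \<le> logdec L t"
  unfolding logdec_def using nu_le_mu[of L t] by simp

lemma logdec_mono: "L < t \<Longrightarrow> t \<le> t' \<Longrightarrow> 0 < nu t' \<Longrightarrow> logdec L t \<le> logdec L t'"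
  unfolding logdec_def using nu_le_mu[of L t] nu_antimono[of t t'] by (simp add: frac_le)

lemma exp_logdec: "L < t \<Longrightarrow> 0 < nu t \<Longrightarrow> nu t = mu L * exp (- logdec L t)"
  unfolding logdec_def using nu_le_mu[of L t] by (simp add: exp_minus)

text \<open>By \<open>measure_nu_le\<close> the layer where \<open>logdec L (v x)\<close> has
  integer part \<open>j\<close> has measure at most \<open>mu L * exp (- j)\<close>. Since
  \<open>nu (v x)\<close> is positive almost everywhere, the layers exhaust the set above
  \<open>L\<close> up to a null set.\<close>

lemma layer_bound:
  fixes k :: "'a \<Rightarrow> ennreal" and h :: "nat \<Rightarrow> ennreal"
  assumes "\<And>x. x \<in> space M \<Longrightarrow> L < v x \<Longrightarrow> 0 < nu (v x) \<Longrightarrow> k x \<le> h (nat \<lfloor>logdec L (v x)\<rfloor>)"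
  shows "(\<integral>\<^sup>+x. k x * indicator {x. L < v x} x \<partial>M) \<le> (\<Sum>j. h j * ennreal (mu L * exp (- real j)))"
proof -
  define P where "P j = {x \<in> space M. L < v x \<and> 0 < nu (v x) \<and> nat \<lfloor>logdec L (v x)\<rfloor> = j}" for j
  have P_meas [measurable]: "P j \<in> sets M" for j unfolding P_def by measurable
  have P_le: "emeasure M (P j) \<le> ennreal (mu L * exp (- real j))" for j
  proof -
    have "nu (v x) \<le> mu L * exp (- real j)" if "x \<in> P j" for x
    proof -
      have x: "L < v x" "0 < nu (v x)" "nat \<lfloor>logdec L (v x)\<rfloor> = j" using that unfolding P_def by auto
      then have "real j \<le> logdec L (v x)" using logdec_nonneg[OF x(1,2)] by linarith
      then show ?thesis using exp_logdec[OF x(1,2)] mu_nonneg[of L] by (simp add: mult_left_mono)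
    qed
    then have "measure M (P j) \<le> measure M {x \<in> space M. nu (v x) \<le> mu L * exp (- real j)}"
      by (intro finite_measure_mono) (auto simp: P_def)
    also have "\<dots> \<le> mu L * exp (- real j)" by (rule measure_nu_le) (simp add: mu_nonneg)
    finally show ?thesis by (simp add: emeasure_eq_measure ennreal_leI)
  qed
  have "(\<integral>\<^sup>+x. k x * indicator {x. L < v x} x \<partial>M) \<le> (\<integral>\<^sup>+x. (\<Sum>j. h j * indicator (P j) x) \<partial>M)"
  proof (rule nn_integral_mono_AE)
    show "AE x in M. k x * indicator {x. L < v x} x \<le> (\<Sum>j. h j * indicator (P j) x)"
      using AE_nu_pos
    proof (rule AE_mp, intro AE_I2 impI)
      fix x assume x: "x \<in> space M" "0 < nu (v x)"
      show "k x * indicator {x. L < v x} x \<le> (\<Sum>j. h j * indicator (P j) x)"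
      proof (cases "L < v x")
        case True
        let ?j = "nat \<lfloor>logdec L (v x)\<rfloor>"
        have "k x * indicator {x. L < v x} x \<le> h ?j * indicator (P ?j) x"
          using assms[OF x(1) True x(2)] True x by (simp add: P_def)
        also have "\<dots> = (\<Sum>j\<in>{?j}. h j * indicator (P j) x)" by (subst sum.insert) auto
        also have "\<dots> \<le> (\<Sum>j. h j * indicator (P j) x)" by (rule sum_le_suminf) auto
        finally show ?thesis .
      qed simp
    qed
  qed
  also have "\<dots> = (\<Sum>j. h j * emeasure M (P j))"
    by (simp add: nn_integral_suminf nn_integral_cmult_indicator)
  also have "\<dots> \<le> (\<Sum>j. h j * ennreal (mu L * exp (- real j)))"
    by (intro suminf_le mult_left_mono P_le) auto
  finally show ?thesis .
qed

text \<open>On layer \<open>j\<close> the function \<open>nu (v x) powr - (1 / 2)\<close> is at most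
  \<open>mu L powr - (1 / 2) * exp ((j + 1) / 2)\<close>, while the layer has measure at most
  \<open>mu L * exp (- j)\<close>; this geometric series collects the products.\<close>

definition half_const :: real where "half_const = (\<Sum>j::nat. exp (1 / 2) * exp (- (1 / 2)) ^ j)"

lemma half_const_summable: "summable (\<lambda>j::nat. exp (1 / 2) * exp (- (1 / 2) :: real) ^ j)"
  by (intro summable_mult summable_geometric) simp

lemma half_const_pos: "0 < half_const"
  unfolding half_const_def by (intro suminf_pos half_const_summable) simp

lemma nu_inverse_sqrt_integral:
  shows "(\<integral>\<^sup>+x. ennreal (nu (v x) powr - (1 / 2)) * indicator {x. L < v x} x \<partial>M)
    \<le> ennreal (half_const * mu L powr (1 / 2))"
proof -
  let ?h = "\<lambda>j::nat. ennreal (mu L powr - (1 / 2) * exp ((real j + 1) / 2))"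
  have "(\<integral>\<^sup>+x. ennreal (nu (v x) powr - (1 / 2)) * indicator {x. L < v x} x \<partial>M)
      \<le> (\<Sum>j. ?h j * ennreal (mu L * exp (- real j)))"
  proof (rule layer_bound)
    fix x assume x: "L < v x" "0 < nu (v x)"
    then have m: "mu L > 0" using nu_le_mu[OF x(1)] by linarith
    have "nu (v x) powr - (1 / 2) = mu L powr - (1 / 2) * exp (logdec L (v x) / 2)"
      using m by (subst exp_logdec[OF x]) (simp add: powr_mult exp_powr_real)
    also have "\<dots> \<le> mu L powr - (1 / 2) * exp ((real (nat \<lfloor>logdec L (v x)\<rfloor>) + 1) / 2)"
    proof (rule mult_left_mono)
      have "logdec L (v x) \<le> real (nat \<lfloor>logdec L (v x)\<rfloor>) + 1" using logdec_nonneg[OF x] by linarith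
      then show "exp (logdec L (v x) / 2) \<le> exp ((real (nat \<lfloor>logdec L (v x)\<rfloor>) + 1) / 2)" by simp
    qed simp
    finally show "ennreal (nu (v x) powr - (1 / 2)) \<le> ?h (nat \<lfloor>logdec L (v x)\<rfloor>)" by (rule ennreal_leI)
  qed
  also have "\<dots> = (\<Sum>j. ennreal (mu L powr (1 / 2) * (exp (1 / 2) * exp (- (1 / 2)) ^ j)))"
  proof (rule suminf_cong)
    fix j :: nat
    have "mu L powr - (1 / 2) * mu L = mu L powr (1 / 2)"
      using mu_nonneg[of L] by (cases "mu L = 0") (simp_all add: powr_minus powr_half_sqrt field_simps)
    moreover have "exp ((real j + 1) / 2) * exp (- real j) = exp (1 / 2) * exp (- (1 / 2)) ^ j"
      unfolding exp_of_nat_mult[symmetric] exp_add[symmetric] by (simp add: field_simps)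
    ultimately have e: "(mu L powr - (1 / 2) * mu L) * (exp ((real j + 1) / 2) * exp (- real j))
        = mu L powr (1 / 2) * (exp (1 / 2) * exp (- (1 / 2)) ^ j)" by simp
    have "(mu L powr - (1 / 2) * exp ((real j + 1) / 2)) * (mu L * exp (- real j))
        = mu L powr (1 / 2) * (exp (1 / 2) * exp (- (1 / 2)) ^ j)"
      unfolding e[symmetric] by (simp only: ac_simps)
    then show "?h j * ennreal (mu L * exp (- real j)) = ennreal (mu L powr (1 / 2) * (exp (1 / 2) * exp (- (1 / 2)) ^ j))"
      by (subst ennreal_mult[symmetric]) (simp_all add: mu_nonneg)
  qed
  also have "\<dots> = ennreal (\<Sum>j. mu L powr (1 / 2) * (exp (1 / 2) * exp (- (1 / 2)) ^ j))"
    by (rule suminf_ennreal2) (auto intro: summable_mult half_const_summable)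
  also have "(\<Sum>j. mu L powr (1 / 2) * (exp (1 / 2) * exp (- (1 / 2)) ^ j)) = half_const * mu L powr (1 / 2)"
    unfolding half_const_def by (subst suminf_mult) (auto intro: half_const_summable)
  finally show ?thesis .
qed

end

section \<open>Garsia's counting argument for Moser's inequality\<close>

locale level_inequality = level_energy +
  assumes level_ineq: "\<And>a b. 0 \<le> a \<Longrightarrow> a < b \<Longrightarrow> 0 < nu b \<Longrightarrow>
    lam * (b - a) powr (1 + q) \<le> en a b powr q * ln (mu a / nu b)"
begin

text \<open>With \<open>z = l / s1\<close> and \<open>\<sigma> = garsia / 2 * z\<close> in
  \<open>garsia_spread\<close>, this value makes \<open>((z / q) / \<sigma>) powr q\<close> equal to
  1/2, and \<open>garsia * l \<le> s1\<close> gives \<open>\<sigma> \<le> 1 / 2\<close>.\<close>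

definition garsia :: real where "garsia = 2 * 2 powr (1 / q) / q"

lemma garsia_pos: "0 < garsia" unfolding garsia_def using q_pos by simp

text \<open>The integrand of Moser's inequality is the exponential of \<open>logdec\<close> minus
  \<open>defect\<close>. The first factor is balanced by the measure of its layer, so the inequality
  reduces to counting the layers that contain a level of small defect.\<close>

definition defect :: "real \<Rightarrow> real \<Rightarrow> real \<Rightarrow> real" where
  "defect L B t = logdec L t - lam * (t - L) powr (1 + q) / B powr q"

lemma defect_nonneg:
  assumes "0 \<le> L" "0 < B" "tail L \<le> B" "L < t" "0 < nu t"
  shows "0 \<le> defect L B t"
proof -
  have "lam * (t - L) powr (1 + q) \<le> en L t powr q * logdec L t"
    using level_ineq[of L t] assms unfolding logdec_def by simp
  also have "\<dots> \<le> B powr q * logdec L t"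
    using assms en_le_tail[of L t] en_nonneg[of L t] logdec_nonneg[of L t] q_pos
    by (intro mult_right_mono powr_mono2) auto
  finally show ?thesis using assms unfolding defect_def by (simp add: field_simps)
qed

text \<open>A small defect at \<open>t1\<close>, deep in the range, means that nearly all of the
  allowance \<open>B\<close> has been spent below \<open>t1\<close>. The little energy left over
  makes a further rise so costly in the logarithm that the defect at \<open>t2\<close> can be small
  only if the logarithm has grown by O(\<open>l\<close>).\<close>

lemma garsia_spread:
  assumes L: "0 \<le> L" and B: "0 < B" "tail L \<le> B"
    and t: "L < t1" "t1 < t2" "0 < nu t2" and l: "0 < l"
    and d: "defect L B t1 \<le> l" "defect L B t2 \<le> l" and s: "garsia * l \<le> logdec L t1"
  shows "logdec L t2 - logdec L t1 \<le> 2 * (garsia + 1) * l"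
proof -
  define e1 where "e1 = en L t1 / B"
  define e2 where "e2 = en t1 t2 / B"
  define s1 where "s1 = logdec L t1"
  define s2 where "s2 = logdec L t2"
  define X where "X = lam * (t1 - L) powr (1 + q) / B powr q"
  define Y where "Y = lam * (t2 - t1) powr (1 + q) / B powr q"
  define z where "z = l / s1"
  define \<sigma> where "\<sigma> = garsia / 2 * z"
  have nu1: "0 < nu t1" using nu_antimono[of t1 t2] t by linarith
  have s1: "garsia * l \<le> s1" "s1 > 0" using s mult_pos_pos[OF garsia_pos l] unfolding s1_def by linarith+
  have e: "0 \<le> e1" "0 \<le> e2" using en_nonneg B unfolding e1_def e2_def by auto
  have "en L t1 + en t1 t2 \<le> tail L" using en_add_le[of t1 t2 L] en_le_tail[of L t2] t by linarith
  then have e12: "e1 + e2 \<le> 1" using B unfolding e1_def e2_def by (simp add: add_divide_distrib[symmetric])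
  have X: "X \<le> e1 powr q * s1"
    using level_ineq[of L t1] L t nu1 B en_nonneg[of L t1]
    unfolding X_def e1_def s1_def logdec_def by (simp add: powr_divide divide_right_mono)
  have s21: "s2 - s1 = ln (nu t1 / nu t2)"
    using nu_le_mu[OF t(1)] nu1 t(3) unfolding s1_def s2_def logdec_def by (simp add: ln_div)
  have mu1: "nu t2 \<le> mu t1" using nu_le_mu t by auto
  have "ln (mu t1 / nu t2) \<le> s2 - s1"
    unfolding s21 using mu_le_nu[of t1] mu1 t(3) nu1 by (simp add: divide_right_mono)
  then have "en t1 t2 powr q * ln (mu t1 / nu t2) \<le> en t1 t2 powr q * (s2 - s1)" by (intro mult_left_mono) auto
  then have Y: "Y \<le> e2 powr q * (s2 - s1)"
    using level_ineq[of t1 t2] L t B en_nonneg[of t1 t2]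
    unfolding Y_def e2_def by (simp add: powr_divide divide_right_mono)
  have s21n: "0 \<le> s2 - s1" unfolding s21 using nu_antimono[of t1 t2] t by simp
  have "s1 - l \<le> e1 powr q * s1" using d(1) X unfolding defect_def s1_def X_def by linarith
  then have "1 - z \<le> e1 powr q" using s1 unfolding z_def by (simp add: field_simps)
  \<comment> \<open>Young's inequality is here the tangent at 1 of a concave power; it converts
    \<open>1 - z \<le> e1 powr q\<close> into a linear bound on the energy left over.\<close>
  also have "e1 powr q \<le> q * e1 + (1 - q) * 1"
    using Youngs_inequality_0[of q "1 - q" e1 1] q_pos q_le e by (cases "e1 = 0") auto
  finally have "q * (1 - e1) \<le> z" by (simp add: algebra_simps)
  moreover have "q * e2 \<le> q * (1 - e1)" using e12 q_pos by (intro mult_left_mono) auto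
  ultimately have "q * e2 \<le> z" by linarith
  then have e2z: "e2 \<le> z / q" using q_pos by (simp add: le_divide_eq mult.commute)
  have z: "0 < z" "garsia * z \<le> 1" using l s1 unfolding z_def by (auto simp: field_simps)
  have \<sigma>: "0 < \<sigma>" "\<sigma> \<le> 1 / 2" using z garsia_pos unfolding \<sigma>_def by auto
  have "e2 / \<sigma> \<le> (z / q) / \<sigma>" using e2z \<sigma> by (intro divide_right_mono) auto
  also have "\<dots> = 1 / 2 powr (1 / q)" using z q_pos unfolding \<sigma>_def garsia_def by (simp add: field_simps)
  finally have "(e2 / \<sigma>) powr q \<le> (1 / 2 powr (1 / q)) powr q"
    using e \<sigma> q_pos by (intro powr_mono2) auto
  also have "\<dots> = 1 / 2" using q_pos by (simp add: powr_divide powr_powr)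
  finally have half: "e2 powr q / \<sigma> powr q \<le> 1 / 2" using e \<sigma> by (simp add: powr_divide)
  \<comment> \<open>The rise to \<open>t2\<close> is split at \<open>t1\<close>. The weight
    \<open>\<sigma>\<close> exceeds the share \<open>e2\<close> by so much that the upper part costs
    at most half of \<open>s2 - s1\<close>, which the left side absorbs, while the lower part grows
    only by \<open>2 * \<sigma> * s1 = garsia * l\<close>.\<close>
  have "s2 - l \<le> lam * (t2 - L) powr (1 + q) / B powr q" using d(2) unfolding defect_def s2_def by linarith
  also have "\<dots> = lam * ((t1 - L) + (t2 - t1)) powr (1 + q) / B powr q" by simp
  also have "\<dots> \<le> lam * ((t1 - L) powr (1 + q) / (1 - \<sigma>) powr q + (t2 - t1) powr (1 + q) / \<sigma> powr q) / B powr q"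
    using t \<sigma> q_pos B lam_pos by (intro divide_right_mono mult_left_mono powr_add_split) auto
  also have "\<dots> = X / (1 - \<sigma>) powr q + Y / \<sigma> powr q"
    unfolding X_def Y_def by (simp add: distrib_left add_divide_distrib mult.commute)
  also have "\<dots> \<le> s1 * (1 + 2 * \<sigma>) + 1 / 2 * (s2 - s1)"
  proof (rule add_mono)
    have "e1 powr q \<le> 1" using e e12 q_pos by (intro powr_le1) auto
    then have "X \<le> s1" using X s1 mult_right_mono[of "e1 powr q" 1 s1] by linarith
    moreover have "1 / (1 - \<sigma>) powr q \<le> 1 + 2 * \<sigma>"
    proof -
      have "(1 - \<sigma>) powr 1 \<le> (1 - \<sigma>) powr q" using \<sigma> q_le by (intro powr_mono') auto
      then have "1 / (1 - \<sigma>) powr q \<le> 1 / (1 - \<sigma>)" using \<sigma> by (intro divide_left_mono) auto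
      also have "\<dots> \<le> 1 + 2 * \<sigma>"
      proof -
        have "\<sigma> * \<sigma> \<le> \<sigma> * (1 / 2)" using \<sigma> by (intro mult_left_mono) auto
        then have "1 \<le> (1 + 2 * \<sigma>) * (1 - \<sigma>)" by (simp add: algebra_simps)
        then show ?thesis using \<sigma> by (simp add: divide_le_eq)
      qed
      finally show ?thesis .
    qed
    ultimately have "X * (1 / (1 - \<sigma>) powr q) \<le> s1 * (1 + 2 * \<sigma>)"
      using s1 by (intro mult_mono) auto
    then show "X / (1 - \<sigma>) powr q \<le> s1 * (1 + 2 * \<sigma>)" by simp
    have "Y / \<sigma> powr q \<le> e2 powr q * (s2 - s1) / \<sigma> powr q" using Y by (intro divide_right_mono) auto
    also have "\<dots> = (e2 powr q / \<sigma> powr q) * (s2 - s1)" by simp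
    also have "\<dots> \<le> 1 / 2 * (s2 - s1)" using half s21n by (intro mult_right_mono)
    finally show "Y / \<sigma> powr q \<le> 1 / 2 * (s2 - s1)" .
  qed
  also have "s1 * (1 + 2 * \<sigma>) = s1 + garsia * l"
    using s1 unfolding \<sigma>_def z_def by (simp add: field_simps)
  finally have fin: "s2 - l \<le> s1 + garsia * l + 1 / 2 * (s2 - s1)" .
  have "s2 - s1 \<le> 2 * G + 2 * l" if "s2 - l \<le> s1 + G + 1 / 2 * (s2 - s1)" for G :: real
    using that by (simp add: field_simps)
  from this[OF fin] show ?thesis unfolding s1_def s2_def by (simp add: algebra_simps)
qed

text \<open>Summation over the integer part \<open>l\<close> of the defect: at most
  \<open>(3 * garsia + 7) * (l + 1)\<close> layers, each contributing at most
  \<open>exp 1 * mu L\<close>, damped by \<open>exp (- l)\<close>.\<close>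

definition moser_const :: real where
  "moser_const = (\<Sum>l::nat. exp 1 * (3 * garsia + 7) * ((real l + 1) * exp (- 1) ^ l))"

lemma moser_const_summable: "summable (\<lambda>l::nat. exp 1 * (3 * garsia + 7) * ((real l + 1) * exp (- 1 :: real) ^ l))"
proof (rule summable_mult)
  have "summable (\<lambda>n. real (Suc n) * exp (- 1 :: real) ^ n)"
    using geometric_deriv_sums[of "exp (- 1) :: real"] sums_summable by fastforce
  then show "summable (\<lambda>l::nat. (real l + 1) * exp (- 1 :: real) ^ l)" by (simp add: add.commute)
qed

lemma moser_const_pos: "0 < moser_const"
  unfolding moser_const_def using garsia_pos by (intro suminf_pos moser_const_summable) (simp add: add_pos_pos)

text \<open>The indices up to \<open>garsia * l\<close> are few in any case; beyond them
  \<open>garsia_spread\<close> confines \<open>J\<close> to a window of length O(\<open>l\<close>)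
  above its lowest such index.\<close>

lemma card_layers:
  assumes L: "0 \<le> L" and B: "0 < B" "tail L \<le> B" and l: "1 \<le> l"
  defines "J \<equiv> {j. \<exists>t>L. 0 < nu t \<and> nat \<lfloor>logdec L t\<rfloor> = j \<and> defect L B t \<le> l}"
  shows "finite J" "real (card J) \<le> (3 * garsia + 7) * l"
proof -
  define a where "a = nat \<lceil>garsia * l\<rceil>"
  define b where "b = nat \<lceil>2 * (garsia + 1) * l\<rceil>"
  define j0 where "j0 = (LEAST j. j \<in> J \<and> garsia * l < real j)"
  have sub: "J \<subseteq> {..a} \<union> {j0..j0 + b + 1}"
  proof
    fix j assume j: "j \<in> J"
    show "j \<in> {..a} \<union> {j0..j0 + b + 1}"
    proof (cases "garsia * l < real j")
      case False
      then have "j \<le> a" unfolding a_def by linarith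
      then show ?thesis by simp
    next
      case True
      then have Pj: "j \<in> J \<and> garsia * l < real j" using j by simp
      have j0: "j0 \<in> J \<and> garsia * l < real j0" unfolding j0_def by (rule LeastI[of "\<lambda>j. j \<in> J \<and> garsia * l < real j", OF Pj])
      have le: "j0 \<le> j" unfolding j0_def by (rule Least_le[of "\<lambda>j. j \<in> J \<and> garsia * l < real j", OF Pj])
      obtain t where t: "L < t" "0 < nu t" "nat \<lfloor>logdec L t\<rfloor> = j" "defect L B t \<le> l" using j unfolding J_def by auto
      obtain t0 where t0: "L < t0" "0 < nu t0" "nat \<lfloor>logdec L t0\<rfloor> = j0" "defect L B t0 \<le> l" using j0 unfolding J_def by auto
      have s: "real j \<le> logdec L t" using t(3) logdec_nonneg[OF t(1,2)] by linarith
      have s0: "real j0 \<le> logdec L t0" "logdec L t0 \<le> real j0 + 1" using t0(3) logdec_nonneg[OF t0(1,2)] by linarith+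
      have "j \<le> j0 + b + 1"
      proof (cases "t0 < t")
        case True
        have "logdec L t - logdec L t0 \<le> 2 * (garsia + 1) * l"
          by (rule garsia_spread[OF L B t0(1) True t(2)]) (use l t t0 s0 j0 in auto)
        then have "real j \<le> real j0 + 1 + 2 * (garsia + 1) * l" using s s0 by linarith
        moreover have "2 * (garsia + 1) * l \<le> real b" unfolding b_def by linarith
        ultimately show ?thesis by linarith
      next
        case False
        then have "logdec L t \<le> logdec L t0" using logdec_mono[of L t t0] t t0 by auto
        then show ?thesis using s s0 by linarith
      qed
      then show ?thesis using le by simp
    qed
  qed
  then show "finite J" by (rule finite_subset) auto
  have "card J \<le> card ({..a} \<union> {j0..j0 + b + 1})" using sub by (intro card_mono) auto
  also have "\<dots> \<le> card {..a} + card {j0..j0 + b + 1}" by (rule card_Un_le)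
  also have "\<dots> = a + b + 3" by simp
  finally have "real (card J) \<le> real a + real b + 3" by linarith
  moreover have "real a \<le> garsia * l + 1" "real b \<le> 2 * (garsia + 1) * l + 1"
    using garsia_pos l unfolding a_def b_def by (auto intro: order_trans[OF of_nat_ceiling] simp: le_of_int_ceiling)+ 
  \<comment> \<open>Of the 7, the window contributes 2; the other 5 come from rounding and endpoints
    and are absorbed by \<open>1 \<le> l\<close>.\<close>
  ultimately show "real (card J) \<le> (3 * garsia + 7) * l" using l by (simp add: algebra_simps)
qed

theorem moser:
  assumes L: "0 \<le> L" and B: "0 < B" "tail L \<le> B"
  shows "(\<integral>\<^sup>+x. ennreal (exp (lam * (v x - L) powr (1 + q) / B powr q)) * indicator {x. L < v x} x \<partial>M)
    \<le> ennreal (moser_const * mu L)"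
proof -
  define J where "J l = {j. \<exists>t>L. 0 < nu t \<and> nat \<lfloor>logdec L t\<rfloor> = j \<and> defect L B t \<le> real l + 1}" for l :: nat
  have J: "finite (J l)" "real (card (J l)) \<le> (3 * garsia + 7) * (real l + 1)" for l
    using card_layers[OF L B, of "real l + 1"] unfolding J_def by auto
  \<comment> \<open>The factor \<open>exp (logdec L (v x))\<close> undoes the decay of the layers,
    so each layer counted in \<open>J l\<close> contributes at most the same amount.\<close>
  define k where "k l x = ennreal (exp (logdec L (v x))) * indicator {x. defect L B (v x) \<le> real l + 1} x" for l :: nat and x
  have k_meas [measurable]: "k l \<in> borel_measurable M" for l unfolding k_def defect_def by measurable
  have kint: "(\<integral>\<^sup>+x. k l x * indicator {x. L < v x} x \<partial>M) \<le> ennreal (exp 1 * (3 * garsia + 7) * (real l + 1) * mu L)" for l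
  proof -
    let ?h = "\<lambda>j. ennreal (exp (real j + 1)) * indicator (J l) j"
    have "(\<integral>\<^sup>+x. k l x * indicator {x. L < v x} x \<partial>M) \<le> (\<Sum>j. ?h j * ennreal (mu L * exp (- real j)))"
    proof (rule layer_bound)
      fix x assume x: "L < v x" "0 < nu (v x)"
      let ?j = "nat \<lfloor>logdec L (v x)\<rfloor>"
      have "logdec L (v x) \<le> real ?j + 1" using logdec_nonneg[OF x] by linarith
      then have "ennreal (exp (logdec L (v x))) \<le> ennreal (exp (real ?j + 1))" by (intro ennreal_leI) simp
      moreover have "?j \<in> J l" if "defect L B (v x) \<le> real l + 1" using that x unfolding J_def by auto
      ultimately show "k l x \<le> ?h ?j" unfolding k_def by (auto split: split_indicator)
    qed
    also have "\<dots> = (\<Sum>j\<in>J l. ?h j * ennreal (mu L * exp (- real j)))"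
      using J by (intro suminf_finite) auto
    also have "\<dots> = (\<Sum>j\<in>J l. ennreal (exp 1 * mu L))"
    proof (rule sum.cong[OF refl])
      fix j assume "j \<in> J l"
      moreover have "exp (real j + 1) * (mu L * exp (- real j)) = exp 1 * mu L"
        by (simp add: exp_add exp_minus field_simps)
      ultimately show "?h j * ennreal (mu L * exp (- real j)) = ennreal (exp 1 * mu L)"
        by (simp add: ennreal_mult[symmetric] mu_nonneg)
    qed
    also have "\<dots> = ennreal (real (card (J l)) * (exp 1 * mu L))"
      by (simp add: ennreal_mult mu_nonneg ennreal_of_nat_eq_real_of_nat)
    also have "\<dots> \<le> ennreal ((3 * garsia + 7) * (real l + 1) * (exp 1 * mu L))"
      using J mu_nonneg by (intro ennreal_leI mult_right_mono) auto
    finally show ?thesis by (simp add: algebra_simps)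
  qed
  have "(\<integral>\<^sup>+x. ennreal (exp (lam * (v x - L) powr (1 + q) / B powr q)) * indicator {x. L < v x} x \<partial>M)
    \<le> (\<integral>\<^sup>+x. (\<Sum>l. ennreal (exp (- real l)) * (k l x * indicator {x. L < v x} x)) \<partial>M)"
  proof (rule nn_integral_mono_AE)
    show "AE x in M. ennreal (exp (lam * (v x - L) powr (1 + q) / B powr q)) * indicator {x. L < v x} x
      \<le> (\<Sum>l. ennreal (exp (- real l)) * (k l x * indicator {x. L < v x} x))"
      using AE_nu_pos
    proof (rule AE_mp, intro AE_I2 impI)
      fix x assume x: "0 < nu (v x)"
      show "ennreal (exp (lam * (v x - L) powr (1 + q) / B powr q)) * indicator {x. L < v x} x
        \<le> (\<Sum>l. ennreal (exp (- real l)) * (k l x * indicator {x. L < v x} x))"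
      proof (cases "L < v x")
        case True
        let ?l = "nat \<lfloor>defect L B (v x)\<rfloor>"
        have d: "real ?l \<le> defect L B (v x)" "defect L B (v x) \<le> real ?l + 1"
          using defect_nonneg[OF L B True x] by linarith+
        have "lam * (v x - L) powr (1 + q) / B powr q \<le> - real ?l + logdec L (v x)"
          using d unfolding defect_def by linarith
        then have "ennreal (exp (lam * (v x - L) powr (1 + q) / B powr q)) \<le> ennreal (exp (- real ?l) * exp (logdec L (v x)))"
          unfolding exp_add[symmetric] by (intro ennreal_leI) simp
        also have "\<dots> = (\<Sum>l\<in>{?l}. ennreal (exp (- real l)) * (k l x * indicator {x. L < v x} x))"
          using d True by (simp add: k_def ennreal_mult)
        also have "\<dots> \<le> (\<Sum>l. ennreal (exp (- real l)) * (k l x * indicator {x. L < v x} x))"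
          by (rule sum_le_suminf) auto
        finally show ?thesis using True by simp
      qed simp
    qed
  qed
  also have "\<dots> = (\<Sum>l. ennreal (exp (- real l)) * (\<integral>\<^sup>+x. k l x * indicator {x. L < v x} x \<partial>M))"
    by (subst nn_integral_suminf) (auto intro!: suminf_cong nn_integral_cmult)
  also have "\<dots> \<le> (\<Sum>l. ennreal (exp (- real l)) * ennreal (exp 1 * (3 * garsia + 7) * (real l + 1) * mu L))"
    by (intro suminf_le mult_left_mono kint) auto
  also have "\<dots> = (\<Sum>l. ennreal (mu L * (exp 1 * (3 * garsia + 7) * ((real l + 1) * exp (- 1) ^ l))))"
  proof (rule suminf_cong)
    fix l :: nat
    have "exp (- 1 :: real) ^ l = exp (- real l)" by (simp add: exp_of_nat_mult[symmetric])
    then show "ennreal (exp (- real l)) * ennreal (exp 1 * (3 * garsia + 7) * (real l + 1) * mu L)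
      = ennreal (mu L * (exp 1 * (3 * garsia + 7) * ((real l + 1) * exp (- 1) ^ l)))"
      using garsia_pos mu_nonneg by (subst ennreal_mult[symmetric]) (auto simp: algebra_simps)
  qed
  also have "\<dots> = ennreal (\<Sum>l. mu L * (exp 1 * (3 * garsia + 7) * ((real l + 1) * exp (- 1) ^ l)))"
    using garsia_pos mu_nonneg by (intro suminf_ennreal2 summable_mult[OF moser_const_summable]) auto
  also have "(\<Sum>l. mu L * (exp 1 * (3 * garsia + 7) * ((real l + 1) * exp (- 1) ^ l))) = moser_const * mu L"
    unfolding moser_const_def by (subst suminf_mult[OF moser_const_summable]) simp
  finally show ?thesis .
qed

end

section \<open>From short level intervals to arbitrary ones\<close>

context level_energy begin

text \<open>The open superlevel sets decrease to the closed one as the level rises to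
  \<open>x\<close>. With the counterpart from the right, this keeps \<open>mu\<close> and
  \<open>nu\<close> comparable on short intervals ending or starting at \<open>x\<close>, even if
  \<open>v\<close> has a plateau there.\<close>

lemma mu_left_limit:
  assumes "m > nu x"
  obtains d where "0 < d" "\<And>u. x - d < u \<Longrightarrow> mu u < m"
proof -
  let ?A = "\<lambda>n::nat. {y \<in> space M. x - 1 / (real n + 1) < v y}"
  have "(\<lambda>n. measure M (?A n)) \<longlonglongrightarrow> measure M (\<Inter>n. ?A n)"
  proof (rule finite_Lim_measure_decseq)
    show "decseq ?A"
    proof (rule decseq_SucI, safe)
      fix n y assume "x - 1 / (real (Suc n) + 1) < v y"
      moreover have "1 / (real (Suc n) + 1) \<le> 1 / (real n + 1)" by (intro divide_left_mono) auto
      ultimately show "x - 1 / (real n + 1) < v y" by linarith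
    qed
  qed auto
  moreover have "(\<Inter>n. ?A n) = {y \<in> space M. x \<le> v y}"
  proof safe
    fix y assume y: "y \<in> (\<Inter>n. ?A n)"
    then show "y \<in> space M" by auto
    show "x \<le> v y"
    proof (rule ccontr)
      assume "\<not> x \<le> v y"
      then obtain n where "inverse (real (Suc n)) < x - v y" using reals_Archimedean[of "x - v y"] by auto
      moreover have "x - 1 / (real n + 1) < v y" using y by auto
      ultimately show False by (simp add: inverse_eq_divide add.commute)
    qed
  next
    fix y and n :: nat assume "x \<le> v y"
    moreover have "1 / (real n + 1) > 0" by simp
    ultimately show "x - 1 / (real n + 1) < v y" by linarith
  qed
  ultimately have "(\<lambda>n. mu (x - 1 / (real n + 1))) \<longlonglongrightarrow> nu x" unfolding mu_def nu_def by simp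
  then have "eventually (\<lambda>n. mu (x - 1 / (real n + 1)) < m) sequentially" using assms by (rule order_tendstoD)
  then obtain n where n: "mu (x - 1 / (real n + 1)) < m" by (meson eventually_happens trivial_limit_sequentially)
  have "mu u < m" if "x - 1 / (real n + 1) < u" for u
  proof -
    have "mu u \<le> mu (x - 1 / (real n + 1))" unfolding mu_def by (intro finite_measure_mono) (use that in auto)
    then show ?thesis using n by linarith
  qed
  then show ?thesis by (intro that[of "1 / (real n + 1)"]) auto
qed

lemma nu_right_limit:
  assumes "m < mu x"
  obtains d where "0 < d" "\<And>u. u < x + d \<Longrightarrow> m < nu u"
proof -
  let ?A = "\<lambda>n::nat. {y \<in> space M. x + 1 / (real n + 1) \<le> v y}"
  have "(\<lambda>n. measure M (?A n)) \<longlonglongrightarrow> measure M (\<Union>n. ?A n)"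
  proof (rule finite_Lim_measure_incseq)
    show "incseq ?A"
    proof (rule incseq_SucI, safe)
      fix n y assume "x + 1 / (real n + 1) \<le> v y"
      moreover have "1 / (real (Suc n) + 1) \<le> 1 / (real n + 1)" by (intro divide_left_mono) auto
      ultimately show "x + 1 / (real (Suc n) + 1) \<le> v y" by linarith
    qed
  qed auto
  moreover have "(\<Union>n. ?A n) = {y \<in> space M. x < v y}"
  proof safe
    fix y and n :: nat assume "x + 1 / (real n + 1) \<le> v y"
    moreover have "1 / (real n + 1) > 0" by simp
    ultimately show "x < v y" by linarith
  next
    fix y assume y: "y \<in> space M" "x < v y"
    then obtain n where "inverse (real (Suc n)) < v y - x" using reals_Archimedean[of "v y - x"] by auto
    then have "x + 1 / (real n + 1) \<le> v y" by (simp add: inverse_eq_divide add.commute)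
    then show "y \<in> (\<Union>n. ?A n)" using y by blast
  qed
  ultimately have "(\<lambda>n. nu (x + 1 / (real n + 1))) \<longlonglongrightarrow> mu x" unfolding mu_def nu_def by simp
  then have "eventually (\<lambda>n. m < nu (x + 1 / (real n + 1))) sequentially" using assms by (rule order_tendstoD)
  then obtain n where n: "m < nu (x + 1 / (real n + 1))" by (meson eventually_happens trivial_limit_sequentially)
  have "m < nu u" if "u < x + 1 / (real n + 1)" for u
    using n nu_antimono[of u "x + 1 / (real n + 1)"] that by linarith
  then show ?thesis by (intro that[of "1 / (real n + 1)"]) auto
qed

text \<open>\<open>powr_add_split\<close>, weighted by the shares of the energy, makes both terms
  carry the sum of the two energies. The logarithms add up in the right direction, since a plateau
  at \<open>y\<close> contributes \<open>ln (mu y / nu y) \<le> 0\<close>. The factor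
  \<open>c\<close> makes room for the error \<open>1 + \<eta>\<close> of the local estimate and is
  not worsened.\<close>

lemma level_inequality_concat:
  assumes c: "0 \<le> c" and xyz: "x < y" "y < z" "0 < nu z"
    and 1: "lam * (y - x) powr (1 + q) \<le> c * (en x y powr q * ln (mu x / nu y))"
    and 2: "lam * (z - y) powr (1 + q) \<le> c * (en y z powr q * ln (mu y / nu z))"
  shows "lam * (z - x) powr (1 + q) \<le> c * (en x z powr q * ln (mu x / nu z))"
proof -
  define e1 where "e1 = en x y"
  define e2 where "e2 = en y z"
  define l1 where "l1 = ln (mu x / nu y)"
  define l2 where "l2 = ln (mu y / nu z)"
  have ord: "nu z \<le> mu y" "mu y \<le> nu y" "nu y \<le> mu x" using nu_le_mu mu_le_nu xyz by auto
  have "0 < lam * (y - x) powr (1 + q)" "0 < lam * (z - y) powr (1 + q)" using lam_pos xyz by auto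
  \<comment> \<open>\<open>0 powr q\<close> is 0, so a vanishing energy would contradict the
    positive left sides.\<close>
  then have "e1 \<noteq> 0" "e2 \<noteq> 0" using 1 2 q_pos unfolding e1_def e2_def by auto
  then have e: "0 < e1" "0 < e2" using en_nonneg unfolding e1_def e2_def by (auto simp: less_le)
  have l: "0 \<le> l1" "0 \<le> l2" using ord xyz unfolding l1_def l2_def by auto
  have ll: "l1 + l2 \<le> ln (mu x / nu z)"
  proof -
    have "l1 + l2 = ln (mu x) - ln (nu z) + (ln (mu y) - ln (nu y))"
      unfolding l1_def l2_def using ord xyz by (simp add: ln_div)
    also have "\<dots> \<le> ln (mu x) - ln (nu z)" using ord xyz by simp
    finally show ?thesis using ord xyz by (simp add: ln_div)
  qed
  define \<sigma> where "\<sigma> = e2 / (e1 + e2)"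
  have \<sigma>: "0 < \<sigma>" "\<sigma> < 1" "1 - \<sigma> = e1 / (e1 + e2)" unfolding \<sigma>_def using e by (auto simp: field_simps)
  have "lam * (z - x) powr (1 + q) = lam * ((y - x) + (z - y)) powr (1 + q)" by simp
  also have "\<dots> \<le> lam * ((y - x) powr (1 + q) / (1 - \<sigma>) powr q + (z - y) powr (1 + q) / \<sigma> powr q)"
    using xyz \<sigma> q_pos lam_pos by (intro mult_left_mono powr_add_split) auto
  also have "\<dots> = lam * (y - x) powr (1 + q) / (1 - \<sigma>) powr q + lam * (z - y) powr (1 + q) / \<sigma> powr q"
    by (simp add: distrib_left)
  also have "\<dots> \<le> c * (e1 powr q * l1) / (1 - \<sigma>) powr q + c * (e2 powr q * l2) / \<sigma> powr q"
    using 1 2 unfolding e1_def e2_def l1_def l2_def by (intro add_mono divide_right_mono) auto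
  also have "\<dots> = c * ((e1 + e2) powr q * l1) + c * ((e1 + e2) powr q * l2)"
    unfolding \<sigma>(3) using e by (simp add: \<sigma>_def powr_divide)
  also have "\<dots> = c * ((e1 + e2) powr q * (l1 + l2))" by (simp add: algebra_simps)
  also have "\<dots> \<le> c * (en x z powr q * ln (mu x / nu z))"
    using c e l ll q_pos en_add_le[of y z x] xyz unfolding e1_def e2_def
    by (intro mult_left_mono mult_mono powr_mono2) auto
  finally show ?thesis .
qed

text \<open>If \<open>mu x \<le> (1 + \<eta>) * nu y\<close>, then \<open>r = mu x / nu y\<close>
  satisfies \<open>r - 1 \<le> (1 + \<eta>) * ln r\<close>, so the base inequality is the claim up
  to \<open>1 + \<eta>\<close>. Short intervals on either side of a level are of this kind,
  concatenation does not worsen the factor, and Bolzano's bisection extends the estimate to all of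
  \<open>(a, b)\<close> before \<open>\<eta>\<close> tends to 0.\<close>

lemma level_inequalityI:
  assumes base: "\<And>a b. 0 \<le> a \<Longrightarrow> a < b \<Longrightarrow> 0 < nu b \<Longrightarrow>
    lam * (b - a) powr (1 + q) \<le> en a b powr q * ((mu a - nu b) / nu b)"
  shows "level_inequality M v f lam q"
proof
  fix a b :: real
  assume ab: "0 \<le> a" "a < b" "0 < nu b"
  have approx: "lam * (b - a) powr (1 + q) \<le> (1 + \<eta>) * (en a b powr q * ln (mu a / nu b))" if \<eta>: "0 < \<eta>" for \<eta>
  proof -
    \<comment> \<open>The order and range conditions are hypotheses inside \<open>P\<close>, so that
      it holds vacuously for the degenerate or protruding intervals that the bisection principle
      also quantifies over.\<close>
    define P where "P x y \<longleftrightarrow> (a \<le> x \<longrightarrow> x < y \<longrightarrow> y \<le> b \<longrightarrow>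
      lam * (y - x) powr (1 + q) \<le> (1 + \<eta>) * (en x y powr q * ln (mu x / nu y)))" for x y
    have nu_pos: "0 < nu y" if "y \<le> b" for y using nu_antimono[OF that] ab by linarith
    have close: "P x y" if "mu x \<le> (1 + \<eta>) * nu y" for x y
      unfolding P_def
    proof (intro impI)
      assume xy: "a \<le> x" "x < y" "y \<le> b"
      define r where "r = mu x / nu y"
      have r: "1 \<le> r" "r \<le> 1 + \<eta>" unfolding r_def using nu_pos[OF xy(3)] nu_le_mu[OF xy(2)] that by (auto simp: field_simps)
      have "lam * (y - x) powr (1 + q) \<le> en x y powr q * ((mu x - nu y) / nu y)"
        using base[of x y] xy ab nu_pos by auto
      also have "(mu x - nu y) / nu y = r - 1" unfolding r_def using nu_pos[OF xy(3)] by (simp add: field_simps)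
      also have "r - 1 \<le> (1 + \<eta>) * ln r"
      proof -
        have "ln (1 / r) \<le> 1 / r - 1" using r by (intro ln_le_minus_one) auto
        then have "(r - 1) / r \<le> ln r" using r by (simp add: ln_div field_simps)
        then have "r - 1 \<le> r * ln r" using r by (simp add: field_simps)
        also have "\<dots> \<le> (1 + \<eta>) * ln r" using r by (intro mult_right_mono) auto
        finally show ?thesis .
      qed
      finally show "lam * (y - x) powr (1 + q) \<le> (1 + \<eta>) * (en x y powr q * ln (mu x / nu y))"
        unfolding r_def by (simp add: mult_left_mono mult.left_commute)
    qed
    have trans: "P x z" if "P x y" "P y z" "x \<le> y" "y \<le> z" for x y z
    proof (cases "x = y \<or> y = z")
      case True
      then show ?thesis using that by auto
    next
      case False
      then have lt: "x < y" "y < z" using that by auto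
      show ?thesis
        unfolding P_def
      proof (intro impI)
        assume "a \<le> x" "x < z" "z \<le> b"
        then show "lam * (z - x) powr (1 + q) \<le> (1 + \<eta>) * (en x z powr q * ln (mu x / nu z))"
          using that lt \<eta> nu_pos[of z] unfolding P_def by (intro level_inequality_concat[of _ x y z]) auto
      qed
    qed
    have "P a b"
    proof (rule Bolzano[of a b P])
      show "a \<le> b" using ab by simp
      show "P x z" if "P x y" "P y z" "x \<le> y" "y \<le> z" for x y z using trans[OF that] .
      fix x assume x: "a \<le> x" "x \<le> b"
      have "nu x < (1 + \<eta>) * nu x" using nu_pos[OF x(2)] \<eta> by simp
      then obtain d1 where d1: "0 < d1" "\<And>u. x - d1 < u \<Longrightarrow> mu u < (1 + \<eta>) * nu x" using mu_left_limit by blast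
      have left: "P u x" if "x - d1 < u" for u using close d1(2)[OF that] by simp
      \<comment> \<open>At the right end \<open>mu b\<close> may vanish, but nothing is to be shown
        beyond \<open>b\<close>.\<close>
      obtain d2 where d2: "0 < d2" "\<And>w. x \<le> w \<Longrightarrow> w < x + d2 \<Longrightarrow> P x w"
      proof (cases "x = b")
        case True
        then show ?thesis by (intro that[of 1]) (auto simp: P_def)
      next
        case False
        then have "0 < mu x" using nu_le_mu[of x b] x ab by auto
        then have "mu x / (1 + \<eta>) < mu x" using \<eta> by (simp add: field_simps)
        then obtain d where d: "0 < d" "\<And>u. u < x + d \<Longrightarrow> mu x / (1 + \<eta>) < nu u" using nu_right_limit by blast
        have "P x w" if "w < x + d" for w
          by (rule close) (use d(2)[OF that] \<eta> in \<open>simp add: field_simps\<close>)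
        then show ?thesis using that[of d] d by auto
      qed
      show "\<exists>d>0. \<forall>u w. u \<le> x \<and> x \<le> w \<and> w - u < d \<longrightarrow> P u w"
      proof (intro exI[of _ "min d1 d2"] conjI allI impI)
        fix u w assume uw: "u \<le> x \<and> x \<le> w \<and> w - u < min d1 d2"
        show "P u w" by (rule trans[of u x w]) (use uw left d2 in auto)
      qed (use d1 d2 in auto)
    qed
    then show ?thesis using ab unfolding P_def by auto
  qed
  have "((\<lambda>\<eta>. (1 + \<eta>) * (en a b powr q * ln (mu a / nu b))) \<longlongrightarrow> (1 + 0) * (en a b powr q * ln (mu a / nu b))) (at_right 0)"
    by (intro tendsto_intros)
  then have "lam * (b - a) powr (1 + q) \<le> (1 + 0) * (en a b powr q * ln (mu a / nu b))"
    by (rule tendsto_lowerbound) (auto simp: eventually_at_filter intro!: always_eventually approx)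
  then show "lam * (b - a) powr (1 + q) \<le> en a b powr q * ln (mu a / nu b)" by simp
qed

end

section \<open>Control of the Lebesgue norm by a nearly maximal level\<close>

context level_energy begin

lemma en_add_tail_le:
  assumes "b \<le> c" shows "en a b + tail c \<le> (\<integral>x. f x \<partial>M)"
proof -
  have "en a b + tail c = (\<integral>x. f x * indicator {x. a < v x \<and> v x < b} x + f x * indicator {x. c < v x} x \<partial>M)"
    unfolding en_def tail_def
    by (intro Bochner_Integration.integral_add[symmetric] integrable_f_indicator) measurable
  also have "\<dots> \<le> (\<integral>x. f x \<partial>M)"
    by (intro integral_mono Bochner_Integration.integrable_add integrable_f_indicator f_int; (measurable)?)
       (use assms f_nonneg in \<open>auto split: split_indicator\<close>)
  finally show ?thesis .
qed

lemma tail_nonneg: "0 \<le> tail a"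
  using en_nonneg[of a a] en_le_tail[of a a] by linarith

lemma integral_low_add_tail: "(\<integral>x. f x * indicator {x. v x \<le> a} x \<partial>M) + tail a = (\<integral>x. f x \<partial>M)"
proof -
  have "(\<integral>x. f x * indicator {x. v x \<le> a} x \<partial>M) + tail a
     = (\<integral>x. f x * indicator {x. v x \<le> a} x + f x * indicator {x. a < v x} x \<partial>M)"
    unfolding tail_def
    by (intro Bochner_Integration.integral_add[symmetric] integrable_f_indicator) measurable
  also have "\<dots> = (\<integral>x. f x \<partial>M)"
    by (intro Bochner_Integration.integral_cong refl) (auto split: split_indicator)
  finally show ?thesis .
qed

lemma integrable_powr_bounded:
  assumes "\<And>x. v x \<le> V" "0 \<le> p" "Measurable.pred M P"
  shows "integrable M (\<lambda>x. v x powr p * indicator {x. P x} x)"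
proof (rule integrable_const_bound[where B = "V powr p"])
  show "AE x in M. norm (v x powr p * indicator {x. P x} x) \<le> V powr p"
    using assms v_nonneg by (intro AE_I2) (auto split: split_indicator intro!: powr_mono2)
qed (use assms in measurable)

text \<open>At the level \<open>t = v x\<close> the hypothesis reads
  \<open>v x powr p \<le> D * nu (v x) powr - (1 / 2)\<close>, and
  \<open>nu_inverse_sqrt_integral\<close> integrates the right side.\<close>

lemma integral_powr_tail_le:
  assumes V: "\<And>x. v x \<le> V" and p: "0 < p" and L: "0 \<le> L" and D: "0 \<le> D"
    and le: "\<And>t. 0 < t \<Longrightarrow> t powr p * nu t powr (1 / 2) \<le> D"
  shows "(\<integral>x. v x powr p * indicator {x. L < v x} x \<partial>M) \<le> D * half_const * mu L powr (1 / 2)"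
proof -
  have "ennreal (\<integral>x. v x powr p * indicator {x. L < v x} x \<partial>M)
    = (\<integral>\<^sup>+x. ennreal (v x powr p * indicator {x. L < v x} x) \<partial>M)"
    by (rule nn_integral_eq_integral[symmetric])
       (use integrable_powr_bounded[OF V, of p "\<lambda>x. L < v x"] p in \<open>auto split: split_indicator\<close>)
  also have "\<dots> \<le> (\<integral>\<^sup>+x. ennreal D * (ennreal (nu (v x) powr - (1 / 2)) * indicator {x. L < v x} x) \<partial>M)"
  proof (rule nn_integral_mono_AE)
    show "AE x in M. ennreal (v x powr p * indicator {x. L < v x} x) \<le> ennreal D * (ennreal (nu (v x) powr - (1 / 2)) * indicator {x. L < v x} x)"
      using AE_nu_pos
    proof (rule AE_mp, intro AE_I2 impI)
      fix x assume x: "0 < nu (v x)"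
      show "ennreal (v x powr p * indicator {x. L < v x} x) \<le> ennreal D * (ennreal (nu (v x) powr - (1 / 2)) * indicator {x. L < v x} x)"
      proof (cases "L < v x")
        case True
        then have "v x powr p * nu (v x) powr (1 / 2) \<le> D" using L by (intro le) auto
        then have "v x powr p \<le> D * nu (v x) powr - (1 / 2)"
          using x by (simp add: powr_minus field_simps)
        then have "ennreal (v x powr p) \<le> ennreal (D * nu (v x) powr - (1 / 2))" by (rule ennreal_leI)
        then show ?thesis using True D by (simp add: ennreal_mult)
      qed simp
    qed
  qed
  also have "\<dots> = ennreal D * (\<integral>\<^sup>+x. ennreal (nu (v x) powr - (1 / 2)) * indicator {x. L < v x} x \<partial>M)"
    by (rule nn_integral_cmult) measurable
  also have "\<dots> \<le> ennreal D * ennreal (half_const * mu L powr (1 / 2))"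
    by (intro mult_left_mono nu_inverse_sqrt_integral) simp
  also have "\<dots> = ennreal (D * half_const * mu L powr (1 / 2))"
    using D half_const_pos by (simp add: ennreal_mult[symmetric] mult.assoc)
  finally show ?thesis using D half_const_pos by (subst (asm) ennreal_le_iff) auto
qed

text \<open>The supremum need not be attained, whence the factor 2. The bound on \<open>v\<close>
  makes it finite and the level of positive measure makes it positive.\<close>

lemma near_maximal_level:
  assumes V: "\<And>x. v x \<le> V" and p: "0 < p" and ex: "0 < t" "0 < nu t"
  obtains L where "0 < L" "0 < nu L" "\<And>t. 0 < t \<Longrightarrow> t powr p * nu t powr (1 / 2) \<le> 2 * (L powr p * nu L powr (1 / 2))"
proof -
  let ?\<phi> = "\<lambda>t. t powr p * nu t powr (1 / 2)"
  have bd: "?\<phi> t \<le> V powr p * measure M (space M) powr (1 / 2)" if "0 < t" for t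
  proof (cases "t \<le> V")
    case True
    then show ?thesis using that p nu_nonneg nu_le_space by (intro mult_mono powr_mono2) auto
  next
    case False
    then have "{x \<in> space M. t \<le> v x} = {}" using V by (auto simp: not_le intro: le_less_trans)
    then have "nu t = 0" unfolding nu_def by (metis measure_empty)
    then show ?thesis by simp
  qed
  define S where "S = (SUP t\<in>{0<..}. ?\<phi> t)"
  have bdd: "bdd_above (?\<phi> ` {0<..})" using bd by (intro bdd_aboveI2) auto
  have up: "?\<phi> t \<le> S" if "0 < t" for t unfolding S_def using that bdd by (intro cSUP_upper) auto
  have "0 < ?\<phi> t" using ex by simp
  then have "0 < S" using up[OF ex(1)] by linarith
  then have "S / 2 < S" by simp
  then have "\<exists>L\<in>{0<..}. S / 2 < ?\<phi> L"
    using less_cSUP_iff[OF _ bdd, of "S / 2"] unfolding S_def[symmetric] by simp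
  then obtain L where L: "0 < L" "S / 2 < ?\<phi> L" by auto
  have "nu L \<noteq> 0" using L \<open>0 < S\<close> by auto
  then have "0 < nu L" using nu_nonneg[of L] by linarith
  moreover have "?\<phi> t \<le> 2 * ?\<phi> L" if "0 < t" for t using up[OF that] L by linarith
  ultimately show ?thesis using L that by blast
qed

end

section \<open>Exponential integrals split at a level\<close>

context level_inequality begin

text \<open>The energy \<open>e0\<close> spent below \<open>L\<close> leaves at most
  \<open>1 - \<sigma>\<close> above, with \<open>\<sigma>\<close> close to \<open>e0\<close>.
  Passing from \<open>v - L\<close> to \<open>v\<close> in the exponent then costs
  \<open>s + 4\<close>, and \<open>exp s\<close> cancels against
  \<open>mu L \<le> A * exp (- s)\<close>. Below \<open>L\<close> the total energy may exceed 1 by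
  up to \<open>\<eta> * E\<close>, but there the exponent is at most \<open>E powr q * s\<close>, so
  the correction stays bounded because \<open>\<eta> * s \<le> 1\<close>.\<close>

lemma integral_exp_large:
  assumes L: "0 < L" "0 < nu L" and \<eta>: "0 < \<eta>" "\<eta> \<le> 1 / 4"
  defines "A \<equiv> measure M (space M)"
  defines "s \<equiv> ln (A / nu L)"
  assumes \<eta>s: "\<eta> * s \<le> 1" and f1: "(\<integral>x. f x \<partial>M) \<le> 1 + \<eta> * en 0 L" and fE: "(\<integral>x. f x \<partial>M) \<le> E"
  shows "(\<integral>\<^sup>+x. ennreal (exp (lam * v x powr (1 + q))) \<partial>M)
    \<le> ennreal (A * (1 + moser_const * exp (E powr (1 + q)) + moser_const * exp 4))"
proof -
  define e0 where "e0 = en 0 L"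
  have A: "nu L \<le> A" "mu 0 \<le> A" "0 < A" unfolding A_def using nu_le_space[of L] mu_le_space[of 0] L by auto
  have s: "0 \<le> s" unfolding s_def using A L by simp
  have nuL: "nu L = A * exp (- s)" unfolding s_def using A L by (simp add: exp_minus)
  have "lam * L powr (1 + q) \<le> e0 powr q * ln (mu 0 / nu L)"
    using level_ineq[of 0 L] L unfolding e0_def by simp
  also have "\<dots> \<le> e0 powr q * s"
    unfolding s_def using A L nu_le_mu[of 0 L] by (intro mult_left_mono) (auto simp: divide_right_mono)
  finally have key: "lam * L powr (1 + q) \<le> e0 powr q * s" .
  moreover have "0 < lam * L powr (1 + q)" using lam_pos L by simp
  ultimately have "e0 \<noteq> 0" by auto
  then have e0: "0 < e0" using en_nonneg[of 0 L] unfolding e0_def by linarith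
  have "e0 + tail L \<le> (\<integral>x. f x \<partial>M)" unfolding e0_def by (rule en_add_tail_le) simp
  then have tl: "tail L \<le> 1 + \<eta> * e0 - e0" and eE: "e0 \<le> E" using f1 fE tail_nonneg[of L] unfolding e0_def by linarith+
  have E0: "0 < E" using eE e0 by linarith
  \<comment> \<open>The tail estimate would allow \<open>(1 - \<eta>) * e0\<close>. Giving up
    another \<open>\<eta> * e0\<close> makes \<open>\<sigma> < 1\<close> strict, so that
    \<open>1 - \<sigma>\<close> is an admissible allowance in \<open>moser\<close>.\<close>
  define \<sigma> where "\<sigma> = (1 - 2 * \<eta>) * e0"
  have "\<eta> * e0 > 0" using \<eta> e0 by simp
  moreover have "\<sigma> = e0 - 2 * (\<eta> * e0)" unfolding \<sigma>_def by (simp add: algebra_simps)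
  moreover have "0 < \<sigma>" unfolding \<sigma>_def using \<eta> e0 by simp
  ultimately have \<sigma>: "0 < \<sigma>" "\<sigma> < 1" "tail L \<le> 1 - \<sigma>"
    using tl tail_nonneg[of L] by linarith+
  have hi: "lam * v x powr (1 + q) \<le> s + 4 + lam * (v x - L) powr (1 + q) / (1 - \<sigma>) powr q" if "L < v x" for x
  proof -
    have "lam * v x powr (1 + q) = lam * ((v x - L) + L) powr (1 + q)" by simp
    also have "\<dots> \<le> lam * ((v x - L) powr (1 + q) / (1 - \<sigma>) powr q + L powr (1 + q) / \<sigma> powr q)"
      using that L \<sigma> q_pos lam_pos by (intro mult_left_mono powr_add_split) auto
    also have "\<dots> = lam * (v x - L) powr (1 + q) / (1 - \<sigma>) powr q + lam * L powr (1 + q) / \<sigma> powr q"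
      by (simp add: distrib_left)
    also have "lam * L powr (1 + q) / \<sigma> powr q \<le> e0 powr q * s / \<sigma> powr q"
      using key by (intro divide_right_mono) auto
    also have "e0 powr q * s / \<sigma> powr q = s / (1 - 2 * \<eta>) powr q"
      unfolding \<sigma>_def using e0 \<eta> by (simp add: powr_mult)
    also have "\<dots> \<le> s / (1 - 2 * \<eta>)"
    proof -
      have "(1 - 2 * \<eta>) powr 1 \<le> (1 - 2 * \<eta>) powr q" using \<eta> q_le by (intro powr_mono') auto
      then show ?thesis using s \<eta> by (intro divide_left_mono) auto
    qed
    \<comment> \<open>Here \<open>\<eta> \<le> 1 / 4\<close> enters; together with
      \<open>\<eta> * s \<le> 1\<close> this is the source of the 4 in \<open>s + 4\<close>.\<close>
    also have "\<dots> \<le> s * (1 + 4 * \<eta>)"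
    proof -
      have "\<eta> * \<eta> \<le> \<eta> * (1 / 4)" using \<eta> by (intro mult_left_mono) auto
      then have "1 \<le> (1 + 4 * \<eta>) * (1 - 2 * \<eta>)" by (simp add: algebra_simps)
      then have "s * 1 \<le> s * ((1 + 4 * \<eta>) * (1 - 2 * \<eta>))" using s by (intro mult_left_mono)
      then show ?thesis using \<eta> by (simp add: divide_le_eq mult.assoc)
    qed
    also have "\<dots> \<le> s + 4" using \<eta>s by (simp add: algebra_simps)
    finally show ?thesis by simp
  qed
  define B where "B = 1 + \<eta> * E"
  have B: "1 \<le> B" "0 < B" unfolding B_def using \<eta> E0 by (auto intro: add_pos_nonneg)
  have "en 0 0 + tail 0 \<le> (\<integral>x. f x \<partial>M)" by (rule en_add_tail_le) simp
  then have "tail 0 \<le> 1 + \<eta> * e0" using f1 en_nonneg[of 0 0] unfolding e0_def by linarith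
  also have "\<dots> \<le> B" unfolding B_def using eE \<eta> by simp
  finally have tail0: "tail 0 \<le> B" .
  have lo: "lam * v x powr (1 + q) \<le> E powr (1 + q) + lam * (v x - 0) powr (1 + q) / B powr q" if "v x \<le> L" for x
  proof -
    have "B powr q \<le> B powr 1" using B q_le by (intro powr_mono) auto
    then have "1 / B \<le> 1 / B powr q" using B by (intro divide_left_mono) auto
    moreover have "1 - \<eta> * E \<le> 1 / B"
    proof -
      have "(1 - \<eta> * E) * (1 + \<eta> * E) = 1 - (\<eta> * E) * (\<eta> * E)" by (simp add: algebra_simps)
      then have "(1 - \<eta> * E) * (1 + \<eta> * E) \<le> 1" by simp
      then show ?thesis using B unfolding B_def by (simp add: le_divide_eq)
    qed
    ultimately have "1 - 1 / B powr q \<le> \<eta> * E" by linarith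
    moreover have "lam * v x powr (1 + q) \<le> E powr q * s"
    proof -
      have "lam * v x powr (1 + q) \<le> lam * L powr (1 + q)"
        using that lam_pos v_nonneg q_pos by (intro mult_left_mono powr_mono2) auto
      also have "\<dots> \<le> E powr q * s"
        using key e0 eE q_pos s by (intro order_trans[OF key] mult_right_mono powr_mono2) auto
      finally show ?thesis .
    qed
    moreover have "0 \<le> 1 - 1 / B powr q" using B q_pos by (simp add: ge_one_powr_ge_zero)
    ultimately have "lam * v x powr (1 + q) * (1 - 1 / B powr q) \<le> (E powr q * s) * (\<eta> * E)"
      using s by - (rule mult_mono, auto)
    also have "\<dots> = (E powr q * E) * (\<eta> * s)" by simp
    also have "\<dots> \<le> (E powr q * E) * 1" using \<eta>s E0 by (intro mult_left_mono) auto
    also have "\<dots> = E powr (1 + q)" using E0 by (simp add: powr_add)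
    finally show ?thesis by (simp add: algebra_simps)
  qed
  let ?i0 = "\<lambda>x. ennreal (exp (lam * (v x - 0) powr (1 + q) / B powr q)) * indicator {x. 0 < v x} x"
  let ?iL = "\<lambda>x. ennreal (exp (lam * (v x - L) powr (1 + q) / (1 - \<sigma>) powr q)) * indicator {x. L < v x} x"
  have "(\<integral>\<^sup>+x. ennreal (exp (lam * v x powr (1 + q))) \<partial>M)
    \<le> (\<integral>\<^sup>+x. 1 + (ennreal (exp (E powr (1 + q))) * ?i0 x + ennreal (exp (s + 4)) * ?iL x) \<partial>M)"
  proof (rule nn_integral_mono)
    fix x
    consider "v x = 0" | "0 < v x" "v x \<le> L" | "L < v x" "0 < v x" using v_nonneg[of x] L by linarith
    then show "ennreal (exp (lam * v x powr (1 + q))) \<le> 1 + (ennreal (exp (E powr (1 + q))) * ?i0 x + ennreal (exp (s + 4)) * ?iL x)"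
    proof cases
      case 1
      then show ?thesis using q_pos by simp
    next
      case 2
      have "ennreal (exp (lam * v x powr (1 + q))) \<le> ennreal (exp (E powr (1 + q)) * exp (lam * (v x - 0) powr (1 + q) / B powr q))"
        unfolding exp_add[symmetric] using lo[of x] 2 by (intro ennreal_leI) simp
      also have "\<dots> = ennreal (exp (E powr (1 + q))) * ?i0 x" using 2 by (simp add: ennreal_mult)
      also have "\<dots> \<le> 1 + (ennreal (exp (E powr (1 + q))) * ?i0 x + ennreal (exp (s + 4)) * ?iL x)"
        by (simp add: add_increasing add_increasing2)
      finally show ?thesis .
    next
      case 3
      have "ennreal (exp (lam * v x powr (1 + q))) \<le> ennreal (exp (s + 4) * exp (lam * (v x - L) powr (1 + q) / (1 - \<sigma>) powr q))"
        unfolding exp_add[symmetric] using hi[of x] 3 by (intro ennreal_leI) simp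
      also have "\<dots> = ennreal (exp (s + 4)) * ?iL x" using 3 by (simp add: ennreal_mult)
      also have "\<dots> \<le> 1 + (ennreal (exp (E powr (1 + q))) * ?i0 x + ennreal (exp (s + 4)) * ?iL x)"
        by (simp add: add_increasing)
      finally show ?thesis .
    qed
  qed
  also have "\<dots> = ennreal A + (ennreal (exp (E powr (1 + q))) * (\<integral>\<^sup>+x. ?i0 x \<partial>M) + ennreal (exp (s + 4)) * (\<integral>\<^sup>+x. ?iL x \<partial>M))"
    by (simp add: nn_integral_add nn_integral_cmult emeasure_eq_measure A_def)
  also have "\<dots> \<le> ennreal A + (ennreal (exp (E powr (1 + q))) * ennreal (moser_const * mu 0) + ennreal (exp (s + 4)) * ennreal (moser_const * mu L))"
    using moser[of 0 B] moser[of L "1 - \<sigma>"] B tail0 L \<sigma> by (intro add_mono mult_left_mono) auto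
  also have "\<dots> = ennreal (A + (exp (E powr (1 + q)) * (moser_const * mu 0) + exp (s + 4) * (moser_const * mu L)))"
    using moser_const_pos mu_nonneg A by (simp add: ennreal_mult[symmetric] ennreal_plus[symmetric] del: ennreal_plus)
  also have "\<dots> \<le> ennreal (A * (1 + moser_const * exp (E powr (1 + q)) + moser_const * exp 4))"
  proof (rule ennreal_leI)
    have le0: "exp (E powr (1 + q)) * (moser_const * mu 0) \<le> exp (E powr (1 + q)) * (moser_const * A)"
      using A moser_const_pos by (intro mult_left_mono) auto
    have "exp (s + 4) * (moser_const * mu L) \<le> exp (s + 4) * (moser_const * (A * exp (- s)))"
      using moser_const_pos mu_le_nu[of L] nuL by (intro mult_left_mono) auto
    also have "exp (s + 4) * (moser_const * (A * exp (- s))) = moser_const * A * exp 4"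
      by (simp add: exp_add exp_minus)
    finally have "exp (s + 4) * (moser_const * mu L) \<le> moser_const * A * exp 4" .
    moreover have "A * (1 + moser_const * exp (E powr (1 + q)) + moser_const * exp 4)
      = A + (exp (E powr (1 + q)) * (moser_const * A) + moser_const * A * exp 4)" by (simp add: algebra_simps)
    ultimately show "A + (exp (E powr (1 + q)) * (moser_const * mu 0) + exp (s + 4) * (moser_const * mu L))
      \<le> A * (1 + moser_const * exp (E powr (1 + q)) + moser_const * exp 4)"
      using le0 by linarith
  qed
  finally show ?thesis .
qed

text \<open>If \<open>\<sigma>\<close> is large enough relative to \<open>L\<close>, the shift by
  \<open>L\<close> costs only the fixed amount \<open>W\<close>, and Moser's inequality above
  \<open>L\<close> suffices; the cost need not be compensated by a small
  \<open>mu L\<close>.\<close>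

lemma integral_exp_small:
  assumes L: "0 < L" and \<sigma>: "0 < \<sigma>" "\<sigma> < 1" "tail L \<le> 1 - \<sigma>" and W: "lam * L powr (1 + q) / \<sigma> powr q \<le> W"
  shows "(\<integral>\<^sup>+x. ennreal (exp (lam * v x powr (1 + q))) \<partial>M)
    \<le> ennreal (exp W * (1 + moser_const) * measure M (space M))"
proof -
  let ?iL = "\<lambda>x. ennreal (exp (lam * (v x - L) powr (1 + q) / (1 - \<sigma>) powr q)) * indicator {x. L < v x} x"
  have hi: "lam * v x powr (1 + q) \<le> W + lam * (v x - L) powr (1 + q) / (1 - \<sigma>) powr q" if "L < v x" for x
  proof -
    have "lam * v x powr (1 + q) = lam * ((v x - L) + L) powr (1 + q)" by simp
    also have "\<dots> \<le> lam * ((v x - L) powr (1 + q) / (1 - \<sigma>) powr q + L powr (1 + q) / \<sigma> powr q)"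
      using that L \<sigma> q_pos lam_pos by (intro mult_left_mono powr_add_split) auto
    finally show ?thesis using W by (simp add: distrib_left)
  qed
  have lo: "lam * v x powr (1 + q) \<le> W" if "v x \<le> L" for x
  proof -
    have "lam * v x powr (1 + q) \<le> lam * L powr (1 + q)"
      using that lam_pos v_nonneg q_pos by (intro mult_left_mono powr_mono2) auto
    also have "\<dots> \<le> lam * L powr (1 + q) / \<sigma> powr q"
    proof -
      have "\<sigma> powr q \<le> 1" using \<sigma> q_pos by (intro powr_le1) auto
      then show ?thesis using lam_pos \<sigma> by (simp add: le_divide_eq mult_left_le)
    qed
    finally show ?thesis using W by linarith
  qed
  have "(\<integral>\<^sup>+x. ennreal (exp (lam * v x powr (1 + q))) \<partial>M) \<le> (\<integral>\<^sup>+x. ennreal (exp W) + ennreal (exp W) * ?iL x \<partial>M)"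
  proof (rule nn_integral_mono)
    fix x
    show "ennreal (exp (lam * v x powr (1 + q))) \<le> ennreal (exp W) + ennreal (exp W) * ?iL x"
    proof (cases "L < v x")
      case True
      have "ennreal (exp (lam * v x powr (1 + q))) \<le> ennreal (exp W * exp (lam * (v x - L) powr (1 + q) / (1 - \<sigma>) powr q))"
        unfolding exp_add[symmetric] using hi[OF True] by (intro ennreal_leI) simp
      also have "\<dots> = ennreal (exp W) * ?iL x" using True by (simp add: ennreal_mult)
      finally show ?thesis by (simp add: add_increasing)
    next
      case False
      then have "ennreal (exp (lam * v x powr (1 + q))) \<le> ennreal (exp W)" using lo[of x] by (intro ennreal_leI) simp
      then show ?thesis by (simp add: add_increasing2)
    qed
  qed
  also have "\<dots> = ennreal (exp W) * ennreal (measure M (space M)) + ennreal (exp W) * (\<integral>\<^sup>+x. ?iL x \<partial>M)"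
    by (simp add: nn_integral_add nn_integral_cmult emeasure_eq_measure)
  also have "\<dots> \<le> ennreal (exp W) * ennreal (measure M (space M)) + ennreal (exp W) * ennreal (moser_const * mu L)"
    using moser[of L "1 - \<sigma>"] L \<sigma> by (intro add_mono mult_left_mono) auto
  also have "\<dots> = ennreal (exp W * measure M (space M) + exp W * (moser_const * mu L))"
    using moser_const_pos mu_nonneg by (simp add: ennreal_mult[symmetric] ennreal_plus[symmetric] del: ennreal_plus)
  also have "\<dots> \<le> ennreal (exp W * (1 + moser_const) * measure M (space M))"
  proof (rule ennreal_leI)
    have "exp W * (moser_const * mu L) \<le> exp W * (moser_const * measure M (space M))"
      using moser_const_pos mu_le_space[of L] by (intro mult_left_mono) auto
    then show "exp W * measure M (space M) + exp W * (moser_const * mu L) \<le> exp W * (1 + moser_const) * measure M (space M)"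
      by (simp add: algebra_simps)
  qed
  finally show ?thesis .
qed

end


section \<open>The uniform constant and the two regimes of the chosen level\<close>

lemma eventually_powr_exp_small:
  fixes a b c \<epsilon> :: real
  assumes "0 < b" "0 < \<epsilon>"
  shows "\<exists>S\<ge>1. \<forall>s\<ge>S. c * s powr a * exp (- b * s) \<le> \<epsilon>"
proof -
  have "((\<lambda>s. c * s powr a * exp (- b * s)) \<longlongrightarrow> 0) at_top" using assms(1) by real_asymp
  then have "eventually (\<lambda>s. c * s powr a * exp (- b * s) < \<epsilon>) at_top" using assms(2) by (rule order_tendstoD(2))
  then obtain S where "\<And>s. s \<ge> S \<Longrightarrow> c * s powr a * exp (- b * s) < \<epsilon>" unfolding eventually_at_top_linorder by blast
  then show ?thesis by (intro exI[of _ "max 1 S"]) (auto intro: less_imp_le)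
qed

text \<open>\<open>C\<close> is fixed before \<open>v\<close>, \<open>f\<close> and \<open>V\<close>
  are given, so all constants are chosen from the data in advance; \<open>V\<close> supplies only
  finiteness. The last hypothesis is the coercivity of truncations, which in the application comes
  from the definition of \<gamma>_1. The regimes \<open>s \<ge> S\<close> and \<open>s < S\<close>
  distinguish whether the nearly maximal level set is a small part of the space.\<close>

theorem level_inequality_exp_bound:
  fixes M :: "'a measure" and lam q p \<gamma> g E :: real
  assumes q: "0 < q" "q \<le> 1" and lam: "0 < lam" and p: "0 < p" and \<gamma>: "0 \<le> \<gamma>" "\<gamma> < g" and M: "finite_measure M"
  obtains C :: real where "\<And>v f V. level_inequality M v f lam q \<Longrightarrow> (\<And>x. v x \<le> V) \<Longrightarrow>
    (\<integral>x. f x \<partial>M) \<le> 1 + \<gamma> * (\<integral>x. v x powr p \<partial>M) powr ((1 + 1 / q) / p) \<Longrightarrow> (\<integral>x. f x \<partial>M) \<le> E \<Longrightarrow>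
    (\<And>L. 0 < L \<Longrightarrow> g * (\<integral>x. min (v x) (L / 2) powr p \<partial>M) powr ((1 + 1 / q) / p)
        \<le> (\<integral>x. f x * indicator {x. v x \<le> L} x \<partial>M)) \<Longrightarrow>
    (\<integral>\<^sup>+x. ennreal (exp (lam * v x powr (1 + q))) \<partial>M) \<le> ennreal C"
proof -
  define A where "A = measure M (space M)"
  define C0 where "C0 = level_energy.half_const"
  define Cm where "Cm = level_inequality.moser_const q"
  \<comment> \<open>The dimension N in the application.\<close>
  define r where "r = 1 + 1 / q"
  have r: "r > 0" "r * q = 1 + q" unfolding r_def using q by (auto simp: field_simps intro: add_pos_pos)
  have A0: "0 \<le> A" unfolding A_def by simp
  \<comment> \<open>The integral \<open>X\<close> of \<open>v powr p\<close> will be at most a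
    multiple of \<open>L powr p * exp (- s / 2)\<close>, so \<open>X powr (r / p)\<close> decays
    like \<open>exp (- \<beta> * s)\<close>.\<close>
  define \<beta> where "\<beta> = r / (2 * p)"
  have \<beta>: "0 < \<beta>" unfolding \<beta>_def using r p by simp
  \<comment> \<open>The coefficient in the estimate of \<open>\<gamma> * X powr (r / p)\<close> by
    the energy below \<open>L\<close>; the added 1 keeps \<open>\<eta>\<close> positive when
    \<open>\<gamma> = 0\<close>.\<close>
  define c1 where "c1 = \<gamma> * (2 * C0 * A) powr (r / p) * lam powr - (1 / q) + 1"
  obtain S where S: "S \<ge> 1" "\<And>s. s \<ge> S \<Longrightarrow> c1 * s powr (1 / q + 1) * exp (- \<beta> * s) \<le> 1 / 4"
    using eventually_powr_exp_small[OF \<beta>, of "1 / 4" c1 "1 / q + 1"] by auto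
  define \<delta> where "\<delta> = (g - \<gamma>) / 4"
  have \<delta>: "0 < \<delta>" unfolding \<delta>_def using \<gamma> by simp
  \<comment> \<open>At most the fraction \<open>4 * C0 * K powr - p\<close> of the integral of
    \<open>v powr p\<close> will sit above \<open>K * L\<close>. \<open>K\<close> is taken so large
    that the rest, weighted by \<open>g\<close>, still beats \<open>\<gamma>\<close> by
    \<open>2 * \<delta>\<close>, half of the gap.\<close>
  have Kt: "((\<lambda>K. 1 - 4 * C0 * K powr - p) \<longlongrightarrow> 1) at_top" using p by real_asymp
  have Klim: "((\<lambda>K. g * (1 - 4 * C0 * K powr - p) powr (r / p)) \<longlongrightarrow> g * 1 powr (r / p)) at_top"
    by (intro tendsto_mult tendsto_const tendsto_powr Kt) simp
  have Kpos: "eventually (\<lambda>K. 0 < 1 - 4 * C0 * K powr - p) at_top"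
    by (rule order_tendstoD(1)[OF Kt]) simp
  have "4 * \<delta> = g - \<gamma>" unfolding \<delta>_def by simp
  then have "g * 1 powr (r / p) > \<gamma> + 2 * \<delta>" using \<delta> by simp
  with Klim have "eventually (\<lambda>K. g * (1 - 4 * C0 * K powr - p) powr (r / p) > \<gamma> + 2 * \<delta>) at_top"
    by (rule order_tendstoD)
  then have "eventually (\<lambda>K. g * (1 - 4 * C0 * K powr - p) powr (r / p) > \<gamma> + 2 * \<delta> \<and> 0 < 1 - 4 * C0 * K powr - p \<and> K \<ge> 1) at_top"
    using Kpos eventually_ge_at_top[of 1] by eventually_elim auto
  then obtain K where K: "K \<ge> 1" "0 < 1 - 4 * C0 * K powr - p" "g * (1 - 4 * C0 * K powr - p) powr (r / p) > \<gamma> + 2 * \<delta>"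
    by (metis (mono_tags, lifting) eventually_at_top_linorder order_refl)
  \<comment> \<open>The bound for \<open>lam * L2 powr (1 + q) / \<sigma> powr q\<close>:
    \<open>\<sigma>\<close> is at least a multiple of \<open>L powr r\<close>, and as
    \<open>r * q = 1 + q\<close> the powers of \<open>L\<close> cancel.\<close>
  define W where "W = lam * (2 * K) powr (1 + q) / (\<delta> powr q * (A * exp (- S)) powr ((1 + q) / p))"
  define C where "C = max A (max (A * (1 + Cm * exp (E powr (1 + q)) + Cm * exp 4)) (exp W * (1 + Cm) * A))"
  show ?thesis
  proof (rule that[of C])
    fix v f :: "'a \<Rightarrow> real" and V :: real
    assume li: "level_inequality M v f lam q" and V: "\<And>x. v x \<le> V"
      and f1: "(\<integral>x. f x \<partial>M) \<le> 1 + \<gamma> * (\<integral>x. v x powr p \<partial>M) powr ((1 + 1 / q) / p)"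
      and fE: "(\<integral>x. f x \<partial>M) \<le> E"
      and coer: "\<And>L. 0 < L \<Longrightarrow> g * (\<integral>x. min (v x) (L / 2) powr p \<partial>M) powr ((1 + 1 / q) / p)
        \<le> (\<integral>x. f x * indicator {x. v x \<le> L} x \<partial>M)"
    interpret level_inequality M v f lam q by (rule li)
    have C0: "C0 = half_const" "0 < C0" and Cm: "Cm = moser_const" unfolding C0_def Cm_def using half_const_pos by auto
    show "(\<integral>\<^sup>+x. ennreal (exp (lam * v x powr (1 + q))) \<partial>M) \<le> ennreal C"
    proof (cases "\<exists>t>0. 0 < nu t")
      case False
      have "AE x in M. ennreal (exp (lam * v x powr (1 + q))) = 1"
        using AE_nu_pos by eventually_elim (use False v_nonneg q in \<open>auto simp: less_le\<close>)
      then have "(\<integral>\<^sup>+x. ennreal (exp (lam * v x powr (1 + q))) \<partial>M) = (\<integral>\<^sup>+x. 1 \<partial>M)" by (rule nn_integral_cong_AE)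
      also have "\<dots> \<le> ennreal C" unfolding C_def A_def by (simp add: emeasure_eq_measure ennreal_leI)
      finally show ?thesis .
    next
      case True
      then obtain t where "0 < t" "0 < nu t" by blast
      then obtain L where L: "0 < L" "0 < nu L"
        and Lmax: "\<And>t. 0 < t \<Longrightarrow> t powr p * nu t powr (1 / 2) \<le> 2 * (L powr p * nu L powr (1 / 2))"
        using near_maximal_level[OF V p] by metis
      define X where "X = (\<integral>x. v x powr p \<partial>M)"
      define s where "s = ln (A / nu L)"
      define D where "D = 2 * (L powr p * nu L powr (1 / 2))"
      have D: "0 \<le> D" unfolding D_def by simp
      have A: "nu L \<le> A" "mu 0 \<le> A" "0 < A" unfolding A_def using nu_le_space[of L] mu_le_space[of 0] L by auto
      have nuL: "nu L = A * exp (- s)" unfolding s_def using A L by (simp add: exp_minus)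
      have vint: "integrable M (\<lambda>x. v x powr p * indicator {x. P x} x)" if "Measurable.pred M P" for P
        using integrable_powr_bounded[OF V, of p P] p that by simp
      have vint1: "integrable M (\<lambda>x. v x powr p)" using vint[of "\<lambda>x. True"] by simp
      have X0: "X = (\<integral>x. v x powr p * indicator {x. 0 < v x} x \<partial>M)"
        unfolding X_def by (intro Bochner_Integration.integral_cong refl) (use v_nonneg in \<open>auto split: split_indicator simp: less_le\<close>)
      have "X \<le> D * half_const * mu 0 powr (1 / 2)"
        unfolding X0 by (rule integral_powr_tail_le[OF V p _ D]) (use Lmax in \<open>auto simp: D_def\<close>)
      also have "\<dots> \<le> D * half_const * A powr (1 / 2)"
        using D half_const_pos A mu_nonneg by (intro mult_left_mono powr_mono2) auto
      also have "\<dots> = 2 * C0 * A * L powr p * exp (- s / 2)"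
      proof -
        have "nu L powr (1 / 2) * A powr (1 / 2) = A * exp (- s / 2)"
          unfolding nuL using A by (simp add: powr_mult exp_powr_real powr_half_sqrt)
        then show ?thesis unfolding D_def C0(1) by (simp add: algebra_simps)
      qed
      finally have Xup: "X \<le> 2 * C0 * A * L powr p * exp (- s / 2)" .
      have "L powr p * nu L = (\<integral>x. L powr p * indicator {x \<in> space M. L \<le> v x} x \<partial>M)" unfolding nu_def by simp
      also have "\<dots> \<le> X" unfolding X_def
        by (intro integral_mono vint1 Bochner_Integration.integrable_mult_right)
          (use L p in \<open>auto split: split_indicator intro!: powr_mono2 simp: emeasure_eq_measure\<close>)
      finally have Xlo: "L powr p * nu L \<le> X" .
      have Xpos: "0 < X" using Xlo L by (smt (verit) mult_pos_pos powr_gt_zero)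
      have rp: "(1 + 1 / q) / p = r / p" unfolding r_def ..
      show ?thesis
      proof (cases "s \<ge> S")
        case True
        define e0 where "e0 = en 0 L"
        define \<eta> where "\<eta> = c1 * s powr (1 / q) * exp (- \<beta> * s)"
        have c1: "1 \<le> c1" unfolding c1_def using \<gamma> by simp
        have s: "1 \<le> s" using S True by simp
        have \<eta>: "0 < \<eta>" unfolding \<eta>_def using c1 s by simp
        have "\<eta> * s = c1 * s powr (1 / q + 1) * exp (- \<beta> * s)" unfolding \<eta>_def using s by (simp add: powr_add)
        then have \<eta>s: "\<eta> * s \<le> 1 / 4" using S(2)[OF True] by simp
        moreover have "\<eta> * 1 \<le> \<eta> * s" using \<eta> s by (intro mult_left_mono) auto
        ultimately have \<eta>4: "\<eta> \<le> 1 / 4" by linarith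
        have "lam * L powr (1 + q) \<le> e0 powr q * ln (mu 0 / nu L)"
          using level_ineq[of 0 L] L unfolding e0_def by simp
        also have "\<dots> \<le> e0 powr q * s"
          unfolding s_def using A L nu_le_mu[of 0 L] by (intro mult_left_mono) (auto simp: divide_right_mono)
        \<comment> \<open>Raised to the power \<open>1 / q\<close>, the level inequality bounds
          \<open>L powr r\<close> by the energy below \<open>L\<close> times a power of
          \<open>s\<close>. This makes the Lebesgue term small relative to that energy, not merely
          small.\<close>
        finally have "(lam * L powr (1 + q)) powr (1 / q) \<le> (e0 powr q * s) powr (1 / q)"
          using q lam by (intro powr_mono2) auto
        moreover have "(lam * L powr (1 + q)) powr (1 / q) = lam powr (1 / q) * L powr r"
          using lam L q by (simp add: powr_mult powr_powr r_def add_divide_distrib add.commute)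
        moreover have "(e0 powr q * s) powr (1 / q) = e0 * s powr (1 / q)"
          using s q en_nonneg[of 0 L] unfolding e0_def by (simp add: powr_mult powr_powr)
        ultimately have "lam powr (1 / q) * L powr r \<le> e0 * s powr (1 / q)" by simp
        then have Lr: "L powr r \<le> lam powr - (1 / q) * (e0 * s powr (1 / q))"
          using lam by (simp add: powr_minus field_simps)
        have "\<gamma> * X powr (r / p) \<le> \<gamma> * (2 * C0 * A * L powr p * exp (- s / 2)) powr (r / p)"
          using Xup Xpos \<gamma> r p by (intro mult_left_mono powr_mono2) auto
        also have "\<dots> = \<gamma> * (2 * C0 * A) powr (r / p) * exp (- \<beta> * s) * L powr r"
          using C0 A L p by (simp add: powr_mult powr_powr exp_powr_real \<beta>_def field_simps)
        also have "\<dots> \<le> \<gamma> * (2 * C0 * A) powr (r / p) * exp (- \<beta> * s) * (lam powr - (1 / q) * (e0 * s powr (1 / q)))"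
          using Lr \<gamma> by (intro mult_left_mono) auto
        also have "\<dots> = (c1 - 1) * s powr (1 / q) * exp (- \<beta> * s) * e0" unfolding c1_def by simp
        also have "\<dots> \<le> \<eta> * e0"
          unfolding \<eta>_def using en_nonneg[of 0 L] by (intro mult_right_mono) (auto simp: e0_def)
        finally have "(\<integral>x. f x \<partial>M) \<le> 1 + \<eta> * en 0 L" using f1 unfolding X_def rp e0_def by linarith
        then have "(\<integral>\<^sup>+x. ennreal (exp (lam * v x powr (1 + q))) \<partial>M)
          \<le> ennreal (A * (1 + moser_const * exp (E powr (1 + q)) + moser_const * exp 4))"
          unfolding A_def by (intro integral_exp_large[OF L \<eta> \<eta>4 _ _ fE]) (use \<eta>s in \<open>auto simp: s_def A_def\<close>)
        also have "\<dots> \<le> ennreal C" unfolding C_def Cm by (intro ennreal_leI) simp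
        finally show ?thesis .
      next
        case False
        have KL: "0 < K * L" using K L by simp
        have Kp: "0 < K powr p" using K by simp
        \<comment> \<open>Near-maximality of \<open>L\<close>, used at the level
          \<open>K * L\<close>, gains the factor \<open>K powr - p\<close>; this is why a fixed
          multiple of \<open>L\<close> captures almost the whole integral.\<close>
        have "(K * L) powr p * nu (K * L) powr (1 / 2) \<le> 2 * (L powr p * nu L powr (1 / 2))" using Lmax[OF KL] .
        then have "L powr p * (K powr p * nu (K * L) powr (1 / 2)) \<le> L powr p * (2 * nu L powr (1 / 2))"
          using K L by (simp add: powr_mult algebra_simps)
        then have "K powr p * nu (K * L) powr (1 / 2) \<le> 2 * nu L powr (1 / 2)" using L by simp
        then have nuK: "nu (K * L) powr (1 / 2) \<le> 2 * K powr - p * nu L powr (1 / 2)"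
          using Kp by (simp add: powr_minus field_simps)
        have "(\<integral>x. v x powr p * indicator {x. K * L < v x} x \<partial>M) \<le> D * half_const * mu (K * L) powr (1 / 2)"
          by (rule integral_powr_tail_le[OF V p _ D]) (use Lmax KL in \<open>auto simp: D_def\<close>)
        also have "\<dots> \<le> D * half_const * (2 * K powr - p * nu L powr (1 / 2))"
          using D half_const_pos nuK mu_nonneg mu_le_nu
          by (intro mult_left_mono order_trans[OF powr_mono2 nuK]) auto
        also have "\<dots> = 4 * C0 * K powr - p * (L powr p * (nu L powr (1 / 2) * nu L powr (1 / 2)))"
          unfolding D_def C0(1) by simp
        also have "nu L powr (1 / 2) * nu L powr (1 / 2) = nu L" using L by (simp add: powr_half_sqrt)
        also have "4 * C0 * K powr - p * (L powr p * nu L) \<le> 4 * C0 * K powr - p * X"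
          using Xlo C0 by (intro mult_left_mono) auto
        finally have up: "(\<integral>x. v x powr p * indicator {x. K * L < v x} x \<partial>M) \<le> 4 * C0 * K powr - p * X" .
        have "X = (\<integral>x. v x powr p * indicator {x. v x \<le> K * L} x + v x powr p * indicator {x. K * L < v x} x \<partial>M)"
          unfolding X_def by (intro Bochner_Integration.integral_cong refl) (auto split: split_indicator)
        also have "\<dots> = (\<integral>x. v x powr p * indicator {x. v x \<le> K * L} x \<partial>M) + (\<integral>x. v x powr p * indicator {x. K * L < v x} x \<partial>M)"
          by (intro Bochner_Integration.integral_add vint) measurable
        finally have "(1 - 4 * C0 * K powr - p) * X \<le> (\<integral>x. v x powr p * indicator {x. v x \<le> K * L} x \<partial>M)"
          using up by (simp add: algebra_simps)
        also have "\<dots> \<le> (\<integral>x. min (v x) (K * L) powr p \<partial>M)"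
        proof (rule integral_mono)
          show "integrable M (\<lambda>x. min (v x) (K * L) powr p)"
            by (rule integrable_const_bound[where B = "(K * L) powr p"])
               (use KL p v_nonneg in \<open>auto intro!: AE_I2 powr_mono2\<close>)
        qed (use KL v_nonneg in \<open>auto intro!: vint split: split_indicator simp: min_def\<close>)
        finally have lo: "(1 - 4 * C0 * K powr - p) * X \<le> (\<integral>x. min (v x) (K * L) powr p \<partial>M)" .
        \<comment> \<open>Coercivity compares the truncation at \<open>L2 / 2\<close> with the
          energy up to \<open>L2\<close>, hence the doubling.\<close>
        define L2 where "L2 = 2 * (K * L)"
        define \<sigma> where "\<sigma> = \<delta> * X powr (r / p)"
        have L2: "0 < L2" "L2 / 2 = K * L" unfolding L2_def using KL by auto
        have "(\<gamma> + 2 * \<delta>) * X powr (r / p) \<le> g * (1 - 4 * C0 * K powr - p) powr (r / p) * X powr (r / p)"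
          using K by (intro mult_right_mono) auto
        also have "\<dots> = g * ((1 - 4 * C0 * K powr - p) * X) powr (r / p)"
          using K Xpos by (simp add: powr_mult)
        also have "\<dots> \<le> g * (\<integral>x. min (v x) (K * L) powr p \<partial>M) powr (r / p)"
          using lo K Xpos r p \<gamma> by (intro mult_left_mono powr_mono2) auto
        also have "\<dots> \<le> (\<integral>x. f x * indicator {x. v x \<le> L2} x \<partial>M)"
          using coer[OF L2(1)] unfolding L2(2) rp .
        \<comment> \<open>The energy up to \<open>L2\<close> exceeds the Lebesgue term by
          \<open>2 * \<sigma>\<close>. One \<open>\<sigma>\<close> is given up afterwards so that
          \<open>\<sigma> < 1\<close> is strict.\<close>
        finally have "tail L2 \<le> 1 - 2 * \<sigma>"
          using integral_low_add_tail[of L2] f1 unfolding rp X_def[symmetric] \<sigma>_def by (simp add: algebra_simps)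
        then have \<sigma>: "0 < \<sigma>" "\<sigma> < 1" "tail L2 \<le> 1 - \<sigma>"
        proof -
          assume t: "tail L2 \<le> 1 - 2 * \<sigma>"
          show "0 < \<sigma>" unfolding \<sigma>_def using \<delta> Xpos by simp
          then show "\<sigma> < 1" "tail L2 \<le> 1 - \<sigma>" using t tail_nonneg[of L2] by linarith+
        qed
        \<comment> \<open>In this regime the level set is not small, so \<open>X\<close>, and with
          it \<open>\<sigma>\<close>, is bounded below in terms of \<open>L\<close>.\<close>
        have "A * exp (- S) \<le> nu L" unfolding nuL using False A by simp
        then have "L powr p * (A * exp (- S)) \<le> X" using Xlo by (smt (verit) mult_left_mono powr_ge_zero)
        then have "(L powr p * (A * exp (- S))) powr (r / p) \<le> X powr (r / p)"
          using A r p by (intro powr_mono2) auto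
        then have "\<delta> * (L powr r * (A * exp (- S)) powr (r / p)) \<le> \<sigma>"
          unfolding \<sigma>_def using \<delta> L A p by (simp add: powr_mult powr_powr)
        then have "(\<delta> * (L powr r * (A * exp (- S)) powr (r / p))) powr q \<le> \<sigma> powr q"
          using q \<delta> by (intro powr_mono2) auto
        then have \<sigma>q: "\<delta> powr q * L powr (1 + q) * (A * exp (- S)) powr ((1 + q) / p) \<le> \<sigma> powr q"
          using \<delta> L A q r(2) by (simp add: powr_mult powr_powr mult.assoc)
        have pos: "0 < \<delta> powr q * L powr (1 + q) * (A * exp (- S)) powr ((1 + q) / p)" using \<delta> L A by simp
        have "lam * L2 powr (1 + q) / \<sigma> powr q \<le> lam * L2 powr (1 + q) / (\<delta> powr q * L powr (1 + q) * (A * exp (- S)) powr ((1 + q) / p))"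
          using \<sigma>q pos lam \<sigma>(1) by (intro divide_left_mono mult_pos_pos[of "\<sigma> powr q"]) auto
        also have "\<dots> = W"
        proof -
          have "L2 powr (1 + q) = (2 * K) powr (1 + q) * L powr (1 + q)"
            unfolding L2_def using K L by (simp add: powr_mult mult.assoc[symmetric])
          then show ?thesis unfolding W_def using L by simp
        qed
        finally have "(\<integral>\<^sup>+x. ennreal (exp (lam * v x powr (1 + q))) \<partial>M) \<le> ennreal (exp W * (1 + moser_const) * A)"
          unfolding A_def by (intro integral_exp_small[OF L2(1) \<sigma>])
        also have "\<dots> \<le> ennreal C" unfolding C_def Cm by (intro ennreal_leI) simp
        finally show ?thesis .
      qed
    qed
  qed
qed

subsection \<open>The level-set isoperimetric inequality\<close>

lemma uniformly_continuous_compact_support: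
  fixes D :: "'a::euclidean_space \<Rightarrow> 'b::real_normed_vector"
  assumes c: "continuous_on UNIV D" and K: "bounded K" "\<And>x. x \<notin> K \<Longrightarrow> D x = 0"
  shows "uniformly_continuous_on UNIV D"
  unfolding uniformly_continuous_on_def
proof (intro allI impI)
  fix e :: real assume e: "e > 0"
  obtain r where r: "\<And>x. x \<in> K \<Longrightarrow> norm x \<le> r" using K(1) unfolding bounded_iff by blast
  have "uniformly_continuous_on (cball 0 (r + 1)) D"
    by (rule compact_uniformly_continuous) (use c in \<open>auto intro: continuous_on_subset\<close>)
  then obtain d where d: "d > 0" "\<And>x y. x \<in> cball 0 (r + 1) \<Longrightarrow> y \<in> cball 0 (r + 1) \<Longrightarrow> dist y x < d \<Longrightarrow> dist (D y) (D x) < e"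
    using e unfolding uniformly_continuous_on_def by metis
  have "dist (D y) (D x) < e" if "dist y x < min d 1" for x y
  proof (cases "x \<in> cball 0 (r + 1) \<and> y \<in> cball 0 (r + 1)")
    case True
    then show ?thesis using d(2)[of x y] that by auto
  next
    case False
    have "norm x \<le> norm y + dist y x" "norm y \<le> norm x + dist y x"
      using norm_triangle_sub[of x y] norm_triangle_sub[of y x] by (auto simp: dist_norm norm_minus_commute)
    then have "norm x > r" "norm y > r" using False that by auto
    then have "x \<notin> K" "y \<notin> K" using r by fastforce+
    then show ?thesis using K e by simp
  qed
  then show "\<exists>d>0. \<forall>x\<in>UNIV. \<forall>x'\<in>UNIV. dist x' x < d \<longrightarrow> dist (D x') (D x) < e"
    using d(1) by (intro exI[of _ "min d 1"]) auto
qed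

text \<open>Uniform continuity of \<open>D\<close> makes the error uniform in \<open>x\<close>, so
  that one \<open>\<epsilon>\<close> will serve a whole range of levels.\<close>

lemma uniform_linearization:
  fixes \<phi> :: "'a::euclidean_space \<Rightarrow> real" and D :: "'a \<Rightarrow> 'a"
  assumes der: "\<And>x. (\<phi> has_derivative (\<lambda>h. D x \<bullet> h)) (at x)"
    and c: "continuous_on UNIV D" and K: "bounded K" "\<And>x. x \<notin> K \<Longrightarrow> D x = 0" and \<omega>: "0 < \<omega>"
  obtains d where "0 < d" "\<And>x h. norm h \<le> d \<Longrightarrow> \<bar>\<phi> (x + h) - \<phi> x - D x \<bullet> h\<bar> \<le> \<omega> * norm h"
proof -
  obtain d where d: "d > 0" "\<And>x y. dist y x < d \<Longrightarrow> dist (D y) (D x) < \<omega>"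
    using uniformly_continuous_compact_support[OF c K] \<omega> unfolding uniformly_continuous_on_def by (metis UNIV_I)
  have "\<bar>\<phi> (x + h) - \<phi> x - D x \<bullet> h\<bar> \<le> \<omega> * norm h" if h: "norm h \<le> d / 2" for x h
  proof -
    have "norm (\<phi> (x + h) - \<phi> x - D x \<bullet> (x + h - x)) \<le> norm (x + h - x) * \<omega>"
    proof (rule differentiable_bound_linearization[of x "x + h" "cball x (d / 2)" \<phi> "\<lambda>y h. D y \<bullet> h" x \<omega>])
      show "x + t *\<^sub>R (x + h - x) \<in> cball x (d / 2)" if "t \<in> {0..1}" for t
      proof -
        have "\<bar>t\<bar> * norm h \<le> 1 * norm h" using that by (intro mult_right_mono) auto
        then show ?thesis using h by (simp add: dist_norm)
      qed
      show "(\<phi> has_derivative (\<lambda>h. D y \<bullet> h)) (at y within cball x (d / 2))" for y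
        using der[of y] has_derivative_at_withinI by blast
      show "onorm ((\<lambda>h. D y \<bullet> h) - (\<lambda>h. D x \<bullet> h)) \<le> \<omega>" if "y \<in> cball x (d / 2)" for y
      proof (rule onorm_bound)
        fix h :: 'a
        have "dist y x < d" using that d(1) by (simp add: dist_commute)
        then have n: "norm (D y - D x) < \<omega>" using d(2) by (metis dist_norm)
        have "norm (((\<lambda>h. D y \<bullet> h) - (\<lambda>h. D x \<bullet> h)) h) = \<bar>(D y - D x) \<bullet> h\<bar>" by (simp add: inner_diff_left)
        also have "\<dots> \<le> norm (D y - D x) * norm h" by (rule Cauchy_Schwarz_ineq2)
        also have "\<dots> \<le> \<omega> * norm h" using n by (intro mult_right_mono) auto
        finally show "norm (((\<lambda>h. D y \<bullet> h) - (\<lambda>h. D x \<bullet> h)) h) \<le> \<omega> * norm h" .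
      qed (use \<omega> in auto)
    qed (use d in auto)
    then show ?thesis by (simp add: mult.commute)
  qed
  then show ?thesis using d(1) by (intro that[of "d / 2"]) auto
qed

lemma power_add_ge:
  fixes x h :: real assumes "0 \<le> x" "0 \<le> h"
  shows "x ^ n + real n * x ^ (n - 1) * h \<le> (x + h) ^ n"
proof (cases "x = 0")
  case True
  then show ?thesis using assms by (cases n) (auto simp: power_0_left)
next
  case False
  then have x: "0 < x" using assms by simp
  have "0 \<le> h / x" using x assms by simp
  then have "1 + real n * (h / x) \<le> (1 + h / x) ^ n" by (intro Bernoulli_inequality) linarith
  then have "x ^ n * (1 + real n * (h / x)) \<le> x ^ n * (1 + h / x) ^ n" using x by (intro mult_left_mono) auto
  also have "\<dots> = (x * (1 + h / x)) ^ n" by (simp only: power_mult_distrib)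
  also have "x * (1 + h / x) = x + h" using x by (simp add: field_simps)
  finally have "x ^ n * (1 + real n * (h / x)) \<le> (x + h) ^ n" .
  moreover have "x ^ n * (1 + real n * (h / x)) = x ^ n + real n * x ^ (n - 1) * h"
    using x by (cases n) (simp_all add: field_simps)
  ultimately show ?thesis by simp
qed

text \<open>The anisotropic perimeter enters only as the first-order term, in \<open>\<epsilon>\<close>, of the Brunn-Minkowski
  lower bound for \<open>A + \<epsilon> B\<close>.\<close>

lemma brunn_minkowski_first_order:
  fixes A B :: "'a::euclidean_space set"
  assumes A: "open A" "bounded A" "A \<noteq> {}" and B: "open B" "bounded B" "B \<noteq> {}" and \<epsilon>: "0 < \<epsilon>"
  defines "d \<equiv> real DIM('a)"
  shows "measure lebesgue A + \<epsilon> * (d * measure lebesgue B powr (1 / d)) * measure lebesgue A powr ((d - 1) / d)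
    \<le> measure lebesgue (minkowski_sum A ((\<lambda>x. \<epsilon> *\<^sub>R x) ` B))"
proof -
  have d: "0 < d" "1 \<le> d" unfolding d_def using DIM_positive[where 'a='a] by linarith+
  let ?m = "measure lebesgue :: 'a set \<Rightarrow> real"
  have eB: "?m ((\<lambda>x. \<epsilon> *\<^sub>R x) ` B) = \<epsilon> ^ DIM('a) * ?m B"
    using measure_lebesgue_affine[of \<epsilon> 0 B] \<epsilon> by simp
  let ?x = "?m A powr (1 / d)" and ?h = "\<epsilon> * ?m B powr (1 / d)"
  have "?m ((\<lambda>x. \<epsilon> *\<^sub>R x) ` B) powr (1 / d) = ?h"
    unfolding eB d_def using \<epsilon> by (simp add: powr_mult powr_realpow[symmetric] powr_powr)
  then have "(?x + ?h) powr d \<le> ?m (minkowski_sum A ((\<lambda>x. \<epsilon> *\<^sub>R x) ` B))"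
    using brunn_minkowski_open[OF A, of "(\<lambda>x. \<epsilon> *\<^sub>R x) ` B"] B \<epsilon>
    by (simp add: d_def open_scaling bounded_scaling)
  moreover have "(?x + ?h) powr d = (?x + ?h) ^ DIM('a)"
    unfolding d_def using \<epsilon> by (intro powr_realpow') (auto simp: add_nonneg_nonneg)
  moreover have "?x ^ DIM('a) + real DIM('a) * ?x ^ (DIM('a) - 1) * ?h \<le> (?x + ?h) ^ DIM('a)"
    using \<epsilon> by (intro power_add_ge) auto
  moreover have "?x ^ DIM('a) = ?m A"
    by (simp add: powr_realpow'[symmetric] powr_powr d_def)
  moreover have "?x ^ (DIM('a) - 1) = ?m A powr ((d - 1) / d)"
  proof (cases "DIM('a) = 1")
    case True
    \<comment> \<open>\<open>0 powr 0\<close> is 0 whereas \<open>0 ^ 0\<close> is 1, so in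
      dimension 1 the measure of \<open>A\<close> must be known to be positive.\<close>
    have "?m A \<noteq> 0" using A lmeasurable_open open_not_negligible negligible_iff_measure0 by metis
    then show ?thesis using True by (simp add: d_def)
  next
    case False
    then have "DIM('a) - 1 \<noteq> 0" using DIM_positive[where 'a='a] by linarith
    then have "?x ^ (DIM('a) - 1) = ?x powr real (DIM('a) - 1)" by (intro powr_realpow'[symmetric]) auto
    also have "real (DIM('a) - 1) = d - 1" unfolding d_def using DIM_positive[where 'a='a] by (simp add: of_nat_diff Suc_leI)
    finally show ?thesis by (simp add: powr_powr)
  qed
  ultimately show ?thesis unfolding d_def by (simp add: algebra_simps)
qed

section \<open>Integration over levels and the isoperimetric inequality for bands\<close>

lemma layer_cake_clamp:
  fixes h :: "'a::euclidean_space \<Rightarrow> real"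
  assumes h [measurable]: "h \<in> borel_measurable borel"
  shows "(\<integral>\<^sup>+t. emeasure lborel {x. t < h x} * indicator {a<..<b} t \<partial>lborel)
     = (\<integral>\<^sup>+x. ennreal (max 0 (min b (h x) - a)) \<partial>lborel)"
proof -
  have "(\<integral>\<^sup>+t. emeasure lborel {x. t < h x} * indicator {a<..<b} t \<partial>lborel)
     = (\<integral>\<^sup>+t. (\<integral>\<^sup>+x. indicator {z. a < fst z \<and> fst z < b \<and> fst z < h (snd z)} (t, x) \<partial>lborel) \<partial>lborel)"
  proof (rule nn_integral_cong)
    fix t :: real
    have m: "{x. t < h x} \<in> sets lborel" by measurable
    have "emeasure lborel {x. t < h x} * indicator {a<..<b} t = (\<integral>\<^sup>+x. indicator {x. t < h x} x * indicator {a<..<b} t \<partial>lborel)"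
      using m by (simp add: nn_integral_multc)
    also have "\<dots> = (\<integral>\<^sup>+x. indicator {z. a < fst z \<and> fst z < b \<and> fst z < h (snd z)} (t, x) \<partial>lborel)"
      by (intro nn_integral_cong) (auto split: split_indicator)
    finally show "emeasure lborel {x. t < h x} * indicator {a<..<b} t
      = (\<integral>\<^sup>+x. indicator {z. a < fst z \<and> fst z < b \<and> fst z < h (snd z)} (t, x) \<partial>lborel)" .
  qed
  also have "\<dots> = (\<integral>\<^sup>+x. (\<integral>\<^sup>+t. indicator {z. a < fst z \<and> fst z < b \<and> fst z < h (snd z)} (t, x) \<partial>lborel) \<partial>lborel)"
    by (rule lborel_pair.Fubini') measurable
  also have "\<dots> = (\<integral>\<^sup>+x. ennreal (max 0 (min b (h x) - a)) \<partial>lborel)"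
  proof (rule nn_integral_cong)
    fix x
    have "(\<integral>\<^sup>+t. indicator {z. a < fst z \<and> fst z < b \<and> fst z < h (snd z)} (t, x) \<partial>lborel)
      = (\<integral>\<^sup>+t. indicator {a<..<min b (h x)} t \<partial>lborel)"
      by (intro nn_integral_cong) (auto split: split_indicator)
    also have "\<dots> = ennreal (max 0 (min b (h x) - a))"
      by (cases "a \<le> min b (h x)") (auto simp: max_def)
    finally show "(\<integral>\<^sup>+t. indicator {z. a < fst z \<and> fst z < b \<and> fst z < h (snd z)} (t, x) \<partial>lborel)
      = ennreal (max 0 (min b (h x) - a))" .
  qed
  finally show ?thesis .
qed

text \<open>Used with \<open>W\<close> the interior of the Wulff shape and \<open>G\<close> the
  function F(\<nabla>\<phi>); \<open>dual\<close> is then the duality between \<open>F\<close> and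
  its polar.\<close>

locale compactly_supported_C1 =
  fixes \<phi> :: "'a::euclidean_space \<Rightarrow> real" and D :: "'a \<Rightarrow> 'a" and K :: "'a set" and W :: "'a set" and G :: "'a \<Rightarrow> real"
  assumes der: "\<And>x. (\<phi> has_derivative (\<lambda>h. D x \<bullet> h)) (at x)"
    and D_cont: "continuous_on UNIV D"
    and K: "bounded K" "\<And>x. x \<notin> K \<Longrightarrow> \<phi> x = 0" "\<And>x. x \<notin> K \<Longrightarrow> D x = 0" "\<And>x. x \<notin> K \<Longrightarrow> G x = 0"
    and W: "open W" "bounded W" "W \<noteq> {}"
    and G_cont: "continuous_on UNIV G"
    and G_nonneg: "\<And>x. 0 \<le> G x"
    and dual: "\<And>x y. y \<in> W \<Longrightarrow> \<bar>D x \<bullet> y\<bar> \<le> G x"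
begin

lemma phi_cont: "continuous_on UNIV \<phi>"
  using der by (meson continuous_at_imp_continuous_on has_derivative_continuous)

lemma phi_meas [measurable]: "\<phi> \<in> borel_measurable borel" and G_meas [measurable]: "G \<in> borel_measurable borel"
  using phi_cont G_cont by (auto intro: borel_measurable_continuous_onI)

lemma G_bounded: obtains C where "0 < C" "\<And>x. G x \<le> C"
proof -
  obtain r where r: "\<And>x. x \<in> K \<Longrightarrow> norm x \<le> r" using K(1) unfolding bounded_iff by blast
  have "compact (G ` cball 0 r)"
    by (intro compact_continuous_image) (use G_cont in \<open>auto intro: continuous_on_subset\<close>)
  then have "bounded (G ` cball 0 r)" by (rule compact_imp_bounded)
  then obtain B where B: "\<And>y. y \<in> G ` cball 0 r \<Longrightarrow> norm y \<le> B"
    unfolding bounded_iff by blast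
  have "G x \<le> \<bar>B\<bar> + 1" for x
  proof (cases "x \<in> K")
    case True
    then have "G x \<in> G ` cball 0 r" using r by auto
    then have "norm (G x) \<le> B" by (rule B)
    then show ?thesis by simp
  next
    case False
    then have "G x = 0" by (rule K(4))
    then show ?thesis by simp
  qed
  then show ?thesis by (intro that[of "\<bar>B\<bar> + 1"]) auto
qed

lemma superlevel:
  assumes "0 \<le> t"
  shows "open {x. t < \<bar>\<phi> x\<bar>}" "bounded {x. t < \<bar>\<phi> x\<bar>}" "{x. t < \<bar>\<phi> x\<bar>} \<in> lmeasurable"
proof -
  show o: "open {x. t < \<bar>\<phi> x\<bar>}"
    by (intro open_Collect_less continuous_intros phi_cont)
  have "{x. t < \<bar>\<phi> x\<bar>} \<subseteq> K" using K(2) assms by force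
  then show b: "bounded {x. t < \<bar>\<phi> x\<bar>}" using K(1) bounded_subset by blast
  show "{x. t < \<bar>\<phi> x\<bar>} \<in> lmeasurable" using o b by (rule lmeasurable_open[rotated])
qed

lemma band:
  assumes "0 \<le> a"
  shows "{x. a < \<bar>\<phi> x\<bar> \<and> \<bar>\<phi> x\<bar> < b} \<in> sets borel" "{x. a < \<bar>\<phi> x\<bar> \<and> \<bar>\<phi> x\<bar> < b} \<in> lmeasurable"
proof -
  show b: "{x. a < \<bar>\<phi> x\<bar> \<and> \<bar>\<phi> x\<bar> < b} \<in> sets borel" by measurable
  show "{x. a < \<bar>\<phi> x\<bar> \<and> \<bar>\<phi> x\<bar> < b} \<in> lmeasurable"
    by (rule fmeasurableI2[OF superlevel(3)[OF assms]]) (use b in auto)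
qed

lemma integrable_G_band: "0 \<le> a \<Longrightarrow> integrable lebesgue (\<lambda>x. indicator {x. a < \<bar>\<phi> x\<bar> \<and> \<bar>\<phi> x\<bar> < b} x *\<^sub>R G x)"
proof -
  assume a: "0 \<le> a"
  obtain C where C: "0 < C" "\<And>x. G x \<le> C" using G_bounded by blast
  have "G \<in> borel_measurable lebesgue" by (rule measurable_completion) simp
  then show ?thesis
    by (intro integrableI_bounded_set_indicator[where B = C])
       (use C G_nonneg band[OF a, of b] in \<open>auto intro!: AE_I2 simp: fmeasurable_def\<close>)
qed

text \<open>The constant of the Wulff isoperimetric inequality, N \<kappa>^(1/N).\<close>

definition iso_const :: real where
  "iso_const = real DIM('a) * measure lebesgue W powr (1 / DIM('a))"

text \<open>A substitute for the coarea formula. Enlarging a superlevel set by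
  \<open>\<epsilon>\<close> times \<open>W\<close> raises its measure by at least
  \<open>\<epsilon> * c\<close>, and the enlarged set lies in a superlevel set of |\<phi>| +
  \<epsilon> (G + \<omega>). Integrated over the levels between \<open>a'\<close> and
  \<open>b\<close>, the gain is at most the increase of the clamped function, which occurs only in
  the band.\<close>

lemma level_isoperimetric_approx:
  assumes a: "0 \<le> a" "a < a'" "a' < b" and \<omega>: "0 < \<omega>"
  defines "\<nu> \<equiv> measure lebesgue {x. b \<le> \<bar>\<phi> x\<bar>}"
  assumes \<nu>: "0 < \<nu>"
  shows "iso_const * (b - a') * \<nu> powr ((real DIM('a) - 1) / DIM('a))
    \<le> (LINT x:{x. a < \<bar>\<phi> x\<bar> \<and> \<bar>\<phi> x\<bar> < b}|lebesgue. G x) + \<omega> * measure lebesgue {x. a < \<bar>\<phi> x\<bar> \<and> \<bar>\<phi> x\<bar> < b}"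
proof -
  let ?d = "real DIM('a)"
  let ?m = "measure lebesgue :: 'a set \<Rightarrow> real"
  let ?S = "{x. a < \<bar>\<phi> x\<bar> \<and> \<bar>\<phi> x\<bar> < b}"
  define c where "c = iso_const * \<nu> powr ((?d - 1) / ?d)"
  have c: "0 \<le> c" unfolding c_def iso_const_def by simp
  obtain C where C: "0 < C" "\<And>x. G x \<le> C" using G_bounded by blast
  obtain R where R: "0 < R" "\<And>y. y \<in> W \<Longrightarrow> norm y \<le> R" using W(2) unfolding bounded_pos by blast
  have "0 < \<omega> / R" using \<omega> R by simp
  then obtain \<delta> where \<delta>: "0 < \<delta>" "\<And>x h. norm h \<le> \<delta> \<Longrightarrow> \<bar>\<phi> (x + h) - \<phi> x - D x \<bullet> h\<bar> \<le> \<omega> / R * norm h"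
    using uniform_linearization[OF der D_cont K(1) K(3)] by metis
  \<comment> \<open>The first bound keeps \<open>\<epsilon>\<close> times \<open>W\<close> within
    the radius of linearization. The second keeps the increment below \<open>a' - a\<close>, so that
    no point with |\<phi>| \<le> a reaches a level above \<open>a'\<close>; this is why the levels
    start at \<open>a'\<close>.\<close>
  define \<epsilon> where "\<epsilon> = min (\<delta> / R) ((a' - a) / (2 * (C + \<omega>)))"
  have \<epsilon>: "0 < \<epsilon>" unfolding \<epsilon>_def using \<delta> R C \<omega> a by simp
  have \<epsilon>1: "\<epsilon> * R \<le> \<delta>"
  proof -
    have "\<epsilon> \<le> \<delta> / R" unfolding \<epsilon>_def by simp
    then show ?thesis using R by (simp add: le_divide_eq)
  qed
  have \<epsilon>2: "\<epsilon> * (C + \<omega>) < a' - a"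
  proof -
    have "\<epsilon> \<le> (a' - a) / (2 * (C + \<omega>))" unfolding \<epsilon>_def by simp
    then have "\<epsilon> * (C + \<omega>) \<le> (a' - a) / (2 * (C + \<omega>)) * (C + \<omega>)" using C \<omega> by (intro mult_right_mono) auto
    also have "\<dots> = (a' - a) / 2" using C \<omega> by (simp add: field_simps)
    also have "\<dots> < a' - a" using a by simp
    finally show ?thesis .
  qed
  have \<epsilon>3: "\<epsilon> * \<omega> < a'"
  proof -
    have "\<epsilon> * \<omega> \<le> \<epsilon> * (C + \<omega>)" using \<epsilon> C by (intro mult_left_mono) auto
    also note \<epsilon>2
    also have "a' - a \<le> a'" using a by simp
    finally show ?thesis .
  qed
  define h0 where "h0 x = \<bar>\<phi> x\<bar>" for x
  define h1 where "h1 x = \<bar>\<phi> x\<bar> + \<epsilon> * (G x + \<omega>)" for x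
  have h_meas [measurable]: "h0 \<in> borel_measurable borel" "h1 \<in> borel_measurable borel"
    unfolding h0_def h1_def by measurable
  have step: "emeasure lborel {x. t < h0 x} + ennreal (\<epsilon> * c) \<le> emeasure lborel {x. t < h1 x}"
    if t: "a' < t" "t < b" for t
  proof -
    let ?A = "{x. t < \<bar>\<phi> x\<bar>}"
    have t0: "0 \<le> t" using t a by linarith
    have sup: "{x. b \<le> \<bar>\<phi> x\<bar>} \<subseteq> ?A" using t by auto
    have "{x. b \<le> \<bar>\<phi> x\<bar>} \<in> sets borel" by measurable
    then have "{x. b \<le> \<bar>\<phi> x\<bar>} \<in> sets lebesgue" by simp
    then have \<nu>A: "\<nu> \<le> ?m ?A" unfolding \<nu>_def using sup superlevel(3)[OF t0] by (intro measure_mono_fmeasurable)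
    then have neA: "?A \<noteq> {}" using \<nu> by (metis measure_empty not_less)
    have T: "{x. t < h1 x} \<in> lmeasurable"
    proof (rule lmeasurable_open)
      have "{x. t < h1 x} \<subseteq> K"
      proof
        fix x assume x: "x \<in> {x. t < h1 x}"
        show "x \<in> K"
        proof (rule ccontr)
          assume "x \<notin> K"
          then have "h1 x = \<epsilon> * \<omega>" unfolding h1_def using K by simp
          then show False using x \<epsilon>3 t by simp
        qed
      qed
      then show "bounded {x. t < h1 x}" using K(1) bounded_subset by blast
      show "open {x. t < h1 x}" unfolding h1_def
        by (intro open_Collect_less continuous_intros phi_cont G_cont)
    qed
    have incl: "minkowski_sum ?A ((\<lambda>x. \<epsilon> *\<^sub>R x) ` W) \<subseteq> {x. t < h1 x}"
    proof
      fix x assume "x \<in> minkowski_sum ?A ((\<lambda>x. \<epsilon> *\<^sub>R x) ` W)"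
      then obtain z y where zy: "x = z + \<epsilon> *\<^sub>R y" "t < \<bar>\<phi> z\<bar>" "y \<in> W" unfolding minkowski_sum_def by auto
      \<comment> \<open>The linearization is centred at the point \<open>x\<close> of the enlarged
        set, not at \<open>z\<close>, so that the gradient is taken where \<open>G\<close> is
        evaluated.\<close>
      define h where "h = - (\<epsilon> *\<^sub>R y)"
      have "norm h = \<epsilon> * norm y" unfolding h_def using \<epsilon> by simp
      also have "\<dots> \<le> \<epsilon> * R" using R(2)[OF zy(3)] \<epsilon> by (intro mult_left_mono) auto
      finally have nh: "norm h \<le> \<epsilon> * R" .
      have z: "z = x + h" unfolding h_def zy(1) by simp
      have "\<bar>\<phi> (x + h) - \<phi> x - D x \<bullet> h\<bar> \<le> \<omega> / R * norm h" using nh \<epsilon>1 by (intro \<delta>(2)) linarith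
      also have "\<dots> \<le> \<omega> / R * (\<epsilon> * R)" using nh \<omega> R by (intro mult_left_mono) auto
      also have "\<dots> = \<epsilon> * \<omega>" using R by simp
      finally have 1: "\<bar>\<phi> (x + h) - \<phi> x - D x \<bullet> h\<bar> \<le> \<epsilon> * \<omega>" .
      have "\<bar>D x \<bullet> h\<bar> = \<epsilon> * \<bar>D x \<bullet> y\<bar>" unfolding h_def using \<epsilon> by (simp add: abs_mult)
      also have "\<dots> \<le> \<epsilon> * G x" using dual[OF zy(3)] \<epsilon> by (intro mult_left_mono) auto
      finally have 2: "\<bar>D x \<bullet> h\<bar> \<le> \<epsilon> * G x" .
      have "t < \<bar>\<phi> (x + h)\<bar>" using zy(2) z by simp
      then have "t < \<bar>\<phi> x\<bar> + \<epsilon> * G x + \<epsilon> * \<omega>" using 1 2 by linarith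
      then show "x \<in> {x. t < h1 x}" unfolding h1_def by (simp add: algebra_simps)
    qed
    have "?m ?A + \<epsilon> * c \<le> ?m ?A + \<epsilon> * iso_const * ?m ?A powr ((?d - 1) / ?d)"
    proof -
      have "\<nu> powr ((?d - 1) / ?d) \<le> ?m ?A powr ((?d - 1) / ?d)"
        using \<nu>A \<nu> DIM_positive[where 'a='a] by (intro powr_mono2) auto
      then show ?thesis unfolding c_def using \<epsilon> by (simp add: iso_const_def mult.assoc mult_left_mono)
    qed
    also have "\<dots> \<le> ?m (minkowski_sum ?A ((\<lambda>x. \<epsilon> *\<^sub>R x) ` W))"
      using brunn_minkowski_first_order[OF superlevel(1,2)[OF t0] neA W \<epsilon>] unfolding iso_const_def by simp
    also have "\<dots> \<le> ?m {x. t < h1 x}"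
      using incl T superlevel[OF t0] by (intro measure_mono_fmeasurable) (auto intro!: borel_open open_minkowski_sum)
    finally have fin: "?m ?A + \<epsilon> * c \<le> ?m {x. t < h1 x}" .
    have b: "?A \<in> sets borel" "{x. t < h1 x} \<in> sets borel" by measurable
    have e: "emeasure lborel X = ennreal (?m X)" if "X \<in> lmeasurable" "X \<in> sets borel" for X
    proof -
      have "emeasure lborel X = emeasure lebesgue X" using that by simp
      also have "\<dots> = ennreal (?m X)" using that(1) by (rule emeasure_eq_measure2)
      finally show ?thesis .
    qed
    show ?thesis
      using fin e[OF superlevel(3)[OF t0] b(1)] e[OF T b(2)] \<epsilon> c unfolding h0_def
      by (simp add: ennreal_plus[symmetric] ennreal_leI del: ennreal_plus)
  qed
  let ?cl = "\<lambda>h x. ennreal (max 0 (min b (h x :: real) - a'))"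
  have Sb: "?S \<in> sets borel" "?S \<in> lmeasurable" using band[OF a(1), of b] by auto
  have "(\<integral>\<^sup>+x. ?cl h0 x \<partial>lborel) + ennreal (\<epsilon> * c * (b - a'))
    = (\<integral>\<^sup>+t. emeasure lborel {x. t < h0 x} * indicator {a'<..<b} t + ennreal (\<epsilon> * c) * indicator {a'<..<b} t \<partial>lborel)"
  proof -
    have "(\<integral>\<^sup>+t. ennreal (\<epsilon> * c) * indicator {a'<..<b} t \<partial>lborel) = ennreal (\<epsilon> * c * (b - a'))"
      using a \<epsilon> c by (simp add: nn_integral_cmult_indicator ennreal_mult)
    moreover have "(\<lambda>t. emeasure lborel {x. t < h0 x} * indicator {a'<..<b} t) \<in> borel_measurable lborel"
    proof -
      have "Measurable.pred (lborel \<Otimes>\<^sub>M lborel) (\<lambda>z. fst z < h0 (snd z))" by measurable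
      then have "{z. fst z < h0 (snd z)} \<in> sets (lborel \<Otimes>\<^sub>M lborel)"
        by (simp add: pred_def space_pair_measure)
      then have "(\<lambda>t. emeasure lborel (Pair t -` {z. fst z < h0 (snd z)})) \<in> borel_measurable lborel"
        by (rule lborel.measurable_emeasure_Pair)
      then show ?thesis by (simp add: vimage_def)
    qed
    ultimately show ?thesis
      by (subst nn_integral_add) (auto simp: layer_cake_clamp[OF h_meas(1)])
  qed
  also have "\<dots> \<le> (\<integral>\<^sup>+t. emeasure lborel {x. t < h1 x} * indicator {a'<..<b} t \<partial>lborel)"
    by (intro nn_integral_mono) (use step in \<open>auto split: split_indicator\<close>)
  also have "\<dots> = (\<integral>\<^sup>+x. ?cl h1 x \<partial>lborel)" by (rule layer_cake_clamp[OF h_meas(2)])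
  also have "\<dots> \<le> (\<integral>\<^sup>+x. ?cl h0 x + ennreal (\<epsilon> * (G x + \<omega>)) * indicator ?S x \<partial>lborel)"
  proof (rule nn_integral_mono)
    fix x
    have inc: "0 \<le> \<epsilon> * (G x + \<omega>)" "\<epsilon> * (G x + \<omega>) < a' - a"
    proof -
      show "0 \<le> \<epsilon> * (G x + \<omega>)" using \<epsilon> G_nonneg[of x] \<omega> by simp
      have "\<epsilon> * (G x + \<omega>) \<le> \<epsilon> * (C + \<omega>)" using C(2)[of x] \<epsilon> by (intro mult_left_mono) auto
      then show "\<epsilon> * (G x + \<omega>) < a' - a" using \<epsilon>2 by (rule le_less_trans)
    qed
    \<comment> \<open>Below the band the increment does not reach \<open>a'\<close>, and above it
      the clamp is already saturated; only inside must the increment be paid for.\<close>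
    consider "\<bar>\<phi> x\<bar> \<le> a" | "b \<le> \<bar>\<phi> x\<bar>" | "x \<in> ?S" by fastforce
    then show "?cl h1 x \<le> ?cl h0 x + ennreal (\<epsilon> * (G x + \<omega>)) * indicator ?S x"
    proof cases
      case 1
      then have "h1 x < a'" unfolding h1_def using inc by linarith
      then show ?thesis by (simp add: max_def)
    next
      case 2
      then have "min b (h1 x) = b" "min b (h0 x) = b" unfolding h1_def h0_def using inc by auto
      then show ?thesis by simp
    next
      case 3
      have "max 0 (min b (h1 x) - a') \<le> max 0 (min b (h0 x) - a') + \<epsilon> * (G x + \<omega>)"
        unfolding h1_def h0_def using inc by linarith
      then have "?cl h1 x \<le> ennreal (max 0 (min b (h0 x) - a') + \<epsilon> * (G x + \<omega>))" by (rule ennreal_leI)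
      then show ?thesis using 3 inc by simp
    qed
  qed
  also have "\<dots> = (\<integral>\<^sup>+x. ?cl h0 x \<partial>lborel) + (\<integral>\<^sup>+x. ennreal (\<epsilon> * (G x + \<omega>)) * indicator ?S x \<partial>lborel)"
    using Sb by (intro nn_integral_add) measurable
  finally have main: "(\<integral>\<^sup>+x. ?cl h0 x \<partial>lborel) + ennreal (\<epsilon> * c * (b - a'))
    \<le> (\<integral>\<^sup>+x. ?cl h0 x \<partial>lborel) + (\<integral>\<^sup>+x. ennreal (\<epsilon> * (G x + \<omega>)) * indicator ?S x \<partial>lborel)" .
  have "(\<integral>\<^sup>+x. ?cl h0 x \<partial>lborel) \<noteq> \<infinity>"
  proof -
    have "(\<integral>\<^sup>+x. ?cl h0 x \<partial>lborel) \<le> (\<integral>\<^sup>+x. ennreal (b - a') * indicator {x. a' < \<bar>\<phi> x\<bar>} x \<partial>lborel)"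
      by (intro nn_integral_mono) (auto split: split_indicator simp: h0_def max_def ennreal_leI)
    also have "\<dots> = ennreal (b - a') * emeasure lborel {x. a' < \<bar>\<phi> x\<bar>}"
      by (intro nn_integral_cmult_indicator) measurable
    also have "\<dots> < \<infinity>"
    proof -
      have b: "{x. a' < \<bar>\<phi> x\<bar>} \<in> sets borel" by measurable
      have "{x. a' < \<bar>\<phi> x\<bar>} \<in> lmeasurable" using superlevel(3)[of a'] a by simp
      then have "emeasure lebesgue {x. a' < \<bar>\<phi> x\<bar>} < \<infinity>" by (simp add: fmeasurable_def)
      then show ?thesis using b by (simp add: ennreal_mult_less_top)
    qed
    finally show ?thesis by simp
  qed
  then have "ennreal (\<epsilon> * c * (b - a')) \<le> (\<integral>\<^sup>+x. ennreal (\<epsilon> * (G x + \<omega>)) * indicator ?S x \<partial>lborel)"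
    using main by (simp add: ennreal_add_left_cancel_le)
  also have "\<dots> = (\<integral>\<^sup>+x. ennreal (\<epsilon> * (indicator ?S x *\<^sub>R G x + \<omega> * indicator ?S x)) \<partial>lebesgue)"
  proof -
    have "(\<integral>\<^sup>+x. ennreal (\<epsilon> * (G x + \<omega>)) * indicator ?S x \<partial>lborel) = (\<integral>\<^sup>+x. ennreal (\<epsilon> * (G x + \<omega>)) * indicator ?S x \<partial>lebesgue)"
      by (rule nn_integral_completion[symmetric])
    also have "\<dots> = (\<integral>\<^sup>+x. ennreal (\<epsilon> * (indicator ?S x *\<^sub>R G x + \<omega> * indicator ?S x)) \<partial>lebesgue)"
      by (intro nn_integral_cong) (auto split: split_indicator)
    finally show ?thesis .
  qed
  also have "\<dots> = ennreal (\<integral>x. \<epsilon> * (indicator ?S x *\<^sub>R G x + \<omega> * indicator ?S x) \<partial>lebesgue)"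
    using \<epsilon> G_nonneg \<omega> integrable_G_band[OF a(1), of b] Sb
    by (intro nn_integral_eq_integral) (auto intro!: AE_I2 Bochner_Integration.integrable_add integrable_mult_right split: split_indicator simp: fmeasurable_def)
  also have "(\<integral>x. \<epsilon> * (indicator ?S x *\<^sub>R G x + \<omega> * indicator ?S x) \<partial>lebesgue)
    = \<epsilon> * ((LINT x:?S|lebesgue. G x) + \<omega> * ?m ?S)"
  proof -
    have i: "integrable lebesgue (\<lambda>x. \<omega> * indicator ?S x)" using Sb by (auto simp: fmeasurable_def)
    show ?thesis
      using Bochner_Integration.integral_add[OF integrable_G_band[OF a(1), of b] i] Sb
      by (simp add: set_lebesgue_integral_def)
  qed
  finally have "ennreal (\<epsilon> * c * (b - a')) \<le> ennreal (\<epsilon> * ((LINT x:?S|lebesgue. G x) + \<omega> * ?m ?S))" .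
  moreover have "0 \<le> (LINT x:?S|lebesgue. G x)"
    unfolding set_lebesgue_integral_def by (intro Bochner_Integration.integral_nonneg) (auto simp: G_nonneg)
  ultimately have "\<epsilon> * (c * (b - a')) \<le> \<epsilon> * ((LINT x:?S|lebesgue. G x) + \<omega> * ?m ?S)"
    using \<epsilon> \<omega> by (subst (asm) ennreal_le_iff) (auto simp: mult.assoc)
  then show ?thesis using \<epsilon> unfolding c_def by (simp add: mult.assoc mult.commute mult.left_commute)
qed

theorem level_isoperimetric:
  assumes a: "0 \<le> a" "a < b"
  shows "iso_const * (b - a) * measure lebesgue {x. b \<le> \<bar>\<phi> x\<bar>} powr ((real DIM('a) - 1) / DIM('a))
    \<le> (LINT x:{x. a < \<bar>\<phi> x\<bar> \<and> \<bar>\<phi> x\<bar> < b}|lebesgue. G x)"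
proof (cases "measure lebesgue {x. b \<le> \<bar>\<phi> x\<bar>} = 0")
  case True
  have "0 \<le> (LINT x:{x. a < \<bar>\<phi> x\<bar> \<and> \<bar>\<phi> x\<bar> < b}|lebesgue. G x)"
    unfolding set_lebesgue_integral_def by (intro Bochner_Integration.integral_nonneg) (auto simp: G_nonneg)
  then show ?thesis unfolding True by simp
next
  case False
  then have \<nu>: "0 < measure lebesgue {x. b \<le> \<bar>\<phi> x\<bar>}" using measure_nonneg order_le_less by metis
  let ?\<nu> = "measure lebesgue {x. b \<le> \<bar>\<phi> x\<bar>} powr ((real DIM('a) - 1) / DIM('a))"
  let ?I = "LINT x:{x. a < \<bar>\<phi> x\<bar> \<and> \<bar>\<phi> x\<bar> < b}|lebesgue. G x"
  let ?m = "measure lebesgue {x. a < \<bar>\<phi> x\<bar> \<and> \<bar>\<phi> x\<bar> < b}"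
  \<comment> \<open>With \<open>a' = a + \<omega>\<close> the loss at the lower end and the
    linearization error vanish together.\<close>
  have ev: "iso_const * (b - (a + \<omega>)) * ?\<nu> \<le> ?I + \<omega> * ?m" if "0 < \<omega>" "\<omega> < b - a" for \<omega>
    using that level_isoperimetric_approx[of a "a + \<omega>" b \<omega>] a \<nu> by simp
  have "((\<lambda>\<omega>. iso_const * (b - (a + \<omega>)) * ?\<nu>) \<longlongrightarrow> iso_const * (b - (a + 0)) * ?\<nu>) (at_right 0)"
    "((\<lambda>\<omega>. ?I + \<omega> * ?m) \<longlongrightarrow> ?I + 0 * ?m) (at_right 0)"
    by (intro tendsto_intros)+
  moreover have "eventually (\<lambda>\<omega>. iso_const * (b - (a + \<omega>)) * ?\<nu> \<le> ?I + \<omega> * ?m) (at_right 0)"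
    using a ev by (intro eventually_at_rightI[of 0 "b - a"]) auto
  ultimately have "iso_const * (b - (a + 0)) * ?\<nu> \<le> ?I + 0 * ?m"
    by (intro tendsto_le[OF trivial_limit_at_right_real]) auto
  then show ?thesis by simp
qed

end

subsection \<open>Finsler norms and test functions\<close>

text \<open>Young's inequality with parameter the mean value \<open>t = I / m\<close>, where it is
  an equality for \<open>G\<close> equal to its mean; integration over \<open>S\<close> therefore
  yields the sharp constant.\<close>

lemma integral_powr_jensen:
  fixes G :: "'a \<Rightarrow> real"
  assumes S: "S \<in> fmeasurable M" and G: "\<And>x. 0 \<le> G x" and r: "1 < r"
    and int: "integrable M (\<lambda>x. indicator S x *\<^sub>R G x)" "integrable M (\<lambda>x. indicator S x *\<^sub>R G x powr r)"
  shows "(LINT x:S|M. G x) powr r \<le> (LINT x:S|M. G x powr r) * measure M S powr (r - 1)"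
proof -
  define I where "I = (LINT x:S|M. G x)"
  define E where "E = (LINT x:S|M. G x powr r)"
  define m where "m = measure M S"
  have nn: "0 \<le> I" "0 \<le> E" "0 \<le> m" unfolding I_def E_def m_def set_lebesgue_integral_def
    using G by (auto intro!: Bochner_Integration.integral_nonneg)
  consider "I = 0" | "m = 0" | "0 < I" "0 < m" using nn by linarith
  then have "I powr r \<le> E * m powr (r - 1)"
  proof cases
    case 1
    then show ?thesis using nn by simp
  next
    case 2
    then have "S \<in> null_sets M" using S unfolding m_def
      by (metis fmeasurableD measure_eq_0_null_sets null_setsI emeasure_eq_measure2 ennreal_0)
    then have "AE x in M. indicator S x *\<^sub>R G x = 0" using AE_not_in by (force elim: eventually_mono)
    then have "I = 0" unfolding I_def set_lebesgue_integral_def by (rule integral_eq_zero_AE)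
    then show ?thesis using nn by simp
  next
    case 3
    define t where "t = I / m"
    have t: "0 < t" unfolding t_def using 3 by simp
    have young: "y * t powr (r - 1) \<le> y powr r / r + t powr r * ((r - 1) / r)" if "0 \<le> y" for y
    proof -
      have "y * t powr (r - 1) \<le> y powr r / r + (t powr (r - 1)) powr (r / (r - 1)) / (r / (r - 1))"
        by (rule Youngs_inequality) (use r that in \<open>auto simp: field_simps\<close>)
      also have "(t powr (r - 1)) powr (r / (r - 1)) = t powr r" using r by (simp add: powr_powr)
      finally show ?thesis by simp
    qed
    have i3: "integrable M (\<lambda>x. indicator S x *\<^sub>R (t powr r * ((r - 1) / r)))"
      using S by (auto simp: fmeasurable_def intro!: integrable_mult_left)
    have "I * t powr (r - 1) = (\<integral>x. (indicator S x *\<^sub>R G x) * t powr (r - 1) \<partial>M)"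
      unfolding I_def set_lebesgue_integral_def by simp
    also have "\<dots> \<le> (\<integral>x. (indicator S x *\<^sub>R G x powr r) / r + indicator S x *\<^sub>R (t powr r * ((r - 1) / r)) \<partial>M)"
      by (intro integral_mono Bochner_Integration.integrable_add integrable_divide_zero integrable_mult_left int i3)
         (use young G in \<open>auto split: split_indicator\<close>)
    also have "\<dots> = E / r + m * (t powr r * ((r - 1) / r))"
      using int(2) i3 S unfolding E_def set_lebesgue_integral_def m_def
      by (subst Bochner_Integration.integral_add) (auto simp: fmeasurable_def)
    finally have le: "I * t powr (r - 1) \<le> E / r + m * (t powr r * ((r - 1) / r))" .
    have "I * t powr (r - 1) = m * t powr r"
      unfolding t_def using 3 by (simp add: powr_divide powr_diff)
    then have "m * t powr r \<le> E / r + m * t powr r * ((r - 1) / r)" using le by simp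
    then have "m * t powr r * (1 - (r - 1) / r) \<le> E / r" by (simp add: algebra_simps)
    moreover have "1 - (r - 1) / r = 1 / r" using r by (simp add: field_simps)
    ultimately have "m * t powr r \<le> E" using r by (simp add: field_simps)
    then have "m powr (r - 1) * (m * t powr r) \<le> m powr (r - 1) * E" by (intro mult_left_mono) auto
    moreover have "m powr (r - 1) * (m * t powr r) = I powr r"
      unfolding t_def using 3 by (simp add: powr_divide powr_diff)
    ultimately show ?thesis by (simp add: mult.commute)
  qed
  then show ?thesis unfolding I_def E_def m_def .
qed

lemma has_derivative_grad:
  assumes "Ck_on (Suc k) \<phi> UNIV"
  shows "(\<phi> has_derivative (\<lambda>h. grad \<phi> x \<bullet> h)) (at x)"
proof -
  have d: "\<phi> differentiable (at x)" using assms by (auto simp: differentiable_on_def)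
  then have hd: "(\<phi> has_derivative frechet_derivative \<phi> (at x)) (at x)" by (simp add: frechet_derivative_works)
  then have lin: "linear (frechet_derivative \<phi> (at x))" by (rule has_derivative_linear)
  have "frechet_derivative \<phi> (at x) h = grad \<phi> x \<bullet> h" for h
  proof -
    have "frechet_derivative \<phi> (at x) h = frechet_derivative \<phi> (at x) (\<Sum>i\<in>UNIV. h $ i *\<^sub>R axis i 1)"
      by (simp add: basis_expansion[of h, unfolded scalar_mult_eq_scaleR])
    also have "\<dots> = (\<Sum>i\<in>UNIV. h $ i * pd \<phi> i x)"
      by (simp add: linear_sum[OF lin] linear_cmul[OF lin] pd_def)
    also have "\<dots> = grad \<phi> x \<bullet> h" by (simp add: inner_vec_def grad_def mult.commute)
    finally show ?thesis .
  qed
  then have "frechet_derivative \<phi> (at x) = (\<lambda>h. grad \<phi> x \<bullet> h)" by (rule ext)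
  then show ?thesis using hd by simp
qed

lemma continuous_on_grad: "Ck_on 1 \<phi> UNIV \<Longrightarrow> continuous_on UNIV (grad \<phi>)"
  unfolding grad_def by (auto intro!: continuous_on_vec_lambda)

lemma test_fun_Ck: "test_fun \<Omega> \<phi> \<Longrightarrow> Ck_on k \<phi> UNIV"
  unfolding test_fun_def smooth_on_def by auto

lemma grad_zero_outside:
  assumes "closed K" "\<And>x. x \<notin> K \<Longrightarrow> \<phi> x = 0" "x \<notin> K"
  shows "grad \<phi> x = 0"
proof -
  have "(\<phi> has_derivative (\<lambda>_. 0)) (at x)"
  proof (rule has_derivative_transform_within_open[where f = "\<lambda>_. 0" and s = "- K"])
    show "((\<lambda>_. 0) has_derivative (\<lambda>_. 0)) (at x)" by simp
  qed (use assms in \<open>auto simp: open_Compl\<close>)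
  then have "frechet_derivative \<phi> (at x) = (\<lambda>_. 0)" by (rule frechet_derivative_at[symmetric])
  then show ?thesis by (simp add: grad_def pd_def vec_eq_iff)
qed

section \<open>The norm \<open>F\<close> and its Wulff shape\<close>

locale finsler =
  fixes F :: "real^'n \<Rightarrow> real"
  assumes adm: "admissible_F F"
begin

lemma F_nonneg: "0 \<le> F x" and F_hom: "F (t *\<^sub>R x) = \<bar>t\<bar> * F x" and F_pos: "x \<noteq> 0 \<Longrightarrow> 0 < F x"
  and F_convex: "convex_on UNIV F"
  using adm unfolding admissible_F_def by auto

lemma F_zero: "F 0 = 0" using F_hom[of 0 0] by simp

lemma F_minus: "F (- x) = F x" using F_hom[of "-1" x] by simp

lemma F_cont: "continuous_on UNIV F" using convex_on_continuous[OF open_UNIV F_convex] .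

lemma F_meas [measurable]: "F \<in> borel_measurable borel" using F_cont by (rule borel_measurable_continuous_onI)

lemma F_triangle: "F (x + y) \<le> F x + F y"
proof -
  have "F ((1 - 1 / 2) *\<^sub>R x + (1 / 2) *\<^sub>R y) \<le> (1 - 1 / 2) * F x + 1 / 2 * F y"
    by (rule convex_onD[OF F_convex]) auto
  moreover have "(1 - 1 / 2) *\<^sub>R x + (1 / 2) *\<^sub>R y = (1 / 2) *\<^sub>R (x + y)" by (simp add: scaleR_add_right)
  ultimately show ?thesis using F_hom[of "1 / 2" "x + y"] by simp
qed

lemma F_upper: obtains B where "0 < B" "\<And>x. F x \<le> B * norm x"
proof -
  have "compact (F ` sphere 0 1)" by (intro compact_continuous_image) (use F_cont in \<open>auto intro: continuous_on_subset\<close>)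
  then have "bounded (F ` sphere 0 1)" by (rule compact_imp_bounded)
  then obtain B where B: "0 < B" "\<And>y. y \<in> F ` sphere 0 1 \<Longrightarrow> norm y \<le> B" unfolding bounded_pos by blast
  have "F x \<le> B * norm x" for x
  proof (cases "x = 0")
    case False
    have "F x = norm x * F (x /\<^sub>R norm x)" using F_hom[of "norm x" "x /\<^sub>R norm x"] False by simp
    moreover have "norm (F (x /\<^sub>R norm x)) \<le> B" using False by (intro B(2) imageI) simp
    then have "F (x /\<^sub>R norm x) \<le> B" by simp
    then have "norm x * F (x /\<^sub>R norm x) \<le> norm x * B" by (intro mult_left_mono) auto
    ultimately show ?thesis by (simp add: mult.commute)
  qed (simp add: F_zero)
  then show ?thesis using B(1) that by blast
qed

lemma F_lower: obtains m where "0 < m" "\<And>x. m * norm x \<le> F x"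
proof -
  have "compact (sphere (0 :: real^'n) 1)" by simp
  moreover have "sphere (0 :: real^'n) 1 \<noteq> {}" by simp
  moreover have "continuous_on (sphere 0 1) F" using F_cont continuous_on_subset by blast
  ultimately obtain z where z: "z \<in> sphere 0 1" "\<And>y. y \<in> sphere 0 1 \<Longrightarrow> F z \<le> F y"
    using continuous_attains_inf by metis
  have "z \<noteq> 0" using z(1) by auto
  have "F z * norm x \<le> F x" for x
  proof (cases "x = 0")
    case False
    have "F x = norm x * F (x /\<^sub>R norm x)" using F_hom[of "norm x" "x /\<^sub>R norm x"] False by simp
    moreover have "F z \<le> F (x /\<^sub>R norm x)" using False by (intro z(2)) simp
    then have "norm x * F z \<le> norm x * F (x /\<^sub>R norm x)" by (intro mult_left_mono) auto
    ultimately show ?thesis by (simp add: mult.commute)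
  qed (simp add: F_zero)
  then show ?thesis using F_pos[OF \<open>z \<noteq> 0\<close>] that by blast
qed

definition wulff :: "(real^'n) set" where "wulff = {x. polar F x \<le> 1}"

text \<open>The supremum in \<open>polar\<close> is a conditional one, so the quotients must be
  bounded, which \<open>F_lower\<close> provides. The description as an intersection of half-spaces
  then gives duality, closedness and convexity.\<close>

lemma wulff_eq: "wulff = {x. \<forall>\<xi>. x \<bullet> \<xi> \<le> F \<xi>}"
proof (intro set_eqI iffI)
  fix x :: "real^'n"
  obtain m where m: "0 < m" "\<And>x. m * norm x \<le> F x" using F_lower by blast
  have bdd: "bdd_above ((\<lambda>\<xi>. (x \<bullet> \<xi>) / F \<xi>) ` (UNIV - {0}))"
  proof (rule bdd_aboveI2)
    fix \<xi> :: "real^'n" assume \<xi>: "\<xi> \<in> UNIV - {0}"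
    have "x \<bullet> \<xi> \<le> norm x * norm \<xi>" by (rule norm_cauchy_schwarz)
    also have "\<dots> \<le> norm x * (F \<xi> / m)" using m by (intro mult_left_mono) (auto simp: field_simps)
    finally show "(x \<bullet> \<xi>) / F \<xi> \<le> norm x / m" using F_pos[of \<xi>] \<xi> m(1) by (simp add: field_simps)
  qed
  {
    assume "x \<in> wulff"
    then have p: "polar F x \<le> 1" unfolding wulff_def by simp
    have "x \<bullet> \<xi> \<le> F \<xi>" for \<xi>
    proof (cases "\<xi> = 0")
      case False
      then have "(x \<bullet> \<xi>) / F \<xi> \<le> polar F x" unfolding polar_def using bdd by (intro cSUP_upper) auto
      then have "(x \<bullet> \<xi>) / F \<xi> \<le> 1" using p by linarith
      then show ?thesis using F_pos[OF False] by (simp add: field_simps)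
    qed (simp add: F_zero)
    then show "x \<in> {x. \<forall>\<xi>. x \<bullet> \<xi> \<le> F \<xi>}" by simp
  }
  {
    assume x: "x \<in> {x. \<forall>\<xi>. x \<bullet> \<xi> \<le> F \<xi>}"
    have "polar F x \<le> 1" unfolding polar_def
    proof (rule cSUP_least)
      have "axis undefined 1 \<in> UNIV - {0 :: real^'n}" by (simp add: axis_eq_0_iff)
      then show "UNIV - {0 :: real^'n} \<noteq> {}" by blast
      fix \<xi> :: "real^'n" assume "\<xi> \<in> UNIV - {0}"
      then show "(x \<bullet> \<xi>) / F \<xi> \<le> 1" using x F_pos[of \<xi>] by (simp add: field_simps)
    qed
    then show "x \<in> wulff" unfolding wulff_def by simp
  }
qed

lemma wulff_dual: "y \<in> wulff \<Longrightarrow> \<bar>\<xi> \<bullet> y\<bar> \<le> F \<xi>"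
proof -
  assume y: "y \<in> wulff"
  then have "y \<bullet> \<xi> \<le> F \<xi>" "y \<bullet> (- \<xi>) \<le> F (- \<xi>)" unfolding wulff_eq by blast+
  then show ?thesis by (simp add: F_minus inner_commute abs_le_iff)
qed

lemma wulff_geometry: "closed wulff" "convex wulff" "bounded wulff" "interior wulff \<noteq> {}"
proof -
  have eq: "wulff = (\<Inter>\<xi>. {x. \<xi> \<bullet> x \<le> F \<xi>})" unfolding wulff_eq by (auto simp: inner_commute)
  show "closed wulff" unfolding eq by (intro closed_INT ballI closed_halfspace_le)
  show "convex wulff" unfolding eq by (intro convex_INT convex_halfspace_le)
  obtain B where B: "0 < B" "\<And>x. F x \<le> B * norm x" using F_upper by blast
  have "norm x \<le> B" if "x \<in> wulff" for x
  proof (cases "x = 0")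
    case False
    \<comment> \<open>The half-space condition is tested with \<open>\<xi> = x\<close>.\<close>
    have "norm x * norm x \<le> B * norm x"
      using that B(2)[of x] unfolding wulff_eq by (auto simp: dot_square_norm power2_eq_square dest!: spec[of _ x])
    then show ?thesis using False by simp
  qed (use B in simp)
  then show "bounded wulff" unfolding bounded_iff by blast
  obtain m where m: "0 < m" "\<And>x. m * norm x \<le> F x" using F_lower by blast
  have "ball 0 m \<subseteq> wulff"
  proof
    fix x assume "x \<in> ball (0 :: real^'n) m"
    then have x: "norm x \<le> m" by simp
    have "x \<bullet> \<xi> \<le> F \<xi>" for \<xi>
    proof -
      have "x \<bullet> \<xi> \<le> norm x * norm \<xi>" by (rule norm_cauchy_schwarz)
      also have "\<dots> \<le> m * norm \<xi>" using x by (intro mult_right_mono) auto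
      finally show ?thesis using m(2)[of \<xi>] by linarith
    qed
    then show "x \<in> wulff" unfolding wulff_eq by simp
  qed
  then have "0 \<in> interior wulff" using m(1) by (intro interiorI[of "ball 0 m"]) auto
  then show "interior wulff \<noteq> {}" by blast
qed

text \<open>The frontier of a convex set is a null set. The interior is the version to which the
  Brunn-Minkowski inequality for open sets applies.\<close>

lemma kappa_interior: "kappa F = measure lebesgue (interior wulff)"
proof -
  have "frontier wulff = wulff - interior wulff" using wulff_geometry(1) by (simp add: frontier_def)
  then have "negligible (wulff - interior wulff)" using negligible_convex_frontier[OF wulff_geometry(2)] by simp
  then have "negligible ((wulff - interior wulff) \<union> (interior wulff - wulff))"
    using interior_subset[of wulff] by (simp add: Diff_eq_empty_iff[THEN iffD2])
  moreover have "wulff \<in> lmeasurable" using wulff_geometry by (simp add: lmeasurable_compact compact_eq_bounded_closed)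
  ultimately have "measure lebesgue (interior wulff) = measure lebesgue wulff"
    by (intro measure_negligible_symdiff)
  then show ?thesis unfolding kappa_def wulff_def by simp
qed

lemma kappa_pos: "0 < kappa F"
proof -
  have "interior wulff \<in> lmeasurable"
    using wulff_geometry(3) by (intro lmeasurable_open) (auto intro: bounded_subset[OF _ interior_subset])
  then show ?thesis unfolding kappa_interior using wulff_geometry(4) open_interior
    by (metis open_not_negligible measure_nonneg order_le_less negligible_iff_measure0)
qed

text \<open>Exhibits \<lambda>_N as the power N/(N-1) of the isoperimetric constant, the form in
  which it arises from the level inequality.\<close>

lemma lambdaN_eq:
  assumes "2 \<le> CARD('n)"
  shows "lambdaN F = (real CARD('n) * kappa F powr (1 / real CARD('n))) powr (1 + 1 / (real CARD('n) - 1))"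
proof -
  define N where "N = real CARD('n)"
  have N: "2 \<le> N" using assms unfolding N_def by simp
  have e: "1 + 1 / (N - 1) = N / (N - 1)" using N by (simp add: field_simps)
  have "(N * kappa F powr (1 / N)) powr (N / (N - 1)) = N powr (N / (N - 1)) * kappa F powr (1 / (N - 1))"
    using N by (simp add: powr_mult powr_powr)
  then show ?thesis unfolding lambdaN_def Let_def N_def[symmetric] e by simp
qed

end

section \<open>Smoothness under sums, products and composition, and smooth truncations\<close>

lemma Ck_on_continuous: "Ck_on k f S \<Longrightarrow> continuous_on S f"
  by (cases k) auto

lemma Ck_on_Suc: "Ck_on (Suc k) f S \<Longrightarrow> Ck_on k f S"
  by (induction k arbitrary: f) auto

lemma pd_eq: "(f has_derivative f') (at x) \<Longrightarrow> pd f i x = f' (axis i 1)"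
  unfolding pd_def by (simp add: frechet_derivative_at[symmetric])

lemma Ck_on_add: "Ck_on k f UNIV \<Longrightarrow> Ck_on k g UNIV \<Longrightarrow> Ck_on k (\<lambda>x. f x + g x) UNIV"
proof (induction k arbitrary: f g)
  case 0
  then show ?case by (auto intro: continuous_on_add)
next
  case (Suc k)
  have "pd (\<lambda>x. f x + g x) i = (\<lambda>x. pd f i x + pd g i x)" for i
  proof
    fix x
    have "(f has_derivative frechet_derivative f (at x)) (at x)" "(g has_derivative frechet_derivative g (at x)) (at x)"
      using Suc.prems by (auto simp: differentiable_on_def frechet_derivative_works)
    from pd_eq[OF has_derivative_add[OF this]] show "pd (\<lambda>x. f x + g x) i x = pd f i x + pd g i x"
      by (simp add: pd_def)
  qed
  then show ?case using Suc by (auto intro: continuous_on_add differentiable_on_add)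
qed

lemma Ck_on_mult: "Ck_on k f UNIV \<Longrightarrow> Ck_on k g UNIV \<Longrightarrow> Ck_on k (\<lambda>x. f x * g x) UNIV"
proof (induction k arbitrary: f g)
  case 0
  then show ?case by (auto intro: continuous_on_mult)
next
  case (Suc k)
  note fg = Ck_on_Suc[OF Suc.prems(1)] Ck_on_Suc[OF Suc.prems(2)]
  have "pd (\<lambda>x. f x * g x) i = (\<lambda>x. f x * pd g i x + pd f i x * g x)" for i
  proof
    fix x
    have "(f has_derivative frechet_derivative f (at x)) (at x)" "(g has_derivative frechet_derivative g (at x)) (at x)"
      using Suc.prems by (auto simp: differentiable_on_def frechet_derivative_works)
    from pd_eq[OF has_derivative_mult[OF this]] show "pd (\<lambda>x. f x * g x) i x = f x * pd g i x + pd f i x * g x"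
      by (simp add: pd_def)
  qed
  moreover have "Ck_on k (\<lambda>x. f x * pd g i x + pd f i x * g x) UNIV" for i
    using Suc.prems fg by (intro Ck_on_add Suc.IH) auto
  ultimately show ?case using Suc.prems by (auto intro: continuous_on_mult differentiable_on_mult)
qed

lemma has_derivative_comp_real:
  fixes h :: "real \<Rightarrow> real"
  assumes "Ck_on (Suc k) \<phi> UNIV" "(h has_real_derivative h') (at (\<phi> x))"
  shows "((\<lambda>x. h (\<phi> x)) has_derivative (\<lambda>y. h' * (grad \<phi> x \<bullet> y))) (at x)"
  using has_derivative_compose[OF has_derivative_grad[OF assms(1)] assms(2)[unfolded has_field_derivative_def]] .

lemma grad_comp_real:
  assumes "Ck_on (Suc k) \<phi> UNIV" "(h has_real_derivative h') (at (\<phi> x))"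
  shows "grad (\<lambda>x. h (\<phi> x)) x = h' *\<^sub>R grad \<phi> x"
  using pd_eq[OF has_derivative_comp_real[OF assms]] by (simp add: grad_def vec_eq_iff inner_axis)

text \<open>The successive derivatives are supplied as a sequence \<open>D\<close> and required only
  at the values of \<open>\<phi>\<close>, because the truncations below come with derivatives on a
  bounded interval. The induction needs all \<open>n\<close> at once, since a partial derivative
  replaces \<open>D n\<close> by \<open>D (Suc n)\<close>.\<close>

lemma Ck_on_comp_real:
  assumes \<phi>: "\<And>k. Ck_on k \<phi> UNIV" and D: "\<And>n x. (D n has_real_derivative D (Suc n) (\<phi> x)) (at (\<phi> x))"
  shows "Ck_on k (\<lambda>x. D n (\<phi> x)) UNIV"
proof (induction k arbitrary: n)
  have d: "((\<lambda>x. D n (\<phi> x)) has_derivative (\<lambda>y. D (Suc n) (\<phi> x) * (grad \<phi> x \<bullet> y))) (at x)" for n x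
    by (rule has_derivative_comp_real[where k = 0, OF \<phi> D])
  have c: "continuous_on UNIV (\<lambda>x. D n (\<phi> x))" for n
    using d by (meson continuous_at_imp_continuous_on has_derivative_continuous)
  {
    case 0
    then show ?case using c by simp
  next
    case (Suc k)
    have "pd (\<lambda>x. D n (\<phi> x)) i = (\<lambda>x. D (Suc n) (\<phi> x) * pd \<phi> i x)" for i
      by (rule ext) (simp add: pd_eq[OF d] inner_axis grad_def)
    moreover have "Ck_on k (\<lambda>x. D (Suc n) (\<phi> x) * pd \<phi> i x) UNIV" for i
      using Suc \<phi>[of "Suc k"] by (intro Ck_on_mult) auto
    moreover have "(\<lambda>x. D n (\<phi> x)) differentiable (at x)" for x using d[of n x] by (rule differentiableI)
    ultimately show ?case using c by (auto simp: differentiable_on_def)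
  }
qed

lemma test_fun_comp_real:
  assumes \<phi>: "test_fun \<Omega> \<phi>" and D: "\<And>n x. (D n has_real_derivative D (Suc n) (\<phi> x)) (at (\<phi> x))" and 0: "D 0 0 = 0"
  shows "test_fun \<Omega> (\<lambda>x. D 0 (\<phi> x))" "grad (\<lambda>x. D 0 (\<phi> x)) x = D 1 (\<phi> x) *\<^sub>R grad \<phi> x"
proof -
  show "test_fun \<Omega> (\<lambda>x. D 0 (\<phi> x))"
    unfolding test_fun_def smooth_on_def
  proof (intro conjI allI)
    show "Ck_on k (\<lambda>x. D 0 (\<phi> x)) UNIV" for k by (rule Ck_on_comp_real[where n = 0 and D = D, OF test_fun_Ck[OF \<phi>] D])
    show "\<exists>K. compact K \<and> K \<subseteq> \<Omega> \<and> (\<forall>x. x \<notin> K \<longrightarrow> D 0 (\<phi> x) = 0)"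
      using \<phi> 0 unfolding test_fun_def by metis
  qed
  show "grad (\<lambda>x. D 0 (\<phi> x)) x = D 1 (\<phi> x) *\<^sub>R grad \<phi> x"
    using grad_comp_real[where k = 0, OF test_fun_Ck[OF \<phi>] D[of 0 x]] by simp
qed

lemma test_fun_scale:
  assumes "test_fun \<Omega> \<phi>"
  shows "test_fun \<Omega> (\<lambda>x. c * \<phi> x)" "grad (\<lambda>x. c * \<phi> x) x = c *\<^sub>R grad \<phi> x"
proof -
  define D :: "nat \<Rightarrow> real \<Rightarrow> real" where "D n s = (if n = 0 then c * s else if n = 1 then c else 0)" for n s
  have "(D n has_real_derivative D (Suc n) s) (at s)" for n s
    unfolding D_def by (cases n) (auto intro!: derivative_eq_intros)
  from test_fun_comp_real[of \<Omega> \<phi> D, OF assms this] show "test_fun \<Omega> (\<lambda>x. c * \<phi> x)" "grad (\<lambda>x. c * \<phi> x) x = c *\<^sub>R grad \<phi> x"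
    by (auto simp: D_def)
qed

text \<open>An antiderivative of exp(-(s/L)^k), which for large even \<open>k\<close> approximates
  the indicator of [-L, L] by an explicit smooth function. The slope is at most 1, so no energy is
  gained; it is at least exp(-(1/2)^k) for |s| \<le> L/2, and the mean value theorem with
  monotonicity turns this into the last property.\<close>

lemma smooth_truncation:
  fixes L V :: real and k :: nat
  assumes L: "0 < L" and V: "0 \<le> V" and k: "even k"
  obtains D :: "nat \<Rightarrow> real \<Rightarrow> real" where
    "\<And>n s. \<bar>s\<bar> \<le> V \<Longrightarrow> (D n has_real_derivative D (Suc n) s) (at s)"
    "D 0 0 = 0" "\<And>s. D 1 s = exp (- ((s / L) ^ k))"
    "\<And>s. \<bar>s\<bar> \<le> V \<Longrightarrow> exp (- ((1 / 2) ^ k)) * min \<bar>s\<bar> (L / 2) \<le> \<bar>D 0 s\<bar>"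
proof -
  define R :: "real poly" where "R = - ([:0, 1 / L:] ^ k)"
  define P :: "nat \<Rightarrow> real poly" where "P = rec_nat 1 (\<lambda>_ p. pderiv p + p * pderiv R)"
  have P: "P 0 = 1" "P (Suc n) = pderiv (P n) + P n * pderiv R" for n unfolding P_def by auto
  define \<tau> where "\<tau> s = exp (poly R s)" for s
  have \<tau>: "\<tau> s = exp (- ((s / L) ^ k))" for s unfolding \<tau>_def R_def by (simp add: poly_power)
  \<comment> \<open>The integral starts below \<open>- V\<close> so that [-V, V] is interior to the
    interval of the fundamental theorem; subtracting the value at 0 normalizes
    \<open>T 0 = 0\<close>.\<close>
  define T where "T s = integral {- V - 1..s} \<tau> - integral {- V - 1..0} \<tau>" for s
  define D where "D n s = (case n of 0 \<Rightarrow> T s | Suc m \<Rightarrow> poly (P m) s * \<tau> s)" for n s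
  have D0: "D 0 = T" and DS: "D (Suc n) s = poly (P n) s * \<tau> s" for n s unfolding D_def by auto
  have D1: "D (Suc 0) = \<tau>" by (rule ext) (simp add: DS P)
  have T': "(T has_real_derivative \<tau> s) (at s)" if "\<bar>s\<bar> \<le> V" for s
  proof -
    have "continuous_on {- V - 1..V + 1} \<tau>" unfolding \<tau>_def by (intro continuous_intros)
    then have "((\<lambda>x. integral {- V - 1..x} \<tau>) has_real_derivative \<tau> s) (at s within {- V - 1..V + 1})"
      using that by (intro integral_has_real_derivative) auto
    moreover have "at s within {- V - 1..V + 1} = at s"
      using that by (intro at_within_interior) auto
    ultimately show ?thesis unfolding T_def by (auto intro!: derivative_eq_intros)
  qed
  have der: "(D n has_real_derivative D (Suc n) s) (at s)" if "\<bar>s\<bar> \<le> V" for n s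
  proof (cases n)
    case 0
    then show ?thesis using T'[OF that] by (simp add: D0 D1)
  next
    case (Suc m)
    have "((\<lambda>s. poly (P m) s * exp (poly R s)) has_real_derivative
      poly (pderiv (P m)) s * exp (poly R s) + poly (P m) s * (exp (poly R s) * poly (pderiv R) s)) (at s)"
      by (auto intro!: derivative_eq_intros)
    then show ?thesis unfolding Suc DS P \<tau>_def[abs_def] by (simp add: D_def algebra_simps \<tau>_def[abs_def])
  qed
  have \<tau>lo: "exp (- ((1 / 2) ^ k)) \<le> \<tau> s" if "\<bar>s\<bar> \<le> L / 2" for s
  proof -
    have "(s / L) ^ k = \<bar>s / L\<bar> ^ k" by (rule power_even_abs[OF k, symmetric])
    also have "\<dots> \<le> (1 / 2) ^ k" using that L by (intro power_mono) (auto simp: field_simps)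
    finally show ?thesis unfolding \<tau> by simp
  qed
  have T0: "T 0 = 0" unfolding T_def by simp
  have mono: "T x \<le> T y" if "x \<le> y" "- V \<le> x" "y \<le> V" for x y
  proof (rule DERIV_nonneg_imp_nondecreasing[OF that(1)])
    fix z assume "x \<le> z" "z \<le> y"
    then have "(T has_real_derivative \<tau> z) (at z)" using that by (intro T') auto
    moreover have "0 \<le> \<tau> z" unfolding \<tau>_def by simp
    ultimately show "\<exists>d. (T has_real_derivative d) (at z) \<and> 0 \<le> d" by blast
  qed
  have lo: "exp (- ((1 / 2) ^ k)) * min \<bar>s\<bar> (L / 2) \<le> \<bar>T s\<bar>" if s: "\<bar>s\<bar> \<le> V" for s
  proof -
    let ?\<kappa> = "exp (- ((1 / 2) ^ k)) :: real"
    consider "s = 0" | "0 < s" | "s < 0" by linarith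
    then show ?thesis
    proof cases
      case 1
      then show ?thesis using L by (simp add: T0 min_def)
    next
      case 2
      define t where "t = min s (L / 2)"
      have t: "0 < t" "t \<le> s" "t \<le> L / 2" using 2 L unfolding t_def by auto
      obtain \<xi> where \<xi>: "0 < \<xi>" "\<xi> < t" "T t - T 0 = (t - 0) * \<tau> \<xi>"
        using MVT2[OF t(1), of T \<tau>] T' t s by (metis abs_of_nonneg less_eq_real_def order_trans)
      have "?\<kappa> * t \<le> \<tau> \<xi> * t" using \<tau>lo[of \<xi>] \<xi> t by (intro mult_right_mono) auto
      also have "\<dots> = T t" using \<xi>(3) T0 by (simp add: mult.commute)
      also have "T t \<le> T s"
        by (rule mono) (use s t in auto)
      finally have "?\<kappa> * t \<le> T s" .
      then show ?thesis using 2 unfolding t_def by simp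
    next
      case 3
      define t where "t = max s (- (L / 2))"
      have t: "t < 0" "s \<le> t" "- (L / 2) \<le> t" using 3 L unfolding t_def by auto
      obtain \<xi> where \<xi>: "t < \<xi>" "\<xi> < 0" "T 0 - T t = (0 - t) * \<tau> \<xi>"
        using MVT2[OF t(1), of T \<tau>] T' t s by (smt (verit))
      have "?\<kappa> * (- t) \<le> \<tau> \<xi> * (- t)" using \<tau>lo[of \<xi>] \<xi> t by (intro mult_right_mono) auto
      also have "\<dots> = - T t" using \<xi>(3) T0 by (simp add: mult.commute)
      also have "- T t \<le> - T s"
      proof -
        have "T s \<le> T t"
          by (rule mono) (use s t in auto)
        then show ?thesis by simp
      qed
      finally have "?\<kappa> * (- t) \<le> - T s" .
      moreover have "- t = min \<bar>s\<bar> (L / 2)" using 3 unfolding t_def by (auto simp: min_def max_def)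
      ultimately show ?thesis by simp
    qed
  qed
  show ?thesis
    by (rule that[of D]) (use der lo in \<open>auto simp: D0 D1 T0 \<tau>\<close>)
qed

section \<open>Test functions on a bounded domain\<close>

locale finsler_domain = finsler F for F :: "real^'n \<Rightarrow> real" +
  fixes \<Omega> :: "(real^'n) set" and N q :: real
  assumes N_eq: "N = real CARD('n)" and q_def: "q = 1 / (N - 1)"
    and dim: "2 \<le> CARD('n)" and open_dom: "open \<Omega>" and bounded_dom: "bounded \<Omega>"
begin

abbreviation M :: "(real^'n) measure" where "M \<equiv> lebesgue_on \<Omega>"
lemma N2: "2 \<le> N" using dim N_eq by simp

lemma q: "0 < q" "q \<le> 1" "N * q = 1 + q" "1 + 1 / q = N"
  unfolding q_def using N2 by (auto simp: field_simps)

lemma lambdaN_eq_powr: "lambdaN F = (N * kappa F powr (1 / N)) powr (1 + q)"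
  using lambdaN_eq[OF dim] unfolding N_eq q_def .

lemma lambdaN_pos: "0 < lambdaN F"
  unfolding lambdaN_eq_powr using kappa_pos N2 by simp

lemma dom_lmeasurable: "\<Omega> \<in> lmeasurable" using bounded_dom open_dom by (rule lmeasurable_open)

lemma dom_sets [measurable]: "\<Omega> \<in> sets lebesgue" using dom_lmeasurable by auto

lemma finite_M: "finite_measure M"
  using dom_lmeasurable by (intro finite_measure_restrict_space[of lebesgue \<Omega>, simplified] finite_measureI)
    (auto simp: emeasure_restrict_space fmeasurable_def)

lemma measure_M: "{x. P x} \<subseteq> \<Omega> \<Longrightarrow> measure M {x \<in> space M. P x} = measure lebesgue {x. P x}"
  by (subst measure_restrict_space) (auto intro!: arg_cong[where f = "measure lebesgue"])

lemma measurable_M: "f \<in> borel_measurable borel \<Longrightarrow> f \<in> borel_measurable M"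
  by (intro measurable_restrict_space1 measurable_completion) simp

definition grad_energy :: "(real^'n \<Rightarrow> real) \<Rightarrow> real^'n \<Rightarrow> real" where
  "grad_energy \<phi> x = F (grad \<phi> x) powr N"

lemma grad_energy_nonneg: "0 \<le> grad_energy \<phi> x" unfolding grad_energy_def by simp

lemma test_fun_C1:
  assumes "test_fun \<Omega> \<phi>"
  obtains K where "compactly_supported_C1 \<phi> (grad \<phi>) K (interior wulff) (\<lambda>x. F (grad \<phi> x))" "K \<subseteq> \<Omega>"
proof -
  obtain K where K: "compact K" "K \<subseteq> \<Omega>" "\<And>x. x \<notin> K \<Longrightarrow> \<phi> x = 0" using assms unfolding test_fun_def by blast
  have Ck: "Ck_on 1 \<phi> UNIV" using test_fun_Ck[OF assms] .
  have gz: "grad \<phi> x = 0" if "x \<notin> K" for x using grad_zero_outside[OF compact_imp_closed[OF K(1)] K(3) that] .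
  have "compactly_supported_C1 \<phi> (grad \<phi>) K (interior wulff) (\<lambda>x. F (grad \<phi> x))"
  proof
    show "(\<phi> has_derivative (\<lambda>h. grad \<phi> x \<bullet> h)) (at x)" for x
      by (rule has_derivative_grad[where k = 0]) (use Ck in simp)
    show c: "continuous_on UNIV (grad \<phi>)" using continuous_on_grad[OF Ck] .
    show "continuous_on UNIV (\<lambda>x. F (grad \<phi> x))"
      by (rule continuous_on_compose2[OF F_cont c]) auto
    show "bounded K" using K(1) by (rule compact_imp_bounded)
    show "bounded (interior wulff)" using wulff_geometry(3) bounded_subset interior_subset by metis
    show "\<bar>grad \<phi> x \<bullet> y\<bar> \<le> F (grad \<phi> x)" if "y \<in> interior wulff" for x y
      using that interior_subset by (intro wulff_dual) auto
  qed (use K gz wulff_geometry F_nonneg F_zero in auto)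
  then show ?thesis using K(2) that by blast
qed

context
  fixes \<phi> assumes \<phi>: "test_fun \<Omega> \<phi>"
begin

lemma F_grad_bounded: obtains C where "0 < C" "\<And>x. F (grad \<phi> x) \<le> C"
proof -
  obtain K where "compactly_supported_C1 \<phi> (grad \<phi>) K (interior wulff) (\<lambda>x. F (grad \<phi> x))" using test_fun_C1[OF \<phi>] .
  then interpret compactly_supported_C1 \<phi> "grad \<phi>" K "interior wulff" "\<lambda>x. F (grad \<phi> x)" .
  show ?thesis using G_bounded that by blast
qed

lemma test_meas [measurable]: "\<phi> \<in> borel_measurable borel" "grad \<phi> \<in> borel_measurable borel"
  using Ck_on_continuous[OF test_fun_Ck[OF \<phi>, of 0]] continuous_on_grad[OF test_fun_Ck[OF \<phi>]]
  by (auto intro: borel_measurable_continuous_onI)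

lemma grad_energy_meas [measurable]: "grad_energy \<phi> \<in> borel_measurable borel"
  unfolding grad_energy_def by measurable

lemma test_bounded: obtains V where "0 \<le> V" "\<And>x. \<bar>\<phi> x\<bar> \<le> V"
proof -
  obtain K where K: "compact K" "\<And>x. x \<notin> K \<Longrightarrow> \<phi> x = 0" using \<phi> unfolding test_fun_def by blast
  have "compact (\<phi> ` K)" using K(1) Ck_on_continuous[OF test_fun_Ck[OF \<phi>, of 0]]
    by (intro compact_continuous_image) (auto intro: continuous_on_subset)
  then have "bounded (\<phi> ` K)" by (rule compact_imp_bounded)
  then obtain V where V: "0 < V" "\<And>y. y \<in> \<phi> ` K \<Longrightarrow> norm y \<le> V" unfolding bounded_pos by blast
  have "\<bar>\<phi> x\<bar> \<le> V" for x using V K(2)[of x] by (cases "x \<in> K") auto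
  then show ?thesis using V(1) that[of V] by auto
qed

lemma grad_energy_integrable: "integrable M (grad_energy \<phi>)"
proof -
  interpret finite_measure M by (rule finite_M)
  obtain C where C: "0 < C" "\<And>x. F (grad \<phi> x) \<le> C" using F_grad_bounded by blast
  show ?thesis
    by (rule integrable_const_bound[where B = "C powr N"])
       (use C F_nonneg N2 in \<open>auto simp: grad_energy_def intro!: AE_I2 powr_mono2 measurable_M grad_energy_meas[unfolded grad_energy_def]\<close>)
qed

lemma test_level_energy: "level_energy M (\<lambda>x. \<bar>\<phi> x\<bar>) (grad_energy \<phi>) (lambdaN F) q"
proof -
  interpret finite_measure M by (rule finite_M)
  show ?thesis
    by unfold_locales (use q lambdaN_pos grad_energy_integrable grad_energy_nonneg in \<open>auto intro!: measurable_M\<close>)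
qed

text \<open>The band inequality and Jensen give c (b - a) \<nu>(b)^((N-1)/N) \<le> I \<le>
  e(a,b)^(1/N) |S|^((N-1)/N), where |S| is \<open>mu a - nu b\<close>. The power N/(N-1) = 1 + q
  makes both measures linear, which is the base inequality required by
  \<open>level_inequalityI\<close>.\<close>

lemma test_level_inequality: "level_inequality M (\<lambda>x. \<bar>\<phi> x\<bar>) (grad_energy \<phi>) (lambdaN F) q"
proof -
  interpret le: level_energy M "\<lambda>x. \<bar>\<phi> x\<bar>" "grad_energy \<phi>" "lambdaN F" q by (rule test_level_energy)
  obtain K where "compactly_supported_C1 \<phi> (grad \<phi>) K (interior wulff) (\<lambda>x. F (grad \<phi> x))" "K \<subseteq> \<Omega>" using test_fun_C1[OF \<phi>] .
  then interpret c1: compactly_supported_C1 \<phi> "grad \<phi>" K "interior wulff" "\<lambda>x. F (grad \<phi> x)" by simp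
  have supp: "x \<in> \<Omega>" if "\<phi> x \<noteq> 0" for x using that c1.K(2) \<open>K \<subseteq> \<Omega>\<close> by blast
  show ?thesis
  proof (rule le.level_inequalityI)
    fix a b :: real assume ab: "0 \<le> a" "a < b" "0 < le.nu b"
    let ?S = "{x. a < \<bar>\<phi> x\<bar> \<and> \<bar>\<phi> x\<bar> < b}"
    let ?G = "\<lambda>x. F (grad \<phi> x)"
    define I where "I = (LINT x:?S|lebesgue. ?G x)"
    define c where "c = N * kappa F powr (1 / N)"
    have S: "?S \<in> sets borel" "?S \<in> lmeasurable" "?S \<subseteq> \<Omega>" using c1.band[OF ab(1)] supp ab by auto
    have nu: "le.nu b = measure lebesgue {x. b \<le> \<bar>\<phi> x\<bar>}"
      unfolding le.nu_def by (rule measure_M) (use supp ab in force)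
    have m: "le.mu a - le.nu b = measure lebesgue ?S"
    proof -
      have "measure M ({x \<in> space M. a < \<bar>\<phi> x\<bar>} - {x \<in> space M. b \<le> \<bar>\<phi> x\<bar>}) = le.mu a - le.nu b"
        unfolding le.mu_def le.nu_def
    proof (rule le.finite_measure_Diff)
      show "{x \<in> space M. a < \<bar>\<phi> x\<bar>} \<in> sets M" "{x \<in> space M. b \<le> \<bar>\<phi> x\<bar>} \<in> sets M" by measurable
    qed (use ab in auto)
      moreover have "{x \<in> space M. a < \<bar>\<phi> x\<bar>} - {x \<in> space M. b \<le> \<bar>\<phi> x\<bar>} = {x \<in> space M. a < \<bar>\<phi> x\<bar> \<and> \<bar>\<phi> x\<bar> < b}" by auto
      ultimately show ?thesis using measure_M[OF S(3)] by simp
    qed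
    have en: "le.en a b = (LINT x:?S|lebesgue. ?G x powr N)"
    proof -
      have "le.en a b = (\<integral>x. indicator \<Omega> x *\<^sub>R (grad_energy \<phi> x * indicator ?S x) \<partial>lebesgue)"
        unfolding le.en_def by (intro integral_restrict_space) simp
      also have "\<dots> = (\<integral>x. indicator ?S x *\<^sub>R ?G x powr N \<partial>lebesgue)"
        by (intro Bochner_Integration.integral_cong refl) (use S(3) in \<open>auto simp: grad_energy_def split: split_indicator\<close>)
      finally show ?thesis unfolding set_lebesgue_integral_def .
    qed
    have c: "0 < c" unfolding c_def using kappa_pos N2 by simp
    have lam: "lambdaN F = c powr (1 + q)" unfolding lambdaN_eq_powr c_def ..
    have "c1.iso_const = c" unfolding c1.iso_const_def c_def kappa_interior N_eq by simp
    then have iso: "c * (b - a) * le.nu b powr ((N - 1) / N) \<le> I"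
      using c1.level_isoperimetric[OF ab(1,2)] unfolding nu I_def N_eq by simp
    have intN: "integrable lebesgue (\<lambda>x. indicator ?S x *\<^sub>R ?G x powr N)"
    proof -
      obtain C where C: "0 < C" "\<And>x. ?G x \<le> C" using F_grad_bounded by blast
      have "grad_energy \<phi> \<in> borel_measurable lebesgue" by (rule measurable_completion) simp
      then show ?thesis
        by (intro integrableI_bounded_set_indicator[where B = "C powr N"])
           (use C F_nonneg S N2 in \<open>auto intro!: AE_I2 powr_mono2 simp: fmeasurable_def grad_energy_def[abs_def]\<close>)
    qed
    have jen: "I powr N \<le> le.en a b * measure lebesgue ?S powr (N - 1)"
      unfolding I_def en
      by (rule integral_powr_jensen[OF S(2)]) (use F_nonneg N2 intN c1.integrable_G_band[OF ab(1), of b] in auto)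
    have Ipos: "0 \<le> c * (b - a) * le.nu b powr ((N - 1) / N)" using c ab by simp
    have e1: "(N - 1) * (1 + q) / N = 1" unfolding q_def using N2 by (simp add: field_simps)
    have "lambdaN F * (b - a) powr (1 + q) * le.nu b = (c * (b - a) * le.nu b powr ((N - 1) / N)) powr (1 + q)"
      using c ab by (simp add: lam powr_mult powr_powr e1)
    also have "\<dots> \<le> I powr (1 + q)" using iso Ipos q by (intro powr_mono2) auto
    also have "\<dots> = (I powr N) powr q" by (simp add: powr_powr q(3))
    also have "\<dots> \<le> (le.en a b * measure lebesgue ?S powr (N - 1)) powr q"
      using jen q by (intro powr_mono2) auto
    also have "\<dots> = le.en a b powr q * measure lebesgue ?S"
    proof -
      have "(N - 1) * q = 1" unfolding q_def using N2 by simp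
      then show ?thesis by (simp add: powr_mult powr_powr le.en_nonneg)
    qed
    finally have "lambdaN F * (b - a) powr (1 + q) * le.nu b \<le> le.en a b powr q * (le.mu a - le.nu b)" unfolding m .
    then show "lambdaN F * (b - a) powr (1 + q) \<le> le.en a b powr q * ((le.mu a - le.nu b) / le.nu b)"
      using ab(3) by (simp add: field_simps)
  qed
qed

lemma Lp_norm_test: "Lp_norm p \<Omega> \<phi> powr N = (\<integral>x. \<bar>\<phi> x\<bar> powr p \<partial>M) powr (N / p)"
proof -
  have "(LINT x:\<Omega>|lebesgue. \<bar>\<phi> x\<bar> powr p) = (\<integral>x. \<bar>\<phi> x\<bar> powr p \<partial>M)"
    unfolding set_lebesgue_integral_def by (intro integral_restrict_space[symmetric]) simp
  then show ?thesis unfolding Lp_norm_def by (simp add: powr_powr)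
qed

lemma W10_test: "W10 N \<Omega> \<phi> (grad \<phi>)"
  unfolding W10_def
proof (intro conjI exI[of _ "\<lambda>_. \<phi>"] allI)
  show "\<phi> \<in> borel_measurable lebesgue" "grad \<phi> \<in> borel_measurable lebesgue" by (auto intro!: measurable_completion)
qed (use \<phi> in simp_all)

text \<open>A function of zero norm is no competitor for the infimum, but then the left side is 0.
  Otherwise the infimum applies, its set being bounded below by 0.\<close>

lemma gamma1_le_test: "gamma1 F p \<Omega> * (\<integral>x. \<bar>\<phi> x\<bar> powr p \<partial>M) powr (N / p) \<le> (\<integral>x. grad_energy \<phi> x \<partial>M)"
proof -
  have E: "(\<integral>x. grad_energy \<phi> x \<partial>M) = (LINT x:\<Omega>|lebesgue. F (grad \<phi> x) powr N)"
    unfolding grad_energy_def set_lebesgue_integral_def by (intro integral_restrict_space) simp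
  have nn: "0 \<le> (LINT x:\<Omega>|lebesgue. F (g x) powr N)" for g :: "real^'n \<Rightarrow> real^'n"
    unfolding set_lebesgue_integral_def by (intro Bochner_Integration.integral_nonneg) auto
  show ?thesis
  proof (cases "Lp_norm p \<Omega> \<phi> = 0")
    case True
    then show ?thesis using nn[of "grad \<phi>"] E unfolding Lp_norm_test[symmetric] by simp
  next
    case False
    let ?A = "{(LINT x:\<Omega>|lebesgue. F (g x) powr N) / Lp_norm p \<Omega> u powr N | u g. W10 N \<Omega> u g \<and> Lp_norm p \<Omega> u \<noteq> 0}"
    have "gamma1 F p \<Omega> \<le> (LINT x:\<Omega>|lebesgue. F (grad \<phi> x) powr N) / Lp_norm p \<Omega> \<phi> powr N"
      unfolding gamma1_def Let_def N_eq[symmetric]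
    proof (rule cInf_lower)
      show "bdd_below ?A" using nn by (intro bdd_belowI[of _ 0]) auto
      show "(LINT x:\<Omega>|lebesgue. F (grad \<phi> x) powr N) / Lp_norm p \<Omega> \<phi> powr N \<in> ?A" using W10_test False by blast
    qed
    moreover have "0 < Lp_norm p \<Omega> \<phi> powr N" using False by simp
    ultimately show ?thesis unfolding E Lp_norm_test[symmetric] by (simp add: field_simps)
  qed
qed

end

text \<open>A sharp truncation is no test function, so the quotient defining \<gamma>_1 is applied
  to smooth truncations with exponents 2(j+1). As \<open>j\<close> grows, \<open>\<kappa> j\<close>
  tends to 1 and the energy retained above \<open>L\<close> tends to 0 by dominated convergence. On
  the set |\<phi>| = L the slope stays at exp(-1); this set is included on the right side.\<close>

lemma test_truncation_coercive:
  assumes \<phi>: "test_fun \<Omega> \<phi>" and L: "0 < L" and p: "0 < p" and g: "0 \<le> gamma1 F p \<Omega>"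
  shows "gamma1 F p \<Omega> * (\<integral>x. min \<bar>\<phi> x\<bar> (L / 2) powr p \<partial>M) powr (N / p)
    \<le> (\<integral>x. grad_energy \<phi> x * indicator {x. \<bar>\<phi> x\<bar> \<le> L} x \<partial>M)"
proof -
  interpret le: level_energy M "\<lambda>x. \<bar>\<phi> x\<bar>" "grad_energy \<phi>" "lambdaN F" q by (rule test_level_energy[OF \<phi>])
  note [measurable] = measurable_M[OF test_meas(1)[OF \<phi>]] measurable_M[OF grad_energy_meas[OF \<phi>]]
  obtain V where V: "0 \<le> V" "\<And>x. \<bar>\<phi> x\<bar> \<le> V" using test_bounded[OF \<phi>] by blast
  define X where "X = (\<integral>x. min \<bar>\<phi> x\<bar> (L / 2) powr p \<partial>M)"
  define \<kappa> where "\<kappa> j = exp (- ((1 / 2) ^ (2 * Suc j)) :: real)" for j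
  define \<tau> where "\<tau> j s = exp (- ((s / L) ^ (2 * Suc j)))" for j and s :: real
  define e where "e j x = \<tau> j (\<phi> x) powr N * grad_energy \<phi> x * indicator {x. L < \<bar>\<phi> x\<bar>} x" for j x
  have \<tau>: "0 < \<tau> j s" "\<tau> j s \<le> 1" for j s unfolding \<tau>_def by (auto simp del: power_Suc mult_Suc_right intro!: zero_le_even_power)
  have e_meas [measurable]: "e j \<in> borel_measurable M" for j unfolding e_def \<tau>_def by measurable
  have e_bd: "norm (e j x) \<le> grad_energy \<phi> x" for j x
  proof -
    have "\<tau> j (\<phi> x) powr N \<le> 1" using \<tau>[of j "\<phi> x"] N2 by (intro powr_le1) auto
    then show ?thesis unfolding e_def using grad_energy_nonneg[of \<phi> x]
      by (auto split: split_indicator simp: abs_mult mult_left_le_one_le)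
  qed
  have e_int: "integrable M (e j)" for j
    by (rule Bochner_Integration.integrable_bound[OF le.f_int]) (use e_bd grad_energy_nonneg in \<open>auto intro!: AE_I2\<close>)
  have step: "gamma1 F p \<Omega> * (\<kappa> j powr N * X powr (N / p))
    \<le> (\<integral>x. grad_energy \<phi> x * indicator {x. \<bar>\<phi> x\<bar> \<le> L} x \<partial>M) + (\<integral>x. e j x \<partial>M)" for j
  proof -
    obtain D :: "nat \<Rightarrow> real \<Rightarrow> real" where D: "\<And>n s. \<bar>s\<bar> \<le> V \<Longrightarrow> (D n has_real_derivative D (Suc n) s) (at s)"
      "D 0 0 = 0" "\<And>s. D 1 s = \<tau> j s" "\<And>s. \<bar>s\<bar> \<le> V \<Longrightarrow> \<kappa> j * min \<bar>s\<bar> (L / 2) \<le> \<bar>D 0 s\<bar>"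
      unfolding \<kappa>_def \<tau>_def using smooth_truncation[OF L V(1), of "2 * Suc j"] by auto
    let ?\<psi> = "\<lambda>x. D 0 (\<phi> x)"
    have \<psi>: "test_fun \<Omega> ?\<psi>" "\<And>x. grad ?\<psi> x = D 1 (\<phi> x) *\<^sub>R grad \<phi> x"
      using test_fun_comp_real[OF \<phi>, of D] D V by auto
    obtain V' where V': "0 \<le> V'" "\<And>x. \<bar>?\<psi> x\<bar> \<le> V'" using test_bounded[OF \<psi>(1)] by blast
    have \<kappa>: "0 < \<kappa> j" unfolding \<kappa>_def by simp
    have X0: "0 \<le> X" unfolding X_def by (intro Bochner_Integration.integral_nonneg) auto
    have "\<kappa> j powr p * X = (\<integral>x. \<kappa> j powr p * min \<bar>\<phi> x\<bar> (L / 2) powr p \<partial>M)" unfolding X_def by simp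
    also have "\<dots> \<le> (\<integral>x. \<bar>?\<psi> x\<bar> powr p \<partial>M)"
    proof (rule integral_mono)
      show "integrable M (\<lambda>x. \<kappa> j powr p * min \<bar>\<phi> x\<bar> (L / 2) powr p)"
        by (intro integrable_mult_right le.integrable_const_bound[where B = "(L / 2) powr p"])
           (use L p in \<open>auto intro!: AE_I2 powr_mono2\<close>)
      show "integrable M (\<lambda>x. \<bar>?\<psi> x\<bar> powr p)"
        using measurable_M[OF test_meas(1)[OF \<psi>(1)]]
        by (intro le.integrable_const_bound[where B = "V' powr p"]) (use V' p in \<open>auto intro!: AE_I2 powr_mono2\<close>)
      fix x
      have "\<kappa> j powr p * min \<bar>\<phi> x\<bar> (L / 2) powr p = (\<kappa> j * min \<bar>\<phi> x\<bar> (L / 2)) powr p"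
        using \<kappa> L by (simp add: powr_mult)
      also have "\<dots> \<le> \<bar>?\<psi> x\<bar> powr p" using D(4)[of "\<phi> x"] V \<kappa> L p by (intro powr_mono2) auto
      finally show "\<kappa> j powr p * min \<bar>\<phi> x\<bar> (L / 2) powr p \<le> \<bar>?\<psi> x\<bar> powr p" .
    qed
    finally have "(\<kappa> j powr p * X) powr (N / p) \<le> (\<integral>x. \<bar>?\<psi> x\<bar> powr p \<partial>M) powr (N / p)"
      using X0 p N2 by (intro powr_mono2) auto
    moreover have "(\<kappa> j powr p * X) powr (N / p) = \<kappa> j powr N * X powr (N / p)"
      using X0 p by (simp add: powr_mult powr_powr)
    ultimately have "gamma1 F p \<Omega> * (\<kappa> j powr N * X powr (N / p)) \<le> gamma1 F p \<Omega> * (\<integral>x. \<bar>?\<psi> x\<bar> powr p \<partial>M) powr (N / p)"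
      using g by (intro mult_left_mono) auto
    also have "\<dots> \<le> (\<integral>x. grad_energy ?\<psi> x \<partial>M)" by (rule gamma1_le_test[OF \<psi>(1)])
    also have "\<dots> \<le> (\<integral>x. grad_energy \<phi> x * indicator {x. \<bar>\<phi> x\<bar> \<le> L} x + e j x \<partial>M)"
    proof (rule integral_mono[OF grad_energy_integrable[OF \<psi>(1)]])
      show "integrable M (\<lambda>x. grad_energy \<phi> x * indicator {x. \<bar>\<phi> x\<bar> \<le> L} x + e j x)"
        by (intro Bochner_Integration.integrable_add le.integrable_f_indicator e_int) measurable
      fix x
      have "grad_energy ?\<psi> x = \<tau> j (\<phi> x) powr N * grad_energy \<phi> x"
        unfolding grad_energy_def \<psi>(2) F_hom D(3) using \<tau>[of j "\<phi> x"] F_nonneg by (simp add: powr_mult)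
      moreover have "\<tau> j (\<phi> x) powr N * grad_energy \<phi> x \<le> grad_energy \<phi> x"
        using \<tau>[of j "\<phi> x"] grad_energy_nonneg[of \<phi> x] N2 by (intro mult_left_le_one_le powr_le1) auto
      ultimately show "grad_energy ?\<psi> x \<le> grad_energy \<phi> x * indicator {x. \<bar>\<phi> x\<bar> \<le> L} x + e j x"
        unfolding e_def by (auto split: split_indicator)
    qed
    also have "\<dots> = (\<integral>x. grad_energy \<phi> x * indicator {x. \<bar>\<phi> x\<bar> \<le> L} x \<partial>M) + (\<integral>x. e j x \<partial>M)"
      by (intro Bochner_Integration.integral_add le.integrable_f_indicator e_int) measurable
    finally show ?thesis .
  qed
  have \<kappa>lim: "\<kappa> \<longlonglongrightarrow> 1"
  proof -
    have "(\<lambda>j. ((1 / 2 :: real)\<^sup>2) ^ Suc j) \<longlonglongrightarrow> 0" by (intro LIMSEQ_Suc LIMSEQ_power_zero) (simp add: power2_eq_square)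
    then have "(\<lambda>j. exp (- (((1 / 2 :: real)\<^sup>2) ^ Suc j))) \<longlonglongrightarrow> exp (- 0)" by (intro tendsto_intros)
    moreover have "\<kappa> = (\<lambda>j. exp (- (((1 / 2 :: real)\<^sup>2) ^ Suc j)))" unfolding \<kappa>_def power_mult ..
    ultimately show ?thesis by (simp only: minus_zero exp_zero)
  qed
  have elim: "(\<lambda>j. \<integral>x. e j x \<partial>M) \<longlonglongrightarrow> (\<integral>x. 0 \<partial>M)"
  proof (rule integral_dominated_convergence[where w = "grad_energy \<phi>"])
    show "AE x in M. (\<lambda>j. e j x) \<longlonglongrightarrow> 0"
    proof (rule AE_I2)
      fix x
      show "(\<lambda>j. e j x) \<longlonglongrightarrow> 0"
      proof (cases "L < \<bar>\<phi> x\<bar>")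
        case True
        define z where "z = (\<phi> x / L)\<^sup>2"
        have "1 < \<bar>\<phi> x / L\<bar>" using True L by (simp add: abs_divide)
        then have z: "1 < z" unfolding z_def by (metis one_less_power pos2 power2_abs)
        have "(\<lambda>j. inverse (z ^ Suc j)) \<longlonglongrightarrow> 0" by (intro LIMSEQ_Suc LIMSEQ_inverse_realpow_zero z)
        moreover have "\<bar>\<tau> j (\<phi> x)\<bar> \<le> inverse (z ^ Suc j)" for j
        proof -
          have "z ^ Suc j \<le> exp (z ^ Suc j)" using exp_ge_add_one_self[of "z ^ Suc j"] by linarith
          then have "inverse (exp (z ^ Suc j)) \<le> inverse (z ^ Suc j)" using z by (intro le_imp_inverse_le) auto
          moreover have "\<tau> j (\<phi> x) = inverse (exp (z ^ Suc j))" unfolding \<tau>_def z_def power_mult exp_minus ..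
          ultimately show ?thesis by simp
        qed
        ultimately have "(\<lambda>j. \<tau> j (\<phi> x)) \<longlonglongrightarrow> 0"
          by (intro Lim_null_comparison[of "\<lambda>j. \<tau> j (\<phi> x)" "\<lambda>j. inverse (z ^ Suc j)"]) auto
        then have "(\<lambda>j. \<tau> j (\<phi> x) powr N) \<longlonglongrightarrow> 0 powr N"
          using \<tau>(1) N2 by (intro tendsto_powr') (auto intro!: always_eventually less_imp_le)
        then have "(\<lambda>j. \<tau> j (\<phi> x) powr N * grad_energy \<phi> x * indicator {x. L < \<bar>\<phi> x\<bar>} x) \<longlonglongrightarrow> 0 powr N * grad_energy \<phi> x * indicator {x. L < \<bar>\<phi> x\<bar>} x"
          by (intro tendsto_mult_right)
        then show ?thesis unfolding e_def by simp
      next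
        case False
        then show ?thesis unfolding e_def by simp
      qed
    qed
    show "AE x in M. norm (e j x) \<le> grad_energy \<phi> x" for j using e_bd by (intro AE_I2)
  qed (use le.f_int in auto)
  have "(\<lambda>j. gamma1 F p \<Omega> * (\<kappa> j powr N * X powr (N / p))) \<longlonglongrightarrow> gamma1 F p \<Omega> * (1 powr N * X powr (N / p))"
    by (intro tendsto_intros \<kappa>lim) auto
  moreover have "(\<lambda>j. (\<integral>x. grad_energy \<phi> x * indicator {x. \<bar>\<phi> x\<bar> \<le> L} x \<partial>M) + (\<integral>x. e j x \<partial>M))
    \<longlonglongrightarrow> (\<integral>x. grad_energy \<phi> x * indicator {x. \<bar>\<phi> x\<bar> \<le> L} x \<partial>M) + (\<integral>x. 0 \<partial>M)"
    by (intro tendsto_intros elim)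
  ultimately have "gamma1 F p \<Omega> * (1 powr N * X powr (N / p)) \<le> (\<integral>x. grad_energy \<phi> x * indicator {x. \<bar>\<phi> x\<bar> \<le> L} x \<partial>M) + (\<integral>x. 0 \<partial>M)"
    by (rule LIMSEQ_le) (use step in auto)
  then show ?thesis unfolding X_def by simp
qed

theorem test_exp_bound:
  assumes p: "0 < p" and \<gamma>: "0 \<le> \<gamma>" "\<gamma> < gamma1 F p \<Omega>"
  obtains C :: real where "\<And>\<phi>. test_fun \<Omega> \<phi> \<Longrightarrow>
    (\<integral>x. grad_energy \<phi> x \<partial>M) \<le> 1 + \<gamma> * (\<integral>x. \<bar>\<phi> x\<bar> powr p \<partial>M) powr (N / p) \<Longrightarrow>
    (\<integral>\<^sup>+x. ennreal (exp (lambdaN F * \<bar>\<phi> x\<bar> powr (1 + q))) \<partial>M) \<le> ennreal C"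
proof -
  let ?g = "gamma1 F p \<Omega>"
  show ?thesis
  proof (rule level_inequality_exp_bound[OF q(1,2) lambdaN_pos p \<gamma> finite_M, where E = "?g / (?g - \<gamma>)"])
    fix C :: real
    assume C: "\<And>v f V. level_inequality M v f (lambdaN F) q \<Longrightarrow> (\<And>x. v x \<le> V) \<Longrightarrow>
    (\<integral>x. f x \<partial>M) \<le> 1 + \<gamma> * (\<integral>x. v x powr p \<partial>M) powr ((1 + 1 / q) / p) \<Longrightarrow> (\<integral>x. f x \<partial>M) \<le> ?g / (?g - \<gamma>) \<Longrightarrow>
    (\<And>L. 0 < L \<Longrightarrow> ?g * (\<integral>x. min (v x) (L / 2) powr p \<partial>M) powr ((1 + 1 / q) / p)
        \<le> (\<integral>x. f x * indicator {x. v x \<le> L} x \<partial>M)) \<Longrightarrow>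
    (\<integral>\<^sup>+x. ennreal (exp (lambdaN F * v x powr (1 + q))) \<partial>M) \<le> ennreal C"
    show ?thesis
    proof (rule that)
      fix \<phi> assume \<phi>: "test_fun \<Omega> \<phi>" and I: "(\<integral>x. grad_energy \<phi> x \<partial>M) \<le> 1 + \<gamma> * (\<integral>x. \<bar>\<phi> x\<bar> powr p \<partial>M) powr (N / p)"
      obtain V where V: "\<And>x. \<bar>\<phi> x\<bar> \<le> V" using test_bounded[OF \<phi>] by blast
      let ?E = "\<integral>x. grad_energy \<phi> x \<partial>M" and ?Y = "(\<integral>x. \<bar>\<phi> x\<bar> powr p \<partial>M) powr (N / p)"
      \<comment> \<open>The Lebesgue term is at most the fraction \<open>\<gamma> / ?g\<close> of
        the energy and can be absorbed; this is the origin of the bound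
        \<open>?g / (?g - \<gamma>)\<close>.\<close>
      have "\<gamma> * (?g * ?Y) \<le> \<gamma> * ?E" using gamma1_le_test[OF \<phi>, of p] \<gamma> by (intro mult_left_mono) auto
      moreover have "?g * ?E \<le> ?g * (1 + \<gamma> * ?Y)" using I \<gamma> by (intro mult_left_mono) auto
      ultimately have "(?g - \<gamma>) * ?E \<le> ?g" by (simp add: algebra_simps)
      then have "?E \<le> ?g / (?g - \<gamma>)" using \<gamma> by (simp add: field_simps)
      then show "(\<integral>\<^sup>+x. ennreal (exp (lambdaN F * \<bar>\<phi> x\<bar> powr (1 + q))) \<partial>M) \<le> ennreal C"
        using C[OF test_level_inequality[OF \<phi>] V, unfolded q(4)] I test_truncation_coercive[OF \<phi> _ p] \<gamma> by simp
    qed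
  qed
qed

end

subsection \<open>Approximation by test functions\<close>

lemma nn_integral_fatou_bound:
  fixes f :: "nat \<Rightarrow> 'a \<Rightarrow> ennreal"
  assumes f: "\<And>n. f n \<in> borel_measurable M" and lim: "AE x in M. (\<lambda>n. f n x) \<longlonglongrightarrow> h x"
    and bd: "eventually (\<lambda>n. (\<integral>\<^sup>+x. f n x \<partial>M) \<le> C) sequentially"
  shows "(\<integral>\<^sup>+x. h x \<partial>M) \<le> C"
proof -
  have "(\<integral>\<^sup>+x. h x \<partial>M) = (\<integral>\<^sup>+x. liminf (\<lambda>n. f n x) \<partial>M)"
    by (rule nn_integral_cong_AE) (use lim in \<open>auto elim!: eventually_mono dest!: lim_imp_Liminf[rotated]\<close>)
  also have "\<dots> \<le> liminf (\<lambda>n. \<integral>\<^sup>+x. f n x \<partial>M)" by (rule nn_integral_liminf[OF f])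
  also have "\<dots> \<le> limsup (\<lambda>n. \<integral>\<^sup>+x. f n x \<partial>M)" by (rule Liminf_le_Limsup) simp
  also have "\<dots> \<le> C" by (rule Limsup_bounded[OF bd])
  finally show ?thesis .
qed

context finsler_domain begin

text \<open>The approximating test functions may violate the constraint slightly, so they are
  multiplied by \<open>\<rho> < 1\<close>; Fatou's lemma passes to the limit in \<open>k\<close>,
  and once more as \<open>\<rho>\<close> tends to 1. The Lebesgue norm enters the constraint with a
  minus sign, so a lower bound along the sequence is enough, and Fatou supplies it without
  convergence in L^p.\<close>

theorem W10_exp_bound:
  assumes p: "0 < p" and \<gamma>: "0 \<le> \<gamma>" and W: "W10 N \<Omega> u g" and a: "aniso_norm F \<gamma> p \<Omega> u g \<le> 1"
    and C: "\<And>\<phi>. test_fun \<Omega> \<phi> \<Longrightarrow>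
      (\<integral>x. grad_energy \<phi> x \<partial>M) \<le> 1 + \<gamma> * (\<integral>x. \<bar>\<phi> x\<bar> powr p \<partial>M) powr (N / p) \<Longrightarrow>
      (\<integral>\<^sup>+x. ennreal (exp (lambdaN F * \<bar>\<phi> x\<bar> powr (1 + q))) \<partial>M) \<le> ennreal C"
  shows "(\<integral>\<^sup>+x. ennreal (exp (lambdaN F * \<bar>u x\<bar> powr (1 + q))) \<partial>M) \<le> ennreal C"
proof -
  interpret finite_measure M by (rule finite_M)
  have u_meas [measurable]: "u \<in> borel_measurable M" and g_meas [measurable]: "g \<in> borel_measurable M"
    using W unfolding W10_def by (auto intro: measurable_restrict_space1)
  obtain \<phi>0 where \<phi>0: "\<And>k. test_fun \<Omega> (\<phi>0 k)"
    "(\<lambda>k. \<integral>\<^sup>+ x\<in>\<Omega>. ennreal (\<bar>\<phi>0 k x - u x\<bar> powr N) \<partial>lebesgue) \<longlonglongrightarrow> 0"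
    "(\<lambda>k. \<integral>\<^sup>+ x\<in>\<Omega>. ennreal (norm (grad (\<phi>0 k) x - g x) powr N) \<partial>lebesgue) \<longlonglongrightarrow> 0"
    using W unfolding W10_def by blast
  have res: "(\<integral>\<^sup>+ x\<in>\<Omega>. h x \<partial>lebesgue) = (\<integral>\<^sup>+x. h x \<partial>M)" for h :: "real^'n \<Rightarrow> ennreal"
    by (rule nn_integral_restrict_space[symmetric]) simp
  have "eventually (\<lambda>k. (\<integral>\<^sup>+x. ennreal (\<bar>\<phi>0 k x - u x\<bar> powr N) \<partial>M) < 1) sequentially"
    "eventually (\<lambda>k. (\<integral>\<^sup>+x. ennreal (norm (grad (\<phi>0 k) x - g x) powr N) \<partial>M) < 1) sequentially"
    using \<phi>0(2,3) unfolding res by (auto intro: order_tendstoD(2))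
  then have "eventually (\<lambda>k. (\<integral>\<^sup>+x. ennreal (\<bar>\<phi>0 k x - u x\<bar> powr N) \<partial>M) < 1 \<and>
     (\<integral>\<^sup>+x. ennreal (norm (grad (\<phi>0 k) x - g x) powr N) \<partial>M) < 1) sequentially" by eventually_elim auto
  then obtain k0 where k0: "\<And>k. k \<ge> k0 \<Longrightarrow> (\<integral>\<^sup>+x. ennreal (\<bar>\<phi>0 k x - u x\<bar> powr N) \<partial>M) < 1"
    "\<And>k. k \<ge> k0 \<Longrightarrow> (\<integral>\<^sup>+x. ennreal (norm (grad (\<phi>0 k) x - g x) powr N) \<partial>M) < 1"
    unfolding eventually_sequentially by blast
  \<comment> \<open>Dropping an initial segment makes all the distances finite, hence the integrands
    integrable.\<close>
  define \<phi>1 where "\<phi>1 k = \<phi>0 (k + k0)" for k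
  have t1: "test_fun \<Omega> (\<phi>1 k)" for k unfolding \<phi>1_def by (rule \<phi>0)
  note m1 [measurable] = measurable_M[OF test_meas(1)[OF t1]] measurable_M[OF test_meas(2)[OF t1]]
  have int_u: "integrable M (\<lambda>x. \<bar>\<phi>1 k x - u x\<bar> powr N)" for k
    by (rule integrableI_nonneg) (use k0(1)[of "k + k0"] in \<open>auto simp: \<phi>1_def[symmetric] intro: less_trans\<close>)
  have int_g: "integrable M (\<lambda>x. norm (grad (\<phi>1 k) x - g x) powr N)" for k
    by (rule integrableI_nonneg) (use k0(2)[of "k + k0"] in \<open>auto simp: \<phi>1_def[symmetric] intro: less_trans\<close>)
  have to0: "(\<lambda>k. \<integral>x. h k x \<partial>M) \<longlonglongrightarrow> 0"
    if "\<And>k. integrable M (h k)" "\<And>k x. 0 \<le> h k x" "(\<lambda>k. \<integral>\<^sup>+x. ennreal (h k x) \<partial>M) \<longlonglongrightarrow> 0" for h :: "nat \<Rightarrow> real^'n \<Rightarrow> real"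
  proof -
    have "(\<integral>\<^sup>+x. ennreal (h k x) \<partial>M) = ennreal (\<integral>x. h k x \<partial>M)" for k
      using that(1,2) by (intro nn_integral_eq_integral) auto
    then have "(\<lambda>k. ennreal (\<integral>x. h k x \<partial>M)) \<longlonglongrightarrow> ennreal 0" using that(3) by simp
    then show ?thesis
      using that(2) by (subst (asm) tendsto_ennreal_iff) (auto intro!: always_eventually Bochner_Integration.integral_nonneg)
  qed
  have lim_u: "(\<lambda>k. \<integral>x. \<bar>\<phi>1 k x - u x\<bar> powr N \<partial>M) \<longlonglongrightarrow> 0"
    using LIMSEQ_ignore_initial_segment[OF \<phi>0(2), of k0] unfolding res \<phi>1_def[symmetric]
    by (intro to0 int_u) auto
  have lim_g: "(\<lambda>k. \<integral>x. norm (grad (\<phi>1 k) x - g x) powr N \<partial>M) \<longlonglongrightarrow> 0"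
    using LIMSEQ_ignore_initial_segment[OF \<phi>0(3), of k0] unfolding res \<phi>1_def[symmetric]
    by (intro to0 int_g) auto
  obtain r where r: "strict_mono r" "AE x in M. (\<lambda>k. \<bar>\<phi>1 (r k) x - u x\<bar> powr N) \<longlonglongrightarrow> 0"
    using tendsto_L1_AE_subseq[of M "\<lambda>k x. \<bar>\<phi>1 k x - u x\<bar> powr N"] int_u lim_u by auto
  define \<phi> where "\<phi> k = \<phi>1 (r k)" for k
  have t: "test_fun \<Omega> (\<phi> k)" for k unfolding \<phi>_def by (rule t1)
  note m [measurable] = measurable_M[OF test_meas(1)[OF t]] measurable_M[OF test_meas(2)[OF t]]
  have ae: "AE x in M. (\<lambda>k. \<phi> k x) \<longlonglongrightarrow> u x"
    using r(2)
  proof eventually_elim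
    case (elim x)
    have "(\<lambda>k. (\<bar>\<phi> k x - u x\<bar> powr N) powr (1 / N)) \<longlonglongrightarrow> 0 powr (1 / N)"
      using elim N2 unfolding \<phi>_def by (intro tendsto_powr' tendsto_const) auto
    moreover have "(\<bar>\<phi> k x - u x\<bar> powr N) powr (1 / N) = \<bar>\<phi> k x - u x\<bar>" for k
      using N2 by (simp add: powr_powr)
    ultimately have "(\<lambda>k. \<bar>\<phi> k x - u x\<bar>) \<longlonglongrightarrow> 0" by simp
    then show ?case by (simp add: LIM_zero_cancel tendsto_rabs_zero_iff)
  qed
  define b where "b k = (\<integral>x. norm (grad (\<phi> k) x - g x) powr N \<partial>M)" for k
  have b: "b \<longlonglongrightarrow> 0" using LIMSEQ_subseq_LIMSEQ[OF lim_g r(1)] unfolding b_def \<phi>_def o_def .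
  have int_b: "integrable M (\<lambda>x. norm (grad (\<phi> k) x - g x) powr N)" for k unfolding \<phi>_def by (rule int_g)
  obtain B where B: "0 < B" "\<And>x. F x \<le> B * norm x" using F_upper by blast
  have Fsub: "F x \<le> F y + B * norm (x - y)" for x y
    using F_triangle[of y "x - y"] B(2)[of "x - y"] by simp
  \<comment> \<open>For small \<open>s\<close> the first coefficient is close to 1, while the large
    second one multiplies a term that vanishes as \<open>k\<close> grows; hence the energies
    converge from above without loss.\<close>
  have split: "F x powr N \<le> F y powr N / (1 - s) powr (N - 1) + (B powr N / s powr (N - 1)) * norm (x - y) powr N"
    if s: "0 < s" "s < 1" for x y s
  proof -
    have "F x powr N \<le> (F y + B * norm (x - y)) powr (1 + (N - 1))"
      using Fsub[of x y] F_nonneg N2 by (simp add: powr_mono2)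
    also have "\<dots> \<le> F y powr (1 + (N - 1)) / (1 - s) powr (N - 1) + (B * norm (x - y)) powr (1 + (N - 1)) / s powr (N - 1)"
      using F_nonneg B s N2 by (intro powr_add_split) auto
    finally show ?thesis using B by (simp add: powr_mult)
  qed
  define E where "E = (\<integral>x. F (g x) powr N \<partial>M)"
  define Ek where "Ek k = (\<integral>x. grad_energy (\<phi> k) x \<partial>M)" for k
  define X where "X = (\<integral>x. \<bar>u x\<bar> powr p \<partial>M)"
  define Xk where "Xk k = (\<integral>x. \<bar>\<phi> k x\<bar> powr p \<partial>M)" for k
  have Fg [measurable]: "(\<lambda>x. F (g x)) \<in> borel_measurable M" by (rule measurable_compose[OF g_meas F_meas])
  have int_E: "integrable M (\<lambda>x. F (g x) powr N)"
  proof (rule Bochner_Integration.integrable_bound)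
    show "integrable M (\<lambda>x. grad_energy (\<phi> 0) x / (1 - 1 / 2) powr (N - 1) + (B powr N / (1 / 2) powr (N - 1)) * norm (grad (\<phi> 0) x - g x) powr N)"
      using grad_energy_integrable[OF t] int_b by (intro Bochner_Integration.integrable_add integrable_divide_zero integrable_mult_right) auto
    show "AE x in M. norm (F (g x) powr N) \<le> norm (grad_energy (\<phi> 0) x / (1 - 1 / 2) powr (N - 1) + (B powr N / (1 / 2) powr (N - 1)) * norm (grad (\<phi> 0) x - g x) powr N)"
    proof (rule AE_I2)
      fix x
      show "norm (F (g x) powr N) \<le> norm (grad_energy (\<phi> 0) x / (1 - 1 / 2) powr (N - 1) + (B powr N / (1 / 2) powr (N - 1)) * norm (grad (\<phi> 0) x - g x) powr N)"
        using split[of "1 / 2" "g x" "grad (\<phi> 0) x"] unfolding grad_energy_def by (simp add: norm_minus_commute)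
    qed
  qed measurable
  have E0: "0 \<le> E" "0 \<le> X" "0 \<le> Xk k" for k unfolding E_def X_def Xk_def by (auto intro!: Bochner_Integration.integral_nonneg)
  have Ek_le: "Ek k \<le> E / (1 - s) powr (N - 1) + B powr N / s powr (N - 1) * b k" if s: "0 < s" "s < 1" for k s
  proof -
    have "Ek k \<le> (\<integral>x. F (g x) powr N / (1 - s) powr (N - 1) + (B powr N / s powr (N - 1)) * norm (grad (\<phi> k) x - g x) powr N \<partial>M)"
      unfolding Ek_def
      by (intro integral_mono grad_energy_integrable[OF t] Bochner_Integration.integrable_add integrable_divide_zero integrable_mult_right int_E int_b)
         (use split[OF s] in \<open>auto simp: grad_energy_def\<close>)
    also have "\<dots> = E / (1 - s) powr (N - 1) + B powr N / s powr (N - 1) * b k"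
      unfolding E_def b_def using int_E int_b by (subst Bochner_Integration.integral_add) auto
    finally show ?thesis .
  qed
  have Elim: "eventually (\<lambda>k. Ek k < E + \<eta>) sequentially" if \<eta>: "0 < \<eta>" for \<eta>
  proof -
    have "((\<lambda>s. E / (1 - s) powr (N - 1)) \<longlongrightarrow> E / (1 - 0) powr (N - 1)) (at_right 0)"
      by (intro tendsto_intros) auto
    then have "eventually (\<lambda>s. E / (1 - s) powr (N - 1) < E + \<eta> / 2) (at_right 0)"
      using \<eta> by (intro order_tendstoD(2)) auto
    moreover have "eventually (\<lambda>s::real. 0 < s \<and> s < 1) (at_right 0)"
      by (rule eventually_at_rightI[of 0 1]) auto
    ultimately have "eventually (\<lambda>s. E / (1 - s) powr (N - 1) < E + \<eta> / 2 \<and> 0 < s \<and> s < 1) (at_right 0)"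
      by eventually_elim auto
    then obtain s where s: "E / (1 - s) powr (N - 1) < E + \<eta> / 2" "0 < s" "s < 1"
      using eventually_happens trivial_limit_at_right_real by blast
    have "(\<lambda>k. B powr N / s powr (N - 1) * b k) \<longlonglongrightarrow> B powr N / s powr (N - 1) * 0" by (intro tendsto_mult_left b)
    then have "eventually (\<lambda>k. B powr N / s powr (N - 1) * b k < \<eta> / 2) sequentially"
      using \<eta> by (intro order_tendstoD(2)) auto
    then show ?thesis
    proof eventually_elim
      case (elim k)
      have "Ek k \<le> E / (1 - s) powr (N - 1) + B powr N / s powr (N - 1) * b k" by (rule Ek_le[OF s(2,3)])
      also have "\<dots> < (E + \<eta> / 2) + \<eta> / 2" by (rule add_strict_mono[OF s(1) elim])
      finally show ?case by simp
    qed
  qed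
  have Xlim: "eventually (\<lambda>k. X powr (N / p) - \<eta> < Xk k powr (N / p)) sequentially" if \<eta>: "0 < \<eta>" for \<eta>
  proof (cases "X = 0")
    \<comment> \<open>This covers \<open>u\<close> outside L^p, whose Bochner integral is 0 by
      convention; the Lebesgue term then counts as 0 in the constraint too, and there is nothing to
      approximate.\<close>
    case True
    then show ?thesis using \<eta> by (intro always_eventually) (auto intro: less_le_trans[of _ 0])
  next
    case False
    then have X: "0 < X" using E0 by simp
    have intX: "integrable M (\<lambda>x. \<bar>u x\<bar> powr p)" using False not_integrable_integral_eq unfolding X_def by blast
    have "((\<lambda>y. y powr (N / p)) \<longlongrightarrow> X powr (N / p)) (at_left X)" using X by (intro tendsto_intros) auto
    then have "eventually (\<lambda>y. X powr (N / p) - \<eta> < y powr (N / p)) (at_left X)" using \<eta> by (intro order_tendstoD(1)) auto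
    moreover have "eventually (\<lambda>y. 0 < y \<and> y < X) (at_left X)" using X by (intro eventually_at_leftI[of 0]) auto
    ultimately have "eventually (\<lambda>y. X powr (N / p) - \<eta> < y powr (N / p) \<and> 0 < y \<and> y < X) (at_left X)" by eventually_elim auto
    then obtain Y where Y: "X powr (N / p) - \<eta> < Y powr (N / p)" "0 < Y" "Y < X"
      using eventually_happens trivial_limit_at_left_real by blast
    have "eventually (\<lambda>k. Y < Xk k) sequentially"
    proof -
      have nnX: "(\<integral>\<^sup>+x. ennreal (\<bar>\<phi> k x\<bar> powr p) \<partial>M) = ennreal (Xk k)" for k
      proof -
        obtain V where "0 \<le> V" "\<And>x. \<bar>\<phi> k x\<bar> \<le> V" using test_bounded[OF t] by blast
        then have "integrable M (\<lambda>x. \<bar>\<phi> k x\<bar> powr p)"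
          using p by (intro integrable_const_bound[where B = "V powr p"]) (auto intro!: AE_I2 powr_mono2)
        then show ?thesis unfolding Xk_def by (intro nn_integral_eq_integral) auto
      qed
      have "ennreal X = (\<integral>\<^sup>+x. ennreal (\<bar>u x\<bar> powr p) \<partial>M)"
        unfolding X_def using intX by (intro nn_integral_eq_integral[symmetric]) auto
      also have "\<dots> = (\<integral>\<^sup>+x. liminf (\<lambda>k. ennreal (\<bar>\<phi> k x\<bar> powr p)) \<partial>M)"
      proof (rule nn_integral_cong_AE)
        show "AE x in M. ennreal (\<bar>u x\<bar> powr p) = liminf (\<lambda>k. ennreal (\<bar>\<phi> k x\<bar> powr p))"
          using ae
        proof eventually_elim
          case (elim x)
          then have "(\<lambda>k. ennreal (\<bar>\<phi> k x\<bar> powr p)) \<longlonglongrightarrow> ennreal (\<bar>u x\<bar> powr p)"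
            using p by (intro tendsto_ennrealI tendsto_powr' tendsto_intros) auto
          then show ?case by (intro lim_imp_Liminf[symmetric]) auto
        qed
      qed
      also have "\<dots> \<le> liminf (\<lambda>k. \<integral>\<^sup>+x. ennreal (\<bar>\<phi> k x\<bar> powr p) \<partial>M)" by (rule nn_integral_liminf) measurable
      finally have "ennreal X \<le> liminf (\<lambda>k. ennreal (Xk k))" unfolding nnX .
      moreover have "ennreal Y < ennreal X" using Y by (simp add: ennreal_less_iff)
      ultimately have "ennreal Y < liminf (\<lambda>k. ennreal (Xk k))" by (rule less_le_trans[rotated])
      then have "eventually (\<lambda>k. ennreal Y < ennreal (Xk k)) sequentially" by (rule less_LiminfD)
      then show ?thesis by eventually_elim (use Y in \<open>simp add: ennreal_less_iff\<close>)
    qed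
    then show ?thesis
    proof eventually_elim
      case (elim k)
      then have "Y powr (N / p) \<le> Xk k powr (N / p)" using Y p N2 by (intro powr_mono2) auto
      then show ?case using Y(1) by linarith
    qed
  qed
  \<comment> \<open>The base of the root may be negative, so the root is not inverted; instead, a
    base above 1 would have a root above 1.\<close>
  have EX: "E - \<gamma> * X powr (N / p) \<le> 1"
  proof (rule ccontr)
    assume n: "\<not> ?thesis"
    have "(LINT x:\<Omega>|lebesgue. F (g x) powr N) = E" "(LINT x:\<Omega>|lebesgue. \<bar>u x\<bar> powr p) = X"
      unfolding E_def X_def set_lebesgue_integral_def by (rule integral_restrict_space[symmetric], simp)+
    then have "aniso_norm F \<gamma> p \<Omega> u g = (E - \<gamma> * X powr (N / p)) powr (1 / N)"
      unfolding aniso_norm_def Let_def Lp_norm_def N_eq[symmetric] by (simp add: powr_powr)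
    moreover have "1 < (E - \<gamma> * X powr (N / p)) powr (1 / N)" using n N2 by (intro gr_one_powr) auto
    ultimately show False using a by simp
  qed
  have scaled: "(\<integral>\<^sup>+x. ennreal (exp (lambdaN F * \<bar>\<rho> * u x\<bar> powr (1 + q))) \<partial>M) \<le> ennreal C" if \<rho>: "0 < \<rho>" "\<rho> < 1" for \<rho>
  proof (rule nn_integral_fatou_bound)
    show "(\<lambda>x. ennreal (exp (lambdaN F * \<bar>\<rho> * \<phi> k x\<bar> powr (1 + q)))) \<in> borel_measurable M" for k by measurable
    show "AE x in M. (\<lambda>k. ennreal (exp (lambdaN F * \<bar>\<rho> * \<phi> k x\<bar> powr (1 + q)))) \<longlonglongrightarrow> ennreal (exp (lambdaN F * \<bar>\<rho> * u x\<bar> powr (1 + q)))"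
      using ae
    proof eventually_elim
      case (elim x)
      have "(\<lambda>k. \<bar>\<rho> * \<phi> k x\<bar> powr (1 + q)) \<longlonglongrightarrow> \<bar>\<rho> * u x\<bar> powr (1 + q)"
        using q by (intro tendsto_powr' tendsto_intros elim) auto
      then show ?case by (intro tendsto_ennrealI tendsto_exp tendsto_mult_left)
    qed
    \<comment> \<open>Scaling by \<open>\<rho>\<close> multiplies the energy and the Lebesgue term
      alike by \<open>\<rho> powr N\<close>, so the unscaled difference may be as large as
      \<open>\<theta>\<close>. The slack \<open>\<theta> - 1\<close> is divided into an error
      \<open>\<eta>\<close> for the energy and \<open>\<gamma> * \<eta>\<close> for the Lebesgue
      term.\<close>
    define \<theta> where "\<theta> = \<rho> powr - N"
    have "\<rho> powr N < 1 powr N" using \<rho> N2 by (intro powr_less_mono2) auto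
    then have \<theta>: "1 < \<theta>" unfolding \<theta>_def using \<rho> by (simp add: powr_minus one_less_inverse_iff)
    define \<eta> where "\<eta> = (\<theta> - 1) / (1 + \<gamma>)"
    have "(1 + \<gamma>) * \<eta> = \<theta> - 1" unfolding \<eta>_def using \<gamma> by simp
    moreover have "0 < \<eta>" unfolding \<eta>_def using \<theta> \<gamma> by simp
    ultimately have \<eta>: "0 < \<eta>" "\<eta> + \<gamma> * \<eta> = \<theta> - 1" by (auto simp: distrib_right)
    show "eventually (\<lambda>k. (\<integral>\<^sup>+x. ennreal (exp (lambdaN F * \<bar>\<rho> * \<phi> k x\<bar> powr (1 + q))) \<partial>M) \<le> ennreal C) sequentially"
      using Elim[OF \<eta>(1)] Xlim[OF \<eta>(1)]
    proof eventually_elim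
      fix k assume k: "Ek k < E + \<eta>" "X powr (N / p) - \<eta> < Xk k powr (N / p)"
      have ts: "test_fun \<Omega> (\<lambda>x. \<rho> * \<phi> k x)" "\<And>x. grad (\<lambda>x. \<rho> * \<phi> k x) x = \<rho> *\<^sub>R grad (\<phi> k) x"
        using test_fun_scale[OF t, of \<rho>] by auto
      have "(\<integral>x. grad_energy (\<lambda>x. \<rho> * \<phi> k x) x \<partial>M) = (\<integral>x. \<rho> powr N * grad_energy (\<phi> k) x \<partial>M)"
        using \<rho> F_nonneg unfolding grad_energy_def ts(2) F_hom by (intro Bochner_Integration.integral_cong) (auto simp: powr_mult)
      also have "\<dots> = \<rho> powr N * Ek k" unfolding Ek_def by simp
      finally have e: "(\<integral>x. grad_energy (\<lambda>x. \<rho> * \<phi> k x) x \<partial>M) = \<rho> powr N * Ek k" .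
      have "(\<integral>x. \<bar>\<rho> * \<phi> k x\<bar> powr p \<partial>M) = (\<integral>x. \<rho> powr p * \<bar>\<phi> k x\<bar> powr p \<partial>M)"
        using \<rho> by (intro Bochner_Integration.integral_cong) (auto simp: abs_mult powr_mult)
      also have "\<dots> = \<rho> powr p * Xk k" unfolding Xk_def by simp
      finally have x: "(\<integral>x. \<bar>\<rho> * \<phi> k x\<bar> powr p \<partial>M) powr (N / p) = \<rho> powr N * Xk k powr (N / p)"
        using \<rho> p E0 by (simp add: powr_mult powr_powr)
      have "\<gamma> * (X powr (N / p) - \<eta>) \<le> \<gamma> * Xk k powr (N / p)" using k(2) \<gamma> by (intro mult_left_mono) auto
      then have "Ek k - \<gamma> * Xk k powr (N / p) \<le> \<theta>" using k(1) EX \<eta>(2) by (simp add: algebra_simps)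
      then have "\<rho> powr N * (Ek k - \<gamma> * Xk k powr (N / p)) \<le> \<rho> powr N * \<theta>" by (intro mult_left_mono) auto
      also have "\<dots> = 1" unfolding \<theta>_def using \<rho> by (simp add: powr_minus)
      finally show "(\<integral>\<^sup>+x. ennreal (exp (lambdaN F * \<bar>\<rho> * \<phi> k x\<bar> powr (1 + q))) \<partial>M) \<le> ennreal C"
        by (intro C[OF ts(1)]) (simp add: e x algebra_simps)
    qed
  qed
  show ?thesis
  proof (rule nn_integral_fatou_bound)
    let ?\<rho> = "\<lambda>n. 1 - 1 / (real n + 2)"
    show "(\<lambda>x. ennreal (exp (lambdaN F * \<bar>?\<rho> n * u x\<bar> powr (1 + q)))) \<in> borel_measurable M" for n by measurable
    have \<rho>: "?\<rho> \<longlonglongrightarrow> 1" by real_asymp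
    show "AE x in M. (\<lambda>n. ennreal (exp (lambdaN F * \<bar>?\<rho> n * u x\<bar> powr (1 + q)))) \<longlonglongrightarrow> ennreal (exp (lambdaN F * \<bar>u x\<bar> powr (1 + q)))"
    proof (rule AE_I2)
      fix x
      have "(\<lambda>n. \<bar>?\<rho> n * u x\<bar> powr (1 + q)) \<longlonglongrightarrow> \<bar>1 * u x\<bar> powr (1 + q)"
        using q by (intro tendsto_powr' tendsto_rabs tendsto_mult \<rho> tendsto_const) auto
      then have "(\<lambda>n. \<bar>?\<rho> n * u x\<bar> powr (1 + q)) \<longlonglongrightarrow> \<bar>u x\<bar> powr (1 + q)" by simp
      then show "(\<lambda>n. ennreal (exp (lambdaN F * \<bar>?\<rho> n * u x\<bar> powr (1 + q)))) \<longlonglongrightarrow> ennreal (exp (lambdaN F * \<bar>u x\<bar> powr (1 + q)))"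
        by (intro tendsto_ennrealI tendsto_exp tendsto_mult_left)
    qed
    show "eventually (\<lambda>n. (\<integral>\<^sup>+x. ennreal (exp (lambdaN F * \<bar>?\<rho> n * u x\<bar> powr (1 + q))) \<partial>M) \<le> ennreal C) sequentially"
      by (intro always_eventually allI scaled) auto
  qed
qed

end

theorem theorem1p1:
  fixes F :: "real^'n \<Rightarrow> real" and \<Omega> :: "(real^'n) set" and p \<gamma> :: real
  assumes "CARD('n) \<ge> 2"
    and "admissible_F F"
    and "smooth_bounded_domain \<Omega>"
    and "p > 1"
    and "0 \<le> \<gamma>" and "\<gamma> < gamma1 F p \<Omega>"
  shows "\<exists>C::real. \<forall>u g. W10 (real CARD('n)) \<Omega> u g \<and> aniso_norm F \<gamma> p \<Omega> u g \<le> 1 \<longrightarrow>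
           (\<integral>\<^sup>+ x\<in>\<Omega>. ennreal (exp (lambdaN F * \<bar>u x\<bar> powr (real CARD('n) / (real CARD('n) - 1)))) \<partial>lebesgue)
             \<le> ennreal C"
proof -
  define N where "N = real CARD('n)"
  define q where "q = 1 / (N - 1)"
  interpret finsler_domain F \<Omega> N q
    by unfold_locales (use assms in \<open>auto simp: N_def q_def smooth_bounded_domain_def\<close>)
  have p: "0 < p" using assms(4) by simp
  obtain C :: real where C: "\<And>\<phi>. test_fun \<Omega> \<phi> \<Longrightarrow>
      (\<integral>x. grad_energy \<phi> x \<partial>M) \<le> 1 + \<gamma> * (\<integral>x. \<bar>\<phi> x\<bar> powr p \<partial>M) powr (N / p) \<Longrightarrow>
      (\<integral>\<^sup>+x. ennreal (exp (lambdaN F * \<bar>\<phi> x\<bar> powr (1 + q))) \<partial>M) \<le> ennreal C"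
    using test_exp_bound[OF p assms(5,6)] by blast
  have e: "N / (N - 1) = 1 + q" unfolding q_def using N2 by (simp add: field_simps)
  have "(\<integral>\<^sup>+ x\<in>\<Omega>. ennreal (exp (lambdaN F * \<bar>u x\<bar> powr (N / (N - 1)))) \<partial>lebesgue) \<le> ennreal C"
    if "W10 N \<Omega> u g" "aniso_norm F \<gamma> p \<Omega> u g \<le> 1" for u g
  proof -
    have "(\<integral>\<^sup>+ x\<in>\<Omega>. ennreal (exp (lambdaN F * \<bar>u x\<bar> powr (N / (N - 1)))) \<partial>lebesgue)
      = (\<integral>\<^sup>+x. ennreal (exp (lambdaN F * \<bar>u x\<bar> powr (1 + q))) \<partial>M)"
      unfolding e by (rule nn_integral_restrict_space[symmetric]) simp
    also have "\<dots> \<le> ennreal C" by (rule W10_exp_bound[OF p assms(5) that]) (rule C)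
    finally show ?thesis .
  qed
  then show ?thesis unfolding N_def by blast
qed

end
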